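(* Let $G$ be a connected block graph and let $C_1,C_2$ be independent sets of $G$. Let $W_1$ and $W_2$ be the sets of vertices of $G$ that are rigid for $C_1$ and for $C_2$, respectively. Then $C_1$ is reachable from $C_2$ if and only if $W_1=W_2$ and for every connected component $H$ of $G-W_1$ we have $|C_1\cap V(H)|=|C_2\cap V(H)|$.
   Context: All graphs are finite, simple and undirected. A cut-vertex of a graph is a vertex whose removal increases the number of connected components. A block of $G$ is a maximal set $S\subseteq V(G)$ such that $G[S]$ is 2-connected (connected without cut-vertices of its own). A block graph is a graph every block of which induces a clique. For a connected block graph $G$: $V_{cut}(G)$ is its set of cut-vertices, $\mathcal{B}(G)$ its set of blocks, $\mathcal{B}_u(G)$ the set of blocks containing $u$, and $K_B(G)=B\cap V_{cut}(G)$. For $u\in V_{cut}(G)$ and $B\in\mathcal{B}_u(G)$, $G[u,B]$ is the connected component containing $u$ of the graph obtained from $G$ by deleting all edges $uv$ with $v\in B$, and $G[B,u]$ is the connected component containing $u$ of the graph obtained from $G$ by deleting all edges $uv$ with $v\notin B$. Let $\mathcal{P}_G=\{(u,B),(B,u): u\in V_{cut}(G),B\in\mathcal{B}_u(G)\}$; for $p\in\{(u,B),(B,u)\}$, $u$ is the base of $p$ and $G[p]$ denotes $G[u,B]$ resp. $G[B,u]$. Let $\beta(u,B)=\mathcal{B}_u(G[u,B])$ and $\kappa(B,u)=K_B(G[B,u])$. For $p\in\mathcal{P}_G$ with base $u$, a $p$-independent set is a set $C\subseteq V(G[p])$ that is independent in $G$, and $C^\circ=C\setminus\{u\}$; for any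 set $S$ and $q\in\mathcal{P}_G$, $S[q]=S\cap V(G[q])$. Depth: $d(B,u)=0$ if $\kappa(B,u)=\emptyset$, otherwise $d(B,u)=1+\max_{v\in\kappa(B,u)}d(v,B)$; and $d(u,B)=1+\max_{B'\in\beta(u,B)}d(B',u)$. Boolean $ua(p)$ (True counts as 1 and False as 0 in arithmetic): if $d(p)=0$ then $ua(p)=$True; if $d(B,u)>0$ then $ua(B,u)$ is False exactly when $ua(v,B)=$True for all $v\in\kappa(B,u)$ and $B=\kappa(B,u)\cup\{u\}$; $ua(u,B)$ is True exactly when $ua(B',u)=$True for some $B'\in\beta(u,B)$. Capacity of a $p$-independent set $C$: if $p=(B,u)$, $cap(C)=\sum_{v\in\kappa(B,u)}cap(C[v,B])+ua(B,u)-|B\cap C^\circ|$; if $p=(u,B)$, $cap(C)=0$ if some $B'\in\beta(u,B)$ has $cap(C[B',u])=0$ and $ua(B',u)=$True, and otherwise $cap(C)=\sum_{B'\in\beta(u,B)}(cap(C[B',u])-ua(B',u))+ua(u,B)$. Reachability: for independent sets $I_1,I_2$, $I_1\rightarrow I_2$ if $I_1=I_2$ or $I_1\setminus I_2=\{v_1\}$, $I_2\setminus I_1=\{v_2\}$ with $v_1v_2\in E(G)$; $I'$ is reachable from $I$ if $I=I_0\rightarrow\cdots\rightarrow I_k=I'$ for some independent sets, $k\ge0$. Potential: for an independent set $C$ of $G$ and $p\in\mathcal{P}_G$, $pot_G(C,p)=\max\{cap(C'[p])+|C'[p]^\circ|-|C[p]^\circ| : C'$ an independent set of $G$ reachable from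 $C\}$. Rigidity: $u\in V_{cut}(G)$ is rigid for $C$ if there exist two distinct blocks $B,B'\in\mathcal{B}_u(G)$ with $pot_G(C,(B,u))=pot_G(C,(B',u))=0$ and $ua(B,u)=ua(B',u)=$True. *)

theory Defs
  imports Main "Graph_Theory.Digraph_Component"
begin

text \<open>
  Finite simple undirected graphs are the symmetric digraphs of the locale \<^locale>\<open>graph\<close>, in which
  an edge \<open>uv\<close> is a pair of opposite arcs.  On such graphs \<^const>\<open>pre_digraph.sccs\<close> is the set of
  connected components.
\<close>

section \<open>Blocks and block graphs\<close>

definition cut_vertices :: "('a, 'b) pre_digraph \<Rightarrow> 'a set" where
  "cut_vertices G = {v \<in> verts G.
     card (pre_digraph.sccs (pre_digraph.del_vert G v)) > card (pre_digraph.sccs G)}"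

text \<open>One vertex and two adjacent vertices also form 2-connected graphs in this sense.\<close>

definition two_connected :: "('a, 'b) pre_digraph \<Rightarrow> bool" where
  "two_connected G \<longleftrightarrow> Digraph_Component.connected G \<and> cut_vertices G = {}"

definition blocks :: "('a, 'b) pre_digraph \<Rightarrow> 'a set set" where
  "blocks G = {S. S \<subseteq> verts G \<and> two_connected (G \<restriction> S) \<and>
     (\<forall>T. S \<subset> T \<and> T \<subseteq> verts G \<longrightarrow> \<not> two_connected (G \<restriction> T))}"

definition blocks_at :: "('a, 'b) pre_digraph \<Rightarrow> 'a \<Rightarrow> 'a set set" where
  "blocks_at G u = {B \<in> blocks G. u \<in> B}"

definition clique :: "('a, 'b) pre_digraph \<Rightarrow> 'a set \<Rightarrow> bool" where
  "clique G S \<longleftrightarrow> S \<subseteq> verts G \<and> (\<forall>u\<in>S. \<forall>v\<in>S. u \<noteq> v \<longrightarrow> u \<rightarrow>\<^bsub>G\<^esub> v)"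

definition block_graph :: "('a, 'b) pre_digraph \<Rightarrow> bool" where
  "block_graph G \<longleftrightarrow> graph G \<and> (\<forall>B\<in>blocks G. clique G B)"

section \<open>The subgraphs cut out by a vertex and a block\<close>

text \<open>
  \<open>VB u B\<close> and \<open>BV B u\<close> stand for the pairs \<open>(u, B)\<close> and \<open>(B, u)\<close>.  All notions below are meant for
  a cut-vertex \<open>u\<close> of \<open>G\<close> and a block \<open>B\<close> of \<open>G\<close> containing \<open>u\<close>.
\<close>

datatype 'a vb_pair = VB 'a "'a set" | BV "'a set" 'a

fun base :: "'a vb_pair \<Rightarrow> 'a" where
  "base (VB u B) = u"
| "base (BV B u) = u"

definition del_edges :: "('a, 'b) pre_digraph \<Rightarrow> 'a \<Rightarrow> 'a set \<Rightarrow> ('a, 'b) pre_digraph" where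
  "del_edges G u S =
     G\<lparr>arcs := {e \<in> arcs G. \<not> (\<exists>v\<in>S. arc_to_ends G e = (u, v) \<or> arc_to_ends G e = (v, u))}\<rparr>"

definition component_of :: "('a, 'b) pre_digraph \<Rightarrow> 'a \<Rightarrow> ('a, 'b) pre_digraph" where
  "component_of G u = G \<restriction> pre_digraph.scc_of G u"

fun part :: "('a, 'b) pre_digraph \<Rightarrow> 'a vb_pair \<Rightarrow> ('a, 'b) pre_digraph" where
  "part G (VB u B) = component_of (del_edges G u B) u"
| "part G (BV B u) = component_of (del_edges G u (verts G - B)) u"

definition beta :: "('a, 'b) pre_digraph \<Rightarrow> 'a \<Rightarrow> 'a set \<Rightarrow> 'a set set" where
  "beta G u B = blocks_at (part G (VB u B)) u"

definition kappa :: "('a, 'b) pre_digraph \<Rightarrow> 'a set \<Rightarrow> 'a \<Rightarrow> 'a set" where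
  "kappa G B u = B \<inter> cut_vertices (part G (BV B u))"

definition independent :: "('a, 'b) pre_digraph \<Rightarrow> 'a set \<Rightarrow> bool" where
  "independent G C \<longleftrightarrow> C \<subseteq> verts G \<and> (\<forall>u\<in>C. \<forall>v\<in>C. \<not> u \<rightarrow>\<^bsub>G\<^esub> v)"

section \<open>Depth, \<open>ua\<close> and capacity\<close>

text \<open>
  The three recursions are specified as partial functions.  If \<open>G\<close> is a connected block graph,
  \<open>u\<close> a cut-vertex and \<open>B\<close> a block containing \<open>u\<close>, they terminate on \<open>VB u B\<close> and on \<open>BV B u\<close>:
  for \<open>v\<close> in \<open>kappa G B u\<close>, \<open>part G (VB v B)\<close> is a subgraph of \<open>part G (BV B u)\<close> that avoids \<open>u\<close>,
  and for \<open>B'\<close> in \<open>beta G u B\<close>, \<open>part G (BV B' u)\<close> is a subgraph of \<open>part G (VB u B)\<close>.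
\<close>

function (domintros) depth :: "('a, 'b) pre_digraph \<Rightarrow> 'a vb_pair \<Rightarrow> nat" where
  "depth G (BV B u) =
     (if kappa G B u = {} then 0 else 1 + Max ((\<lambda>v. depth G (VB v B)) ` kappa G B u))"
| "depth G (VB u B) = 1 + Max ((\<lambda>B'. depth G (BV B' u)) ` beta G u B)"
  by pat_completeness auto

function (domintros) ua :: "('a, 'b) pre_digraph \<Rightarrow> 'a vb_pair \<Rightarrow> bool" where
  "ua G (BV B u) =
     (if depth G (BV B u) = 0 then True
      else \<not> ((\<forall>v\<in>kappa G B u. ua G (VB v B)) \<and> B = kappa G B u \<union> {u}))"
| "ua G (VB u B) =
     (if depth G (VB u B) = 0 then True
      else (\<exists>B'\<in>beta G u B. ua G (BV B' u)))"
  by pat_completeness auto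

text \<open>\<open>cap G p C\<close> is the capacity of the \<open>p\<close>-independent set \<open>C\<close>.\<close>

function (domintros) cap :: "('a, 'b) pre_digraph \<Rightarrow> 'a vb_pair \<Rightarrow> 'a set \<Rightarrow> int" where
  "cap G (BV B u) C =
     (\<Sum>v\<in>kappa G B u. cap G (VB v B) (C \<inter> verts (part G (VB v B))))
       + of_bool (ua G (BV B u)) - int (card (B \<inter> (C - {u})))"
| "cap G (VB u B) C =
     (if \<exists>B'\<in>beta G u B. cap G (BV B' u) (C \<inter> verts (part G (BV B' u))) = 0 \<and> ua G (BV B' u)
      then 0
      else (\<Sum>B'\<in>beta G u B. cap G (BV B' u) (C \<inter> verts (part G (BV B' u)))
               - of_bool (ua G (BV B' u)))
             + of_bool (ua G (VB u B)))"
  by pat_completeness auto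

section \<open>Reconfiguration, potential and rigidity\<close>

definition step :: "('a, 'b) pre_digraph \<Rightarrow> 'a set \<Rightarrow> 'a set \<Rightarrow> bool" where
  "step G I J \<longleftrightarrow> independent G I \<and> independent G J \<and>
     (I = J \<or> (\<exists>v1 v2. I - J = {v1} \<and> J - I = {v2} \<and> v1 \<rightarrow>\<^bsub>G\<^esub> v2))"

text \<open>\<open>reachable_from G I J\<close>: the independent set \<open>J\<close> is reachable from the independent set \<open>I\<close>.\<close>

definition reachable_from :: "('a, 'b) pre_digraph \<Rightarrow> 'a set \<Rightarrow> 'a set \<Rightarrow> bool" where
  "reachable_from G I J \<longleftrightarrow> independent G I \<and> (step G)\<^sup>*\<^sup>* I J"

definition pot :: "('a, 'b) pre_digraph \<Rightarrow> 'a set \<Rightarrow> 'a vb_pair \<Rightarrow> int" where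
  "pot G C p = Max ((\<lambda>C'. cap G p (C' \<inter> verts (part G p))
       + int (card (C' \<inter> verts (part G p) - {base p}))
       - int (card (C \<inter> verts (part G p) - {base p}))) ` {C'. reachable_from G C C'})"

definition rigid :: "('a, 'b) pre_digraph \<Rightarrow> 'a set \<Rightarrow> 'a \<Rightarrow> bool" where
  "rigid G C u \<longleftrightarrow> u \<in> cut_vertices G \<and>
     (\<exists>B\<in>blocks_at G u. \<exists>B'\<in>blocks_at G u. B \<noteq> B' \<and>
        pot G C (BV B u) = 0 \<and> pot G C (BV B' u) = 0 \<and> ua G (BV B u) \<and> ua G (BV B' u))"

end

theory Submission
  imports Defs
begin

text \<open>
  A vertex is rigid for \<open>C\<close> exactly if every configuration reachable from \<open>C\<close> has at least two
  tokens in its closed neighbourhood. One direction holds because capacities are nonnegative and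
  a block \<open>B\<close> at \<open>u\<close> without tokens off \<open>u\<close> has capacity at least \<open>ua(B,u)\<close>; for the other, one shows
  that tokens inside \<open>G[B,u]\<close> can vacate \<open>B\<close> as soon as the capacity is at least \<open>ua(B,u)\<close>.
  Hence rigid vertices are never entered, the components of \<open>G - W\<close> evolve independently, and in
  each of them the configuration is fluid: every vertex can be loosened, that is, some
  reachable configuration has at most one token in its closed neighbourhood. Any two fluid
  configurations of the same size on a connected block graph are mutually reachable, by induction
  on the graph: move a token into an end block hanging at \<open>w\<close>, park it there, and delete the end
  blocks at \<open>w\<close>; the remaining configuration is again fluid.
\<close>

section \<open>Token sliding inside a vertex set\<close>

text \<open>The last claim, that the remaining configuration is again fluid, is the obstacle. A
  sequence that loosens a vertex of the smaller graph may use \<open>w\<close> and the end blocks as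
  extra room, or pull the parked token out again, so sliding in the larger graph does not simply
  restrict to the smaller one. The way around it is to let two claims feed each other in a single
  induction over connected vertex sets: parking preserves fluidity (\<open>parkable\<close>), and
  fluid configurations of equal size reach each other (\<open>linked\<close>). For this reason every
  sliding notion carries the vertex set \<open>X\<close> in which the tokens live. Block graphs
  enter that induction only through \<open>bg\<close>, a condition on the neighbours of a single
  vertex; blocks themselves are needed only for the capacities, which in turn meet the sliding part
  only through \<open>rig\<close>, a notion of rigidity that is free of capacities.\<close>

locale ugraph =
  fixes V :: "'a set" and E :: "'a \<Rightarrow> 'a \<Rightarrow> bool"
  assumes finite_V: "finite V"
    and sym: "E a b \<Longrightarrow> E b a"
    and irr: "\<not> E a a"
    and E_V: "E a b \<Longrightarrow> a \<in> V"
begin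

text \<open>Reflexive also at points outside \<open>S\<close>, so membership of the starting point
  is a separate hypothesis wherever it matters.\<close>

definition conn :: "'a set \<Rightarrow> 'a \<Rightarrow> 'a \<Rightarrow> bool" where
  "conn S = (\<lambda>x y. x \<in> S \<and> y \<in> S \<and> E x y)\<^sup>*\<^sup>*"

definition cn :: "'a set \<Rightarrow> bool" where
  "cn S \<longleftrightarrow> (\<forall>a\<in>S. \<forall>b\<in>S. conn S a b)"

definition ind :: "'a set \<Rightarrow> bool" where
  "ind C \<longleftrightarrow> (\<forall>a\<in>C. \<forall>b\<in>C. \<not> E a b)"

definition nb :: "'a \<Rightarrow> 'a set" where
  "nb u = insert u {v. E u v}"

definition mv :: "'a set \<Rightarrow> 'a set \<Rightarrow> 'a set \<Rightarrow> bool" where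
  "mv X I J \<longleftrightarrow> I \<subseteq> X \<and> J \<subseteq> X \<and> ind I \<and> ind J \<and>
     (\<exists>a b. a \<in> I \<and> b \<notin> I \<and> E a b \<and> J = insert b (I - {a}))"

definition reach :: "'a set \<Rightarrow> 'a set \<Rightarrow> 'a set \<Rightarrow> bool" where
  "reach X I J \<longleftrightarrow> I \<subseteq> X \<and> ind I \<and> (mv X)\<^sup>*\<^sup>* I J"

text \<open>The threshold is 2 because a vertex with exactly one token in its closed neighbourhood
  can be entered by that token (\<open>one_token_move\<close>), while with two tokens it cannot be
  entered at all (\<open>reach_avoid\<close>).\<close>

definition rig :: "'a set \<Rightarrow> 'a set \<Rightarrow> 'a set" where
  "rig X C = {u \<in> X. \<forall>D. reach X C D \<longrightarrow> 2 \<le> card (nb u \<inter> D)}"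

definition fluid :: "'a set \<Rightarrow> 'a set \<Rightarrow> bool" where
  "fluid X C \<longleftrightarrow> C \<subseteq> X \<and> ind C \<and> rig X C = {}"

lemma E_V2: "E a b \<Longrightarrow> b \<in> V"
  using sym E_V by blast

lemma finite_sub: "X \<subseteq> V \<Longrightarrow> finite X"
  using finite_subset[OF _ finite_V] .

lemma finite_nb: "finite (nb u)"
proof -
  have "nb u \<subseteq> insert u V"
    unfolding nb_def using E_V2 by auto
  then show ?thesis
    using finite_V finite_subset by blast
qed

lemma ind_subset: "ind C \<Longrightarrow> D \<subseteq> C \<Longrightarrow> ind D"
  unfolding ind_def by blast

lemma conn_refl [simp]: "conn S a a"
  unfolding conn_def by simp

lemma conn_sym: "conn S a b \<Longrightarrow> conn S b a"
  unfolding conn_def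
proof (induction rule: rtranclp_induct)
  case (step y z)
  then show ?case
    using sym converse_rtranclp_into_rtranclp[of "\<lambda>x y. x \<in> S \<and> y \<in> S \<and> E x y" z y a] by simp
qed simp

lemma conn_trans: "conn S a b \<Longrightarrow> conn S b c \<Longrightarrow> conn S a c"
  unfolding conn_def by (rule rtranclp_trans)

lemma cn_from:
  assumes "\<And>y. y \<in> S \<Longrightarrow> conn S w y"
  shows "cn S"
  unfolding cn_def using assms conn_sym conn_trans by meson

lemma conn_edge: "a \<in> S \<Longrightarrow> b \<in> S \<Longrightarrow> E a b \<Longrightarrow> conn S a b"
  unfolding conn_def by (simp add: r_into_rtranclp)

lemma conn_mono: "conn S a b \<Longrightarrow> S \<subseteq> T \<Longrightarrow> conn T a b"
  unfolding conn_def
  by (erule mono_rtranclp[rule_format, rotated]) auto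

text \<open>The standard way to trap a path: no edge of \<open>S\<close> leaves \<open>T\<close>, so
  the path stays in \<open>T\<close>, and the second conclusion keeps the confined path for later
  use.\<close>

lemma conn_closed:
  assumes "conn S a b" "a \<in> T" "\<And>x y. x \<in> T \<Longrightarrow> x \<in> S \<Longrightarrow> y \<in> S \<Longrightarrow> E x y \<Longrightarrow> y \<in> T"
  shows "b \<in> T \<and> conn (S \<inter> T) a b"
  using assms(1)[unfolded conn_def]
proof (induction rule: rtranclp_induct)
  case base
  then show ?case using assms(2) by simp
next
  case (step y z)
  then have "z \<in> T" using assms(3) by blast
  moreover have "conn (S \<inter> T) y z"
    using step calculation by (intro conn_edge) auto
  ultimately show ?case using step conn_trans by blast
qed

lemma conn_in: "conn S a b \<Longrightarrow> a \<in> S \<Longrightarrow> b \<in> S"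
  using conn_closed[of S a b S] by blast

lemma mvE:
  assumes "mv X I J"
  obtains a b where "a \<in> I" "b \<notin> I" "a \<in> X" "b \<in> X" "E a b" "J = insert b (I - {a})"
    "I \<subseteq> X" "J \<subseteq> X" "ind I" "ind J"
  using assms unfolding mv_def by blast

lemma mvI:
  assumes "a \<in> I" "b \<notin> I" "E a b" "I \<subseteq> X" "b \<in> X" "ind I" "ind (insert b (I - {a}))"
  shows "mv X I (insert b (I - {a}))"
  using assms unfolding mv_def by blast

lemma mv_sym: "mv X I J \<Longrightarrow> mv X J I"
proof -
  assume "mv X I J"
  then obtain a b where *: "I \<subseteq> X" "J \<subseteq> X" "ind I" "ind J" "a \<in> I" "b \<notin> I" "E a b"
      "J = insert b (I - {a})"
    unfolding mv_def by blast
  then have "I = insert a (J - {b})" "a \<notin> J" "b \<in> J" "E b a"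
    using irr sym by auto
  then show ?thesis unfolding mv_def using * by blast
qed

lemma reach_refl: "I \<subseteq> X \<Longrightarrow> ind I \<Longrightarrow> reach X I I"
  unfolding reach_def by simp

lemma reach_mv: "mv X I J \<Longrightarrow> reach X I J"
  unfolding reach_def by (metis mv_def r_into_rtranclp)

lemma reach_step: "reach X I J \<Longrightarrow> mv X J K \<Longrightarrow> reach X I K"
  unfolding reach_def by (meson rtranclp.rtrancl_into_rtrancl)

lemma reach_induct [consumes 1, case_names base step]:
  assumes "reach X I J" "I \<subseteq> X \<Longrightarrow> ind I \<Longrightarrow> P I"
    "\<And>J K. reach X I J \<Longrightarrow> mv X J K \<Longrightarrow> P J \<Longrightarrow> P K"
  shows "P J"
proof -
  have "(mv X)\<^sup>*\<^sup>* I J" "I \<subseteq> X" "ind I" using assms(1) unfolding reach_def by auto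
  then show ?thesis
    by (induction rule: rtranclp_induct) (use assms in \<open>auto simp: reach_def\<close>)
qed

lemma reach_in: "reach X I J \<Longrightarrow> J \<subseteq> X \<and> ind J"
  by (induction rule: reach_induct) (auto simp: mv_def reach_def)

lemma reach_in0: "reach X I J \<Longrightarrow> I \<subseteq> X \<and> ind I"
  by (auto simp: reach_def)

lemma reach_trans: "reach X I J \<Longrightarrow> reach X J K \<Longrightarrow> reach X I K"
  unfolding reach_def by auto

lemma reach_sym: "reach X I J \<Longrightarrow> reach X J I"
proof (induction rule: reach_induct)
  case base
  then show ?case by (simp add: reach_refl)
next
  case (step J K)
  then show ?case using reach_mv mv_sym reach_trans by blast
qed

lemma reach_mono: "reach X I J \<Longrightarrow> X \<subseteq> Y \<Longrightarrow> reach Y I J"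
proof (induction rule: reach_induct)
  case (step J K)
  then have "mv Y J K" unfolding mv_def by blast
  then show ?case using step reach_step by blast
qed (auto simp: reach_def)

lemma card_mv: "finite I \<Longrightarrow> mv X I J \<Longrightarrow> card J = card I"
  unfolding mv_def
  by (metis Diff_iff card_Suc_Diff1 card_insert_disjoint finite_Diff)

lemma reach_card: "reach X I J \<Longrightarrow> X \<subseteq> V \<Longrightarrow> card J = card I"
proof (induction rule: reach_induct)
  case (step J K)
  then have "finite J" using reach_in[of X I J] finite_V by (meson finite_subset)
  then show ?case using step card_mv by simp
qed simp

text \<open>Frozen tokens without edges to \<open>X\<close> never obstruct sliding inside
  \<open>X\<close>. This is how moves in separate regions are run one after the other.\<close>

lemma reach_Un:
  assumes "reach X I J" "X \<union> K \<subseteq> Z" "X \<inter> K = {}" "ind K"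
    "\<And>x k. x \<in> X \<Longrightarrow> k \<in> K \<Longrightarrow> \<not> E x k"
  shows "reach Z (I \<union> K) (J \<union> K)"
proof -
  have un: "ind (L \<union> K)" if L: "L \<subseteq> X" "ind L" for L
    unfolding ind_def
  proof (intro ballI)
    fix a b assume "a \<in> L \<union> K" "b \<in> L \<union> K"
    then consider "a \<in> L" "b \<in> L" | "a \<in> K" "b \<in> K" | "a \<in> X" "b \<in> K" | "a \<in> K" "b \<in> X"
      using L(1) by blast
    then show "\<not> E a b"
      using L(2) assms(4,5) sym unfolding ind_def by cases blast+
  qed
  show ?thesis
    using assms(1)
  proof (induction rule: reach_induct)
    case base
    then show ?case
      using assms un[of I] reach_in0[OF assms(1)] by (intro reach_refl) auto
  next
    case (step J L)
    then obtain a b where *: "a \<in> J" "b \<notin> J" "E a b" "L = insert b (J - {a})" "J \<subseteq> X" "L \<subseteq> X"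
        "ind J" "ind L"
      unfolding mv_def by blast
    have "a \<notin> K" "b \<notin> K" using * assms(3) by auto
    then have eq: "L \<union> K = insert b (J \<union> K - {a})" using * by auto
    have "mv Z (J \<union> K) (L \<union> K)"
      using * assms(2) \<open>b \<notin> K\<close> un[of J] un[of L] unfolding eq by (intro mvI) auto
    then show ?case using step reach_step by blast
  qed
qed

text \<open>Without edges between \<open>X\<close> and the rest of \<open>Z\<close>, each move
  either takes place inside \<open>X\<close> or leaves the tokens of \<open>X\<close> alone.\<close>

lemma reach_proj:
  assumes "reach Z I J" "X \<subseteq> Z" "\<And>x z. x \<in> X \<Longrightarrow> z \<in> Z - X \<Longrightarrow> \<not> E x z"
  shows "reach X (I \<inter> X) (J \<inter> X)"
  using assms(1)
proof (induction rule: reach_induct)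
  case base
  show ?case using reach_in0[OF assms(1)] ind_subset by (intro reach_refl) auto
next
  case (step J K)
  then obtain a b where *: "a \<in> J" "b \<notin> J" "E a b" "K = insert b (J - {a})" "J \<subseteq> Z" "K \<subseteq> Z"
      "ind J" "ind K"
    unfolding mv_def by blast
  show ?case
  proof (cases "a \<in> X")
    case True
    then have "b \<in> X" using * assms(3) by blast
    then have eq: "K \<inter> X = insert b (J \<inter> X - {a})" using * by auto
    have "mv X (J \<inter> X) (K \<inter> X)"
      using * True \<open>b \<in> X\<close> ind_subset[of J "J \<inter> X"] ind_subset[of K "K \<inter> X"]
      unfolding eq by (intro mvI) auto
    then show ?thesis using step reach_step by blast
  next
    case False
    then have "b \<notin> X" using * assms(3) sym by blast
    then have "K \<inter> X = J \<inter> X" using * False by auto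
    then show ?thesis using step by simp
  qed
qed

lemma reach_Union:
  assumes "finite F" "\<And>X. X \<in> F \<Longrightarrow> reach X (I \<inter> X) (J \<inter> X)"
    "\<And>X Y x y. X \<in> F \<Longrightarrow> Y \<in> F \<Longrightarrow> X \<noteq> Y \<Longrightarrow> x \<in> X \<Longrightarrow> y \<in> Y \<Longrightarrow> x \<noteq> y \<and> \<not> E x y"
  shows "reach (\<Union>F) (I \<inter> \<Union>F) (J \<inter> \<Union>F)"
  using assms
proof (induction F rule: finite_induct)
  case empty
  then show ?case by (simp add: reach_refl ind_def)
next
  case (insert X F)
  have dis: "x \<noteq> y \<and> \<not> E x y" if "x \<in> X" "y \<in> \<Union>F" for x y
    using insert.prems(2)[of X] insert.hyps(2) that by blast
  have 1: "reach (\<Union>F) (I \<inter> \<Union>F) (J \<inter> \<Union>F)"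
    by (rule insert.IH) (use insert.prems in blast)+
  have 2: "reach X (I \<inter> X) (J \<inter> X)" using insert by simp
  have i: "ind (I \<inter> \<Union>F)" "ind (J \<inter> X)" using reach_in0[OF 1] reach_in[OF 2] by auto
  have "reach (X \<union> \<Union>F) (I \<inter> X \<union> I \<inter> \<Union>F) (J \<inter> X \<union> I \<inter> \<Union>F)"
    by (rule reach_Un[OF 2 _ _ i(1)]) (use dis in blast)+
  moreover have "reach (X \<union> \<Union>F) (I \<inter> \<Union>F \<union> J \<inter> X) (J \<inter> \<Union>F \<union> J \<inter> X)"
    by (rule reach_Un[OF 1 _ _ i(2)]) (use dis sym in blast)+
  then have "reach (X \<union> \<Union>F) (J \<inter> X \<union> I \<inter> \<Union>F) (J \<inter> X \<union> J \<inter> \<Union>F)"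
    by (simp only: Un_commute[of _ "J \<inter> X"])
  ultimately have "reach (X \<union> \<Union>F) (I \<inter> X \<union> I \<inter> \<Union>F) (J \<inter> X \<union> J \<inter> \<Union>F)"
    by (rule reach_trans)
  then show ?case by (simp add: Int_Un_distrib)
qed

text \<open>A vertex with two tokens in its closed neighbourhood cannot be entered.\<close>

lemma reach_avoid:
  assumes "reach X C D" "U \<subseteq> X"
    "\<And>D u. reach (X - U) C D \<Longrightarrow> u \<in> U \<Longrightarrow> 2 \<le> card (nb u \<inter> D)"
    "C \<inter> U = {}"
  shows "reach (X - U) C D"
  using assms(1)
proof (induction rule: reach_induct)
  case base
  then show ?case using assms reach_in0[OF assms(1)] by (intro reach_refl) auto
next
  case (step J K)
  then obtain a b where *: "a \<in> J" "b \<notin> J" "E a b" "K = insert b (J - {a})" "J \<subseteq> X" "K \<subseteq> X"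
      "ind J" "ind K"
    unfolding mv_def by blast
  have "b \<notin> U"
  proof
    assume "b \<in> U"
    then have "2 \<le> card (nb b \<inter> J)" using step assms(3) by blast
    \<comment> \<open>After the move \<open>b\<close> is occupied and the result is independent, so
      the token that moved was the only one near \<open>b\<close>.\<close>
    moreover have "nb b \<inter> J \<subseteq> {a}"
      using * unfolding nb_def ind_def by auto
    then have "card (nb b \<inter> J) \<le> 1" using card_mono[of "{a}"] by fastforce
    ultimately show False by simp
  qed
  then have "mv (X - U) J K"
    using * reach_in[OF step(3)] unfolding mv_def by blast
  then show ?case using step reach_step by blast
qed

text \<open>An occupied vertex has only its own token in its closed neighbourhood, hence fewer than
  two.\<close>

lemma rig_empty_reach:
  assumes "C \<subseteq> X" "ind C" shows "C \<inter> rig X C = {}"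
proof -
  have False if u: "u \<in> C" "u \<in> rig X C" for u
  proof -
    have "2 \<le> card (nb u \<inter> C)" using u reach_refl[OF assms] unfolding rig_def by blast
    moreover have "nb u \<inter> C = {u}"
      using assms u unfolding nb_def ind_def by auto
    ultimately show False by simp
  qed
  then show ?thesis by blast
qed

lemma rig_reach: "reach X C D \<Longrightarrow> rig X C = rig X D"
  unfolding rig_def using reach_trans reach_sym by blast

lemma reach_rig:
  assumes "reach X C D"
  shows "reach (X - rig X C) C D"
proof (rule reach_avoid[OF assms])
  show "C \<inter> rig X C = {}" using rig_empty_reach reach_in0[OF assms] by blast
  show "2 \<le> card (nb u \<inter> D)" if "reach (X - rig X C) C D" "u \<in> rig X C" for D u
    using that reach_mono[of "X - rig X C" C D X] unfolding rig_def by blast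
qed (auto simp: rig_def)

lemma fluid_reach: "fluid X C \<Longrightarrow> reach X C D \<Longrightarrow> fluid X D"
  unfolding fluid_def using reach_in rig_reach by blast

text \<open>Erasing tokens keeps a sliding sequence legal: subsets of independent sets are
  independent, and the moves of erased tokens are skipped.\<close>

lemma reach_ghost:
  assumes "reach X I J" "I' \<subseteq> I"
  shows "\<exists>J'\<subseteq>J. reach X I' J'"
  using assms(1)
proof (induction rule: reach_induct)
  case base
  then show ?case using assms(2) ind_subset[of I I'] reach_refl[of I' X] by auto
next
  case (step J K)
  then obtain J' where J': "J' \<subseteq> J" "reach X I' J'" by blast
  from step obtain a b where *: "a \<in> J" "b \<notin> J" "E a b" "K = insert b (J - {a})" "J \<subseteq> X" "K \<subseteq> X"
      "ind J" "ind K"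
    unfolding mv_def by blast
  show ?case
  proof (cases "a \<in> J'")
    case True
    let ?K = "insert b (J' - {a})"
    have K: "?K \<subseteq> K" using * J' by auto
    then have "ind ?K" "ind J'" using * J' ind_subset by blast+
    then have "mv X J' ?K"
      using * J' True by (intro mvI) auto
    then show ?thesis using J' K reach_step[of X I' J' ?K] by blast
  next
    case False
    then have "J' \<subseteq> K" using * J' by auto
    then show ?thesis using J' by blast
  qed
qed

lemma fluidD: "fluid X C \<Longrightarrow> u \<in> X \<Longrightarrow> \<exists>D. reach X C D \<and> card (nb u \<inter> D) \<le> 1"
  unfolding fluid_def rig_def by (auto simp: not_le) fastforce

lemma fluidI:
  assumes "C \<subseteq> X" "ind C" "\<And>u. u \<in> X \<Longrightarrow> \<exists>D. reach X C D \<and> card (nb u \<inter> D) \<le> 1"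
  shows "fluid X C"
  unfolding fluid_def rig_def using assms by force

text \<open>A move changes the number of tokens in a closed neighbourhood by at most one, so on the way
  from no token to some token there is a configuration with exactly one.\<close>

lemma reach_first_one:
  assumes "reach X C D" "nb u \<inter> C = {}" "nb u \<inter> D \<noteq> {}"
  shows "\<exists>D'. reach X C D' \<and> card (nb u \<inter> D') = 1"
proof -
  have "nb u \<inter> D = {} \<or> (\<exists>D'. reach X C D' \<and> card (nb u \<inter> D') = 1)"
    using assms(1)
  proof (induction rule: reach_induct)
    case (step J K)
    then consider "nb u \<inter> J = {}" | "\<exists>D'. reach X C D' \<and> card (nb u \<inter> D') = 1" by blast
    then show ?case
    proof cases
      case 1
      obtain a b where "K = insert b (J - {a})" using step unfolding mv_def by blast
      then have "nb u \<inter> K \<subseteq> {b}" using 1 by auto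
      then have "nb u \<inter> K = {} \<or> nb u \<inter> K = {b}" by auto
      moreover have "reach X C K" using step reach_step by blast
      ultimately show ?thesis by (metis card_1_singleton_iff One_nat_def)
    qed blast
  qed (use assms in blast)
  then show ?thesis using assms by blast
qed

text \<open>The only token that could obstruct entering \<open>u\<close> is the one that makes the
  move.\<close>

lemma one_token_move:
  assumes "reach X C D" "card (nb u \<inter> D) = 1" "u \<in> X"
  shows "\<exists>D'. reach X C D' \<and> u \<in> D'"
proof (cases "u \<in> D")
  case False
  from assms obtain v where v: "nb u \<inter> D = {v}" using card_1_singletonE by blast
  then have "E v u" "v \<in> D" using False sym unfolding nb_def by auto
  moreover have "ind (insert u (D - {v}))"
    using reach_in[OF assms(1)] v sym irr unfolding ind_def nb_def by auto
  ultimately have "mv X D (insert u (D - {v}))"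
    using False reach_in[OF assms(1)] assms(3) unfolding mv_def by blast
  then show ?thesis using assms reach_step by blast
qed (use assms in blast)

text \<open>Induction along a path from an occupied vertex. When \<open>y\<close> is occupied, its
  neighbour \<open>z\<close> has some token nearby, whereas another reachable configuration has at
  most one there; hence some configuration has exactly one, and that token steps onto
  \<open>z\<close>. The token arriving at \<open>u\<close> need not be the one that started.\<close>

lemma fluid_occupied:
  assumes "fluid X C" "C \<noteq> {}" "cn X" "u \<in> X"
  shows "\<exists>D. reach X C D \<and> u \<in> D"
proof -
  from assms obtain c where c: "c \<in> C" "c \<in> X" unfolding fluid_def by blast
  have "(\<lambda>x y. x \<in> X \<and> y \<in> X \<and> E x y)\<^sup>*\<^sup>* c u"
    using assms c unfolding cn_def conn_def by blast
  then show ?thesis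
  proof (induction rule: rtranclp_induct)
    case base
    then show ?case using assms(1) c reach_refl unfolding fluid_def by blast
  next
    case (step y z)
    then obtain D where D: "reach X C D" "y \<in> D" by blast
    obtain D' where D': "reach X C D'" "card (nb z \<inter> D') \<le> 1"
      using fluidD assms(1) step by blast
    have "\<exists>D''. reach X C D'' \<and> card (nb z \<inter> D'') = 1"
    proof (cases "card (nb z \<inter> D') = 1")
      case False
      then have "nb z \<inter> D' = {}" using D' finite_nb by (simp add: le_Suc_eq)
      moreover have "nb z \<inter> D \<noteq> {}" using step D sym unfolding nb_def by auto
      ultimately show ?thesis
        using reach_first_one[of X D' D z] D D' reach_trans reach_sym by blast
    qed (use D' in blast)
    then show ?case using one_token_move step by blast
  qed
qed

section \<open>Fluid configurations\<close>

definition comp :: "'a set \<Rightarrow> 'a \<Rightarrow> 'a set" where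
  "comp S x = {v. conn S x v}"

lemma comp_self: "x \<in> comp S x"
  unfolding comp_def by simp

lemma comp_subset: "x \<in> S \<Longrightarrow> comp S x \<subseteq> S"
  unfolding comp_def using conn_in by blast

lemma comp_edge: "x \<in> S \<Longrightarrow> a \<in> comp S x \<Longrightarrow> b \<in> S \<Longrightarrow> E a b \<Longrightarrow> b \<in> comp S x"
  unfolding comp_def
  using conn_in[of S x a] conn_edge[of a S b] conn_trans[of S x a b] by blast

lemma comp_conn:
  assumes "x \<in> S" "a \<in> comp S x" shows "conn (comp S x) x a"
proof -
  have "a \<in> comp S x \<and> conn (S \<inter> comp S x) x a"
    using assms comp_edge[of x S] comp_self[of x S] unfolding comp_def
    by (intro conn_closed) auto
  then show ?thesis using conn_mono by blast
qed

lemma comp_cn: "x \<in> S \<Longrightarrow> cn (comp S x)"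
  unfolding cn_def by (meson comp_conn conn_sym conn_trans)

lemma cn_ex_edge:
  assumes "cn X" "a \<in> X" "b \<in> X" "a \<in> T" "b \<notin> T"
  shows "\<exists>x y. x \<in> X \<and> x \<in> T \<and> y \<in> X \<and> y \<notin> T \<and> E x y"
  using conn_closed[of X a b T] assms unfolding cn_def by blast

text \<open>In terms of blocks: all blocks of \<open>X\<close> at \<open>w\<close> except at most one are end blocks, and
  \<open>A\<close> is what lies beyond the exceptional one.\<close>

definition pendant :: "'a set \<Rightarrow> 'a \<Rightarrow> 'a set \<Rightarrow> bool" where
  "pendant X w A \<longleftrightarrow> w \<in> X \<and> A \<subseteq> X - {w} \<and> cn A \<and> X - A - {w} \<noteq> {} \<and>
     (\<forall>a\<in>A. \<forall>b\<in>X - A. E a b \<longrightarrow> b = w) \<and> (\<forall>b\<in>X - A - {w}. E w b) \<and>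
     (\<forall>a\<in>X - A - {w}. \<forall>b\<in>X - A - {w}. \<forall>c\<in>X - A - {w}. E a b \<longrightarrow> E b c \<longrightarrow> a \<noteq> c \<longrightarrow> E a c)"

text \<open>Two tokens beyond \<open>A\<close> block each other forever: a token can leave the end
  blocks only through \<open>w\<close>, and the other one is adjacent to \<open>w\<close>. Thus
  \<open>w\<close> would keep two tokens nearby, against fluidity.\<close>

lemma pendant_one_token:
  assumes p: "pendant X w A" and "fluid X C" "a \<in> C" "b \<in> C" "a \<notin> A" "b \<notin> A"
  shows "a = b"
proof (rule ccontr)
  assume ab: "a \<noteq> b"
  let ?L = "X - A - {w}"
  have wL: "E w x" if "x \<in> ?L" for x using p that unfolding pendant_def by blast
  have Lc: "y \<in> ?L \<or> y = w" if "x \<in> ?L" "E x y" "y \<in> X" for x y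
    using p that sym unfolding pendant_def by blast
  have C: "C \<subseteq> X" "ind C" using assms unfolding fluid_def by auto
  have "\<exists>a b. a \<noteq> b \<and> a \<in> D \<inter> ?L \<and> b \<in> D \<inter> ?L" if "reach X C D" for D
    using that
  proof (induction rule: reach_induct)
    case base
    have "a \<noteq> w" "b \<noteq> w" using C ab assms wL sym unfolding ind_def by blast+
    then show ?case using ab assms C by blast
  next
    case (step J K)
    then obtain a b where ab: "a \<noteq> b" "a \<in> J \<inter> ?L" "b \<in> J \<inter> ?L" by blast
    from step(2) obtain p q where pq: "p \<in> J" "q \<notin> J" "q \<in> X" "E p q" "K = insert q (J - {p})" "ind K"
      by (rule mvE)
    have q: "q \<in> ?L" if "p \<in> ?L" "x \<in> J \<inter> ?L" "x \<noteq> p" for x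
    proof -
      have "x \<in> K" "q \<in> K" using that pq by auto
      then have "q \<noteq> w" using pq(6) wL that(2) unfolding ind_def by blast
      then show ?thesis using Lc that(1) pq by blast
    qed
    have old: "x \<in> K" if "x \<in> J" "x \<noteq> p" for x using that pq by blast
    have new: "q \<in> K" using pq by blast
    consider "p = a" | "p = b" | "p \<noteq> a" "p \<noteq> b" by blast
    then show ?case
    proof cases
      case 1
      then have "q \<in> ?L" using q[of b] ab by blast
      moreover have "b \<in> K \<inter> ?L" "q \<noteq> b" using ab old[of b] 1 pq(2) by auto
      ultimately show ?thesis using new by blast
    next
      case 2
      then have "q \<in> ?L" using q[of a] ab by blast
      moreover have "a \<in> K \<inter> ?L" "q \<noteq> a" using ab old[of a] 2 pq(2) by auto
      ultimately show ?thesis using new by blast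
    next
      case 3
      then show ?thesis using old ab by blast
    qed
  qed
  moreover obtain D where D: "reach X C D" "card (nb w \<inter> D) \<le> 1"
    using fluidD[OF assms(2), of w] p unfolding pendant_def by blast
  ultimately obtain a b where ab: "a \<noteq> b" "a \<in> D \<inter> ?L" "b \<in> D \<inter> ?L" by blast
  then have "{a, b} \<subseteq> nb w \<inter> D" using wL unfolding nb_def by blast
  then have "card {a, b} \<le> card (nb w \<inter> D)" using finite_nb by (intro card_mono) auto
  then show False using ab D by simp
qed

text \<open>Rigid vertices are never entered, so a sequence loosening \<open>u\<close> stays outside
  them and projects to \<open>Z\<close>, a union of components of what is left.\<close>

lemma fluid_comp:
  assumes "ind C" "C \<subseteq> X" "Z \<subseteq> X - rig X C"
    "\<And>x z. x \<in> Z \<Longrightarrow> z \<in> X - rig X C - Z \<Longrightarrow> \<not> E x z"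
  shows "fluid Z (C \<inter> Z)"
proof (rule fluidI)
  show "C \<inter> Z \<subseteq> Z" "ind (C \<inter> Z)" using assms(1) ind_subset by auto
  fix u assume u: "u \<in> Z"
  then obtain D where D: "reach X C D" "card (nb u \<inter> D) \<le> 1"
    using assms(3) unfolding rig_def by fastforce
  have "reach Z (C \<inter> Z) (D \<inter> Z)"
    using reach_proj[OF reach_rig[OF D(1)] assms(3)] assms(4) by blast
  moreover have "card (nb u \<inter> (D \<inter> Z)) \<le> card (nb u \<inter> D)"
    using finite_nb by (intro card_mono) auto
  ultimately show "\<exists>D. reach Z (C \<inter> Z) D \<and> card (nb u \<inter> D) \<le> 1"
    using D le_trans by blast
qed

definition parkable :: "'a set \<Rightarrow> bool" where
  "parkable X \<longleftrightarrow> (\<forall>w A C l. pendant X w A \<longrightarrow> fluid X C \<longrightarrow> l \<in> C \<longrightarrow> l \<in> X - A - {w} \<longrightarrow>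
     fluid A (C - {l}))"

definition linked :: "'a set \<Rightarrow> bool" where
  "linked X \<longleftrightarrow> (\<forall>C D. fluid X C \<longrightarrow> fluid X D \<longrightarrow> card C = card D \<longrightarrow> reach X C D)"

text \<open>Since \<open>w\<close> is outside \<open>A\<close>, \<open>pendant_one_token\<close>
  puts all other tokens into \<open>A\<close>, where \<open>l\<close> has no neighbour. So the token
  on \<open>w\<close> can slide to \<open>l\<close>, and \<open>parkable\<close> applies to the
  result.\<close>

lemma park_at_apex:
  assumes pk: "parkable X" and p: "pendant X w A" and fl: "fluid X D" and "w \<in> D" and l: "l \<in> X - A - {w}"
  shows "D - {w} \<subseteq> A" "l \<notin> D" "reach X D (insert l (D - {w}))" "fluid A (D - {w})"
proof -
  have pp: "w \<notin> A" "\<And>a. a \<in> A \<Longrightarrow> \<not> E a l" "E w l"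
    using p l unfolding pendant_def by blast+
  show sub: "D - {w} \<subseteq> A"
    using pendant_one_token[OF p fl, of w] assms(4) pp by blast
  then show lD: "l \<notin> D" using l by blast
  have D: "D \<subseteq> X" "ind D" using fl unfolding fluid_def by auto
  have "ind (insert l (D - {w}))"
    unfolding ind_def
  proof (intro ballI)
    fix a b assume "a \<in> insert l (D - {w})" "b \<in> insert l (D - {w})"
    then have "a = l \<or> a \<in> A \<and> a \<in> D" "b = l \<or> b \<in> A \<and> b \<in> D" using sub by auto
    then show "\<not> E a b" using pp(2) irr sym D(2) unfolding ind_def by blast
  qed
  then have "mv X D (insert l (D - {w}))"
    using assms(4) lD pp D l by (intro mvI) auto
  then show r: "reach X D (insert l (D - {w}))" by (rule reach_mv)
  have "fluid A (insert l (D - {w}) - {l})"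
    using pk p fluid_reach[OF fl r] l unfolding parkable_def by blast
  moreover have "insert l (D - {w}) - {l} = D - {w}" using lD by auto
  ultimately show "fluid A (D - {w})" by simp
qed

text \<open>If no token is in the pendant part, the first token that enters \<open>w\<close> is the one to omit.\<close>

lemma pendant_remove_token:
  assumes pk: "parkable X" and p: "pendant X w A" and fl: "fluid X D" and "D \<noteq> {}" and "cn X"
    and XV: "X \<subseteq> V"
  shows "\<exists>F\<subseteq>D. fluid A F \<and> Suc (card F) = card D"
proof -
  have D: "D \<subseteq> X" "ind D" using fl unfolding fluid_def by auto
  have fD: "finite D" using D XV finite_sub by blast
  obtain l where l: "l \<in> X - A - {w}" using p unfolding pendant_def by blast
  have A: "A \<subseteq> X" "w \<notin> A" "w \<in> X" using p unfolding pendant_def by auto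
  show ?thesis
  proof (cases "D \<subseteq> A")
    case False
    then obtain t where t: "t \<in> D" "t \<notin> A" by blast
    have "fluid A (D - {t})"
    proof (cases "t = w")
      case True
      then show ?thesis using park_at_apex[OF pk p fl] t l by blast
    next
      case False
      then show ?thesis using pk p fl t D unfolding parkable_def by blast
    qed
    moreover have "Suc (card (D - {t})) = card D" using card_Suc_Diff1[OF fD t(1)] .
    ultimately show ?thesis by (intro exI[of _ "D - {t}"]) auto
  next
    case True
    obtain D' where D': "reach X D D'" "w \<in> D'"
      using fluid_occupied[OF fl assms(4) assms(5)] A by blast
    have "reach A D D' \<or> (\<exists>J x. reach A D J \<and> x \<in> J \<and> mv X J (insert w (J - {x})))"
      using D'(1)
    proof (induction rule: reach_induct)
      case base
      then show ?case using True reach_refl by blast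
    next
      case (step J K)
      then consider "reach A D J" | "\<exists>J x. reach A D J \<and> x \<in> J \<and> mv X J (insert w (J - {x}))" by blast
      then show ?case
      proof cases
        case 1
        from step(2) obtain a b where ab: "a \<in> J" "b \<notin> J" "a \<in> X" "b \<in> X" "E a b" "K = insert b (J - {a})"
            "J \<subseteq> X" "K \<subseteq> X" "ind J" "ind K"
          by (rule mvE)
        have JA: "J \<subseteq> A" using reach_in 1 by blast
        show ?thesis
        proof (cases "b \<in> A")
          case True
          then have "mv A J K" unfolding ab(6) using ab JA by (intro mvI) auto
          then show ?thesis using 1 reach_step by blast
        next
          case False
          have "b = w" using p[unfolded pendant_def] ab(1,4,5) JA False by (meson DiffI subsetD)
          then have "mv X J (insert w (J - {a}))" using step(2) ab(6) by simp
          then show ?thesis using 1 ab(1) by blast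
        qed
      qed blast
    qed
    moreover have "\<not> reach A D D'" using reach_in D'(2) A by blast
    ultimately obtain J x where J: "reach A D J" "x \<in> J" "mv X J (insert w (J - {x}))" by blast
    let ?K = "insert w (J - {x})"
    have JA: "J \<subseteq> A" using reach_in J by blast
    have "reach X D ?K" by (rule reach_step[OF reach_mono[OF J(1)] J(3)]) (rule A)
    then have "fluid X ?K" by (rule fluid_reach[OF fl])
    then have "fluid A (?K - {w})" using park_at_apex[OF pk p _ _ l] by blast
    moreover have "?K - {w} = J - {x}" using JA A by auto
    ultimately have fJ: "fluid A (J - {x})" by simp
    \<comment> \<open>Played backwards from \<open>J\<close> to \<open>D\<close> without the token
      on \<open>x\<close>, the sequence ends in a subset of \<open>D\<close>; fluidity and size are
      carried along.\<close>
    obtain F where F: "F \<subseteq> D" "reach A (J - {x}) F"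
      using reach_ghost[OF reach_sym[OF J(1)], of "J - {x}"] by blast
    have AV: "A \<subseteq> V" using A XV by blast
    have "finite J" using JA AV by (intro finite_sub) simp
    then have "Suc (card F) = card D"
      using reach_card[OF F(2) AV] reach_card[OF J(1) AV] card_Suc_Diff1[OF _ J(2)] by simp
    then show ?thesis using F fJ fluid_reach by blast
  qed
qed

end

section \<open>Block graphs by a local condition, and the induction on vertex sets\<close>

text \<open>\<open>bg\<close> expresses that blocks are cliques without mentioning blocks: two
  neighbours of \<open>w\<close> that stay joined when \<open>w\<close> is removed lie on a cycle
  through \<open>w\<close> (see \<open>bgraph_from_biconn\<close>). In this form the condition also
  serves subsets of \<open>V\<close>, by monotonicity of \<open>conn\<close>.\<close>

locale bgraph = ugraph +
  assumes bg: "E w a \<Longrightarrow> E w b \<Longrightarrow> a \<noteq> b \<Longrightarrow> conn (V - {w}) a b \<Longrightarrow> E a b"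
begin

text \<open>Among all pairs \<open>(w, A)\<close> where \<open>A\<close> is empty or a component of \<open>X - w\<close> that leaves something
  over, one with \<open>A\<close> as large as possible is pendant.\<close>

lemma ex_pendant:
  assumes XV: "X \<subseteq> V" and cX: "cn X" and xy: "x0 \<in> X" "y0 \<in> X" "x0 \<noteq> y0"
  shows "\<exists>w A. pendant X w A"
proof -
  define P where "P = (\<lambda>(w, A). w \<in> X \<and> A \<subseteq> X - {w} \<and> cn A \<and> X - A - {w} \<noteq> {} \<and>
     (\<forall>a\<in>A. \<forall>b\<in>X - A. E a b \<longrightarrow> b = w))"
  have fX: "finite X" using XV by (rule finite_sub)
  have "P (x0, {})" using xy unfolding P_def cn_def by auto
  moreover have "\<forall>q. P q \<longrightarrow> card (snd q) < Suc (card X)"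
    using fX card_mono[of X] unfolding P_def by (auto simp: less_Suc_eq_le)
  ultimately obtain q where q: "P q" "\<And>q'. P q' \<Longrightarrow> card (snd q') \<le> card (snd q)"
    using ex_has_greatest_nat[of P "(x0, {})" "card \<circ> snd" "Suc (card X)"] by auto
  obtain w A where qw: "q = (w, A)" by (cases q)
  have w: "w \<in> X" "A \<subseteq> X - {w}" "cn A" "X - A - {w} \<noteq> {}"
    and cl: "\<And>a b. a \<in> A \<Longrightarrow> b \<in> X - A \<Longrightarrow> E a b \<Longrightarrow> b = w"
    using q(1) unfolding qw P_def by auto
  have mx: "card A' \<le> card A" if "P (w', A')" for w' A' using q(2)[OF that] qw by simp
  let ?L = "X - A - {w}"
  have Lc: "y \<in> ?L \<or> y = w" if "x \<in> ?L" "E x y" "y \<in> X" for x y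
    using cl[of y x] that sym by blast
  have adj: "E w z" if z: "z \<in> ?L" for z
  proof (rule ccontr)
    assume nz: "\<not> E w z"
    let ?N = "{z \<in> ?L. \<not> E w z}"
    obtain x y where x: "x \<in> ?N" and y: "y \<in> X" "y \<notin> ?N" "E x y"
      using cn_ex_edge[OF cX, of z w ?N] z nz w by blast
    have "y \<noteq> w" using x y sym by blast
    then have yL: "y \<in> ?L" "E w y" using Lc[of x y] x y by blast+
    \<comment> \<open>Moving the apex from \<open>w\<close> to \<open>y\<close> yields a better
      pair: the component of \<open>w\<close> contains \<open>A\<close> and \<open>w\<close>, but
      misses \<open>x\<close>, because otherwise \<open>bg\<close> at \<open>y\<close> would make
      \<open>w\<close> and \<open>x\<close> adjacent.\<close>
    let ?A = "comp (X - {y}) w"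
    have wy: "w \<in> X - {y}" using yL w by blast
    have "conn (X - {y}) w a" if a: "a \<in> A" for a
    proof -
      obtain a1 c where "a1 \<in> A" "c \<in> X" "c \<notin> A" "E a1 c"
        using cn_ex_edge[OF cX, of a w A] a w by blast
      then have a1: "a1 \<in> A" "E a1 w" using cl[of a1 c] by auto
      have "conn A a1 a" using w a a1 unfolding cn_def by blast
      then have "conn (X - {y}) a1 a" using w yL by (elim conn_mono) blast
      moreover have "conn (X - {y}) w a1" using wy a1 w yL sym by (intro conn_edge) auto
      ultimately show ?thesis using conn_trans by blast
    qed
    then have sub: "insert w A \<subseteq> ?A" unfolding comp_def by auto
    have "x \<notin> ?A"
    proof
      assume "x \<in> ?A"
      then have "conn (V - {y}) w x"
        unfolding comp_def using conn_mono[of "X - {y}" w x "V - {y}"] XV by blast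
      then show False using bg[of y w x] x y yL sym by blast
    qed
    moreover have "x \<noteq> y" using x yL by blast
    ultimately have "X - ?A - {y} \<noteq> {}" using x by blast
    moreover have "cn ?A" "?A \<subseteq> X - {y}" using comp_cn[OF wy] comp_subset[OF wy] .
    moreover have "\<forall>a\<in>?A. \<forall>b\<in>X - ?A. E a b \<longrightarrow> b = y" using comp_edge[OF wy] by blast
    ultimately have "P (y, ?A)" unfolding P_def using yL by simp
    then have "card ?A \<le> card A" by (rule mx)
    moreover have "finite ?A" using finite_subset[OF comp_subset[OF wy]] fX by simp
    then have "card (insert w A) \<le> card ?A" using sub by (rule card_mono)
    moreover have "finite A" "w \<notin> A" using finite_subset[OF w(2)] w(2) fX by auto
    ultimately show False by simp
  qed
  have tr: "E a c" if "a \<in> ?L" "b \<in> ?L" "c \<in> ?L" "E a b" "E b c" "a \<noteq> c" for a b c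
  proof -
    have "a \<noteq> b" "c \<noteq> b" "w \<noteq> b" using that irr by auto
    \<comment> \<open>Here \<open>bg\<close> is applied with the middle vertex \<open>b\<close> as
      centre; the detour from \<open>a\<close> to \<open>c\<close> goes through
      \<open>w\<close>.\<close>
    then have "conn (V - {b}) a w" "conn (V - {b}) w c"
      using that adj sym XV w by (auto intro!: conn_edge)
    then have "conn (V - {b}) a c" by (rule conn_trans)
    then show ?thesis using bg[of b a c] that sym by blast
  qed
  show ?thesis
    unfolding pendant_def
  proof (intro exI[of _ w] exI[of _ A] conjI ballI impI)
    show "E a c" if "a \<in> ?L" "b \<in> ?L" "c \<in> ?L" "E a b" "E b c" "a \<noteq> c" for a b c
      using tr[OF that] .
  qed (use w cl adj in blast)+
qed

text \<open>If parking a token at \<open>l\<close> made some vertices of \<open>A\<close> rigid, let \<open>U\<close> be the set of these and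
  \<open>Z\<close> the component of \<open>A - U\<close> next to \<open>w\<close>. Consider the first configuration \<open>D\<close> in \<open>X\<close>
  loosening some \<open>u \<in> U\<close>. Until then the components of \<open>X - U\<close> do not interact, and on \<open>Z\<close>
  the part of \<open>D\<close> in \<open>Z \<union> (X - A)\<close> can be imitated by a subset \<open>F\<close> of \<open>D\<close> with \<open>l\<close> still parked;
  so \<open>u\<close> could be loosened inside \<open>A\<close>.\<close>

lemma parkable_step:
  assumes XV: "X \<subseteq> V" and cX: "cn X"
    and IH: "\<And>Y. Y \<subset> X \<Longrightarrow> cn Y \<Longrightarrow> parkable Y \<and> linked Y"
  shows "parkable X"
  unfolding parkable_def
proof (intro allI impI)
  fix w A C l
  assume p: "pendant X w A" and fl: "fluid X C" and lC: "l \<in> C" and l: "l \<in> X - A - {w}"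
  have pp: "w \<in> X" "A \<subseteq> X - {w}" "cn A" "\<And>a b. a \<in> A \<Longrightarrow> b \<in> X - A \<Longrightarrow> E a b \<Longrightarrow> b = w"
      "\<And>b. b \<in> X - A - {w} \<Longrightarrow> E w b"
      "\<And>a b c. a \<in> X - A - {w} \<Longrightarrow> b \<in> X - A - {w} \<Longrightarrow> c \<in> X - A - {w} \<Longrightarrow>
         E a b \<Longrightarrow> E b c \<Longrightarrow> a \<noteq> c \<Longrightarrow> E a c"
    using p unfolding pendant_def by blast+
  define S where "S = C - {l}"
  have C: "C \<subseteq> X" "ind C" using fl unfolding fluid_def by auto
  have S: "S \<subseteq> A" "ind S"
    using pendant_one_token[OF p fl, of l] lC l ind_subset[OF C(2), of S] unfolding S_def by blast+
  have Cl: "C = insert l S" "l \<notin> S" "l \<notin> A" using lC l unfolding S_def by auto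
  define U where "U = rig A S"
  have UA: "U \<subseteq> A" unfolding U_def rig_def by blast
  have SU: "S \<inter> U = {}" unfolding U_def using rig_empty_reach S by blast
  have "U = {}"
  proof (rule ccontr)
    assume "U \<noteq> {}"
    then obtain u0 where u0: "u0 \<in> U" by blast
    obtain D' where D': "reach X C D'" "card (nb u0 \<inter> D') \<le> 1"
      using fluidD[OF fl, of u0] u0 UA pp by blast
    have "\<exists>D u. reach (X - U) C D \<and> u \<in> U \<and> \<not> 2 \<le> card (nb u \<inter> D)"
    proof (rule ccontr)
      assume *: "\<not> ?thesis"
      have "reach (X - U) C D'"
        by (rule reach_avoid[OF D'(1)]) (use * UA pp SU Cl in auto)
      then show False using * u0 D'(2) by fastforce
    qed
    then obtain D u where D: "reach (X - U) C D" and u: "u \<in> U" "\<not> 2 \<le> card (nb u \<inter> D)" by blast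
    \<comment> \<open>\<open>K\<close> is what \<open>A - U\<close> retains of the neighbours of
      \<open>w\<close>. By \<open>bg\<close> these are pairwise adjacent, so at most one component
      \<open>Z\<close> of \<open>A - U\<close> touches \<open>w\<close>. Then \<open>Y\<close> is
      the component of \<open>w\<close> in \<open>X - U\<close>, and \<open>R\<close> is the
      rest.\<close>
    define K where "K = {k \<in> A - U. E w k}"
    define Z where "Z = {x \<in> A - U. \<exists>k\<in>K. conn (A - U) k x}"
    define Y where "Y = Z \<union> (X - A)"
    define R where "R = A - U - Z"
    have Z: "Z \<subseteq> A - U" "K \<subseteq> Z" unfolding Z_def K_def using conn_refl by blast+
    have Zcl: "y \<in> Z" if "x \<in> Z" "y \<in> A - U" "E x y" for x y
      using that conn_trans conn_edge[of x "A - U" y] unfolding Z_def by blast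
    have ZR: "\<not> E x z" "\<not> E z x" if "x \<in> Z" "z \<in> R" for x z
      using that Zcl sym unfolding R_def by blast+
    have ZL: "\<not> E x z" if "x \<in> Z" "z \<in> X - A - {w}" for x z
      using that pp(4) Z by blast
    have YR: "\<not> E x z" "\<not> E z x" if "x \<in> Y" "z \<in> R" for x z
    proof -
      show "\<not> E x z"
      proof
        assume e: "E x z"
        show False
        proof (cases "x \<in> Z")
          case False
          then have "x \<in> X - A" "z \<in> A" using that unfolding Y_def R_def by auto
          then have "x = w" using pp(4)[of z x] e sym by blast
          then have "z \<in> K" using e that unfolding K_def R_def by blast
          then show False using Z that unfolding R_def by blast
        qed (use ZR that e in blast)
      qed
      then show "\<not> E z x" using sym by blast
    qed
    have XU: "X - U = Y \<union> R" "Y \<inter> R = {}" unfolding Y_def R_def using Z UA pp by auto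
    have KK: "conn Z k k'" if "k \<in> K" "k' \<in> K" for k k'
    proof (cases "k = k'")
      case False
      have "conn A k k'" using pp(3) that unfolding K_def cn_def by blast
      then have "conn (V - {w}) k k'" using pp XV by (elim conn_mono) blast
      then have "E k k'" using bg[of w k k'] that False unfolding K_def by blast
      then show ?thesis using Z that by (intro conn_edge) auto
    qed simp
    have Zk: "\<exists>k\<in>K. conn Z k x" if "x \<in> Z" for x
    proof -
      obtain k where k: "k \<in> K" "conn (A - U) k x" using \<open>x \<in> Z\<close> unfolding Z_def by blast
      have "conn ((A - U) \<inter> Z) k x"
        using conn_closed[OF k(2), of Z] Zcl k(1) Z by blast
      then show ?thesis using k conn_mono by blast
    qed
    have cZ: "cn Z" unfolding cn_def using Zk KK conn_trans conn_sym by meson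
    have ZX: "Z \<subset> X" "Y \<subset> X" "Y \<subseteq> X" "w \<in> Y" "w \<notin> Z"
      using Z u0 UA pp unfolding Y_def by blast+
    have "conn Y w x" if "x \<in> Y" for x
    proof (cases "x \<in> Z")
      case True
      then obtain k where k: "k \<in> K" "conn Z k x" using Zk by blast
      have "conn Y w k" using k(1) Z ZX unfolding K_def Y_def by (intro conn_edge) auto
      moreover have "conn Y k x" using k(2) unfolding Y_def by (elim conn_mono) blast
      ultimately show ?thesis using conn_trans by blast
    next
      case False
      show ?thesis
      proof (cases "x = w")
        case False
        then have "E w x" using \<open>x \<notin> Z\<close> that pp(5)[of x] unfolding Y_def by blast
        then show ?thesis using that ZX by (intro conn_edge) auto
      qed simp
    qed
    then have cY: "cn Y" unfolding cn_def using conn_trans conn_sym by meson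
    have YZ: "Y - Z = X - A" unfolding Y_def using Z by auto
    have pY: "pendant Y w Z"
      unfolding pendant_def YZ
    proof (intro conjI ballI impI)
      show "w \<in> Y" "cn Z" using ZX cZ by auto
      show "Z \<subseteq> Y - {w}" using ZX unfolding Y_def by blast
      show "X - A - {w} \<noteq> {}" using l by blast
      show "b = w" if "a \<in> Z" "b \<in> X - A" "E a b" for a b
        using pp(4)[of a b] that Z by blast
      show "E w b" if "b \<in> X - A - {w}" for b using pp(5)[OF that] .
      show "E a c" if "a \<in> X - A - {w}" "b \<in> X - A - {w}" "c \<in> X - A - {w}" "E a b" "E b c" "a \<noteq> c"
        for a b c using pp(6)[OF that] .
    qed
    have YV: "Y \<subseteq> V" using ZX XV by blast
    have flZ: "fluid Z (S \<inter> Z)"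
    proof (rule fluid_comp[OF S(2) S(1)])
      show "Z \<subseteq> A - rig A S" using Z unfolding U_def by simp
      show "\<not> E x z" if "x \<in> Z" "z \<in> A - rig A S - Z" for x z
        using ZR that unfolding R_def U_def by blast
    qed
    have CY: "C \<inter> Y = insert l (S \<inter> Z)"
      using S l Cl SU unfolding Y_def by auto
    have rY: "reach Y (C \<inter> Y) (D \<inter> Y)"
      using YR XU by (intro reach_proj[OF D]) auto
    have rR: "reach R (S \<inter> R) (D \<inter> R)"
    proof -
      have "reach R (C \<inter> R) (D \<inter> R)"
        using YR XU by (intro reach_proj[OF D]) auto
      moreover have "C \<inter> R = S \<inter> R" using Cl unfolding R_def by auto
      ultimately show ?thesis by simp
    qed
    have "\<exists>F\<subseteq>D. reach Z (S \<inter> Z) F"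
    proof (cases "w \<in> rig Y (C \<inter> Y)")
      case True
      have "reach (Y - {w}) (C \<inter> Y) (D \<inter> Y)"
        by (rule reach_mono[OF reach_rig[OF rY]]) (use True in blast)
      then have "reach Z (C \<inter> Y \<inter> Z) (D \<inter> Y \<inter> Z)"
        using ZL ZX unfolding Y_def by (elim reach_proj) auto
      moreover have "C \<inter> Y \<inter> Z = S \<inter> Z" unfolding CY using l Z by auto
      ultimately have "reach Z (S \<inter> Z) (D \<inter> Y \<inter> Z)" by simp
      then show ?thesis by (intro exI[of _ "D \<inter> Y \<inter> Z"]) auto
    next
      case False
      have "fluid Y (C \<inter> Y)"
      proof (rule fluidI)
        show i: "ind (C \<inter> Y)" using C(2) ind_subset by blast
        show "C \<inter> Y \<subseteq> Y" by blast
        fix x assume xY: "x \<in> Y"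
        consider "x = w" | "x \<in> X - A - {w}" | "x \<in> Z" using xY unfolding Y_def by blast
        then show "\<exists>D. reach Y (C \<inter> Y) D \<and> card (nb x \<inter> D) \<le> 1"
        proof cases
          case 1
          then show ?thesis using False xY unfolding rig_def by fastforce
        next
          case 2
          \<comment> \<open>Within \<open>Y\<close>, the closed neighbourhood of a vertex of an end
            block is a clique, so it never holds two tokens.\<close>
          have q: "q \<in> X - A - {w} \<or> q = w" if "q \<in> nb x \<inter> (C \<inter> Y)" for q
            using that 2 ZL sym unfolding nb_def Y_def by blast
          have "q = r" if "q \<in> nb x \<inter> (C \<inter> Y)" "r \<in> nb x \<inter> (C \<inter> Y)" for q r
          proof (rule ccontr)
            assume qr: "q \<noteq> r"
            have "E q r \<or> E r q"
              using q[OF that(1)] q[OF that(2)] that 2 pp(5,6) sym qr unfolding nb_def by blast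
            then show False using i that unfolding ind_def by blast
          qed
          then have "card (nb x \<inter> (C \<inter> Y)) \<le> 1"
            using finite_nb[of x] card_le_Suc0_iff_eq[of "nb x \<inter> (C \<inter> Y)"] by simp
          then show ?thesis using reach_refl i by blast
        next
          case 3
          then obtain F where F: "reach Z (S \<inter> Z) F" "card (nb x \<inter> F) \<le> 1"
            using fluidD[OF flZ] by blast
          have "reach Y (S \<inter> Z \<union> {l}) (F \<union> {l})"
            using l Cl Z ZL irr unfolding Y_def by (intro reach_Un[OF F(1)]) (auto simp: ind_def)
          moreover have "l \<notin> nb x" using 3 ZL[of x l] l Z unfolding nb_def by blast
          then have "nb x \<inter> (F \<union> {l}) = nb x \<inter> F" by auto
          ultimately show ?thesis using F CY by (intro exI[of _ "F \<union> {l}"]) auto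
        qed
      qed
      then have flD: "fluid Y (D \<inter> Y)" using fluid_reach rY by blast
      have fin: "finite (S \<inter> Z)" using Z pp XV finite_V by (meson finite_subset inf_le2 le_infI2 subset_trans Diff_subset)
      have cD: "card (D \<inter> Y) = Suc (card (S \<inter> Z))"
        using reach_card[OF rY YV] CY Cl fin by simp
      then have "D \<inter> Y \<noteq> {}" by auto
      then obtain F where F: "F \<subseteq> D \<inter> Y" "fluid Z F" "Suc (card F) = card (D \<inter> Y)"
        using pendant_remove_token[OF _ pY flD _ cY YV] IH ZX cY by blast
      then have "reach Z (S \<inter> Z) F" using IH[OF ZX(1) cZ] flZ cD unfolding linked_def by simp
      then show ?thesis using F by blast
    qed
    then obtain F where F: "F \<subseteq> D" "reach Z (S \<inter> Z) F" by blast
    have ZRA: "Z \<union> R = A - U" "Z \<inter> R = {}" using Z unfolding R_def by auto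
    have FZ: "F \<subseteq> Z" "ind F" using reach_in F by blast+
    have iR: "ind (S \<inter> R)" using ind_subset[OF S(2)] by blast
    have "reach (A - U) (S \<inter> Z \<union> S \<inter> R) (F \<union> S \<inter> R)"
      by (rule reach_Un[OF F(2) _ _ iR]) (use ZRA ZR in blast)+
    moreover have "reach (A - U) (S \<inter> R \<union> F) (D \<inter> R \<union> F)"
      by (rule reach_Un[OF rR _ _ FZ(2)]) (use ZRA ZR FZ(1) in blast)+
    then have "reach (A - U) (F \<union> S \<inter> R) (D \<inter> R \<union> F)" by (simp only: Un_commute[of F])
    ultimately have "reach (A - U) (S \<inter> Z \<union> S \<inter> R) (D \<inter> R \<union> F)"
      by (rule reach_trans)
    moreover have "S \<inter> Z \<union> S \<inter> R = S" using ZRA S SU by blast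
    ultimately have "reach (A - U) S (D \<inter> R \<union> F)" by simp
    then have "reach A S (D \<inter> R \<union> F)" by (rule reach_mono) blast
    \<comment> \<open>The imitation is a subset of \<open>D\<close> reachable inside
      \<open>A\<close>. Rigidity of \<open>u\<close> in \<open>A\<close> demands two tokens near
      \<open>u\<close>, more than \<open>D\<close> itself has there.\<close>
    then have "2 \<le> card (nb u \<inter> (D \<inter> R \<union> F))" using u unfolding U_def rig_def by blast
    also have "\<dots> \<le> card (nb u \<inter> D)" using F finite_nb by (intro card_mono) auto
    finally show False using u by blast
  qed
  then show "fluid A (C - {l})" using S unfolding fluid_def U_def S_def by blast
qed

text \<open>Both configurations are parked at the same \<open>l\<close>, so the two remainders on
  \<open>A\<close> can be linked with that token frozen; reversibility of sliding joins the two
  routes.\<close>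

lemma linked_step:
  assumes XV: "X \<subseteq> V" and cX: "cn X" and pk: "parkable X"
    and IH: "\<And>Y. Y \<subset> X \<Longrightarrow> cn Y \<Longrightarrow> linked Y"
  shows "linked X"
  unfolding linked_def
proof (intro allI impI)
  fix C D assume C: "fluid X C" and D: "fluid X D" and cd: "card C = card D"
  have CX: "C \<subseteq> X" "ind C" "D \<subseteq> X" "ind D" using C D unfolding fluid_def by auto
  have fX: "finite X" "finite C" "finite D" using CX XV finite_sub[of X] finite_subset[of C X] finite_subset[of D X] by auto
  show "reach X C D"
  proof (cases "C = {}")
    case True
    then have "D = {}" using cd fX by simp
    then show ?thesis using True CX reach_refl by blast
  next
    case False
    then have Dne: "D \<noteq> {}" using cd fX by auto
    show ?thesis
    proof (cases "\<exists>x\<in>X. \<exists>y\<in>X. x \<noteq> y")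
      case False
      obtain c d where cd: "c \<in> C" "d \<in> D" using \<open>C \<noteq> {}\<close> Dne by blast
      have X1: "x = c" if "x \<in> X" for x using False that cd CX by blast
      have "C = {c}" "D = {c}" using X1 cd CX by (auto dest: subsetD)
      then have "C = D" by simp
      then show ?thesis using CX reach_refl by blast
    next
      case True
      then obtain w A where p: "pendant X w A" using ex_pendant[OF XV cX] by blast
      obtain l where l: "l \<in> X - A - {w}" using p unfolding pendant_def by blast
      have pp: "A \<subset> X" "cn A" "w \<in> X" "\<And>a. a \<in> A \<Longrightarrow> \<not> E a l"
        using p l unfolding pendant_def by blast+
      have *: "\<exists>S. reach X F (insert l S) \<and> fluid A S" if F: "fluid X F" "F \<noteq> {}" for F
      proof -
        obtain F' where F': "reach X F F'" "w \<in> F'"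
          using fluid_occupied[OF F cX pp(3)] by blast
        have "fluid X F'" using fluid_reach F F' by blast
        then show ?thesis
          using park_at_apex(3,4)[OF pk p _ F'(2) l] reach_trans[OF F'(1)] by blast
      qed
      obtain S T where S: "reach X C (insert l S)" "fluid A S" and T: "reach X D (insert l T)" "fluid A T"
        using *[OF C False] *[OF D Dne] by blast
      have ST: "S \<subseteq> A" "T \<subseteq> A" using S T unfolding fluid_def by auto
      have fA: "finite A" using pp(1) fX(1) by (meson finite_subset psubset_imp_subset)
      have fST: "finite S" "finite T" "l \<notin> S" "l \<notin> T"
        using finite_subset[OF ST(1) fA] finite_subset[OF ST(2) fA] ST l by auto
      have "card S = card T"
        using reach_card[OF S(1) XV] reach_card[OF T(1) XV] cd fST by simp
      then have "reach A S T" using IH[OF pp(1,2)] S(2) T(2) unfolding linked_def by simp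
      then have "reach X (S \<union> {l}) (T \<union> {l})"
        by (rule reach_Un) (use pp l irr in \<open>auto simp: ind_def\<close>)
      then have "reach X (insert l S) (insert l T)" by simp
      then show ?thesis
        using reach_trans[OF S(1) reach_trans[OF _ reach_sym[OF T(1)]]] by blast
    qed
  qed
qed

text \<open>The claims are intertwined: \<open>parkable\<close> for \<open>X\<close> uses both
  claims for smaller sets, and \<open>linked\<close> for \<open>X\<close> uses
  \<open>parkable\<close> for \<open>X\<close> itself.\<close>

lemma parkable_linked: "X \<subseteq> V \<Longrightarrow> cn X \<Longrightarrow> parkable X \<and> linked X"
proof (induction "card X" arbitrary: X rule: less_induct)
  case less
  have fX: "finite X" using less.prems(1) by (rule finite_sub)
  have IH: "parkable Y \<and> linked Y" if "Y \<subset> X" "cn Y" for Y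
    using less.hyps[of Y] psubset_card_mono[OF fX that(1)] that less.prems by blast
  have "parkable X" using parkable_step less.prems IH by blast
  then show ?case using linked_step less.prems IH by blast
qed

theorem fluid_reach_iff_card:
  assumes "X \<subseteq> V" "cn X" "fluid X C" "fluid X D" "card C = card D"
  shows "reach X C D"
  using parkable_linked[OF assms(1,2)] assms(3-5) unfolding linked_def by blast

end

section \<open>Blocks as maximal cliques\<close>

definition (in ugraph) clq :: "'a set \<Rightarrow> bool" where
  "clq S \<longleftrightarrow> (\<forall>a\<in>S. \<forall>b\<in>S. a \<noteq> b \<longrightarrow> E a b)"

locale cbgraph = bgraph +
  assumes cn_V: "cn V"
begin

text \<open>In a block graph the blocks are exactly the maximal cliques;
  \<open>blocks_maximal_cliques\<close> makes the connection with the original definition.\<close>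

definition BL :: "'a set set" where
  "BL = {S. S \<subseteq> V \<and> S \<noteq> {} \<and> clq S \<and> (\<forall>T. S \<subseteq> T \<longrightarrow> T \<subseteq> V \<longrightarrow> clq T \<longrightarrow> T = S)}"

definition BA :: "'a \<Rightarrow> 'a set set" where
  "BA u = {B \<in> BL. u \<in> B}"

text \<open>For a block \<open>B\<close> at \<open>u\<close>, the vertex sets of \<open>G[B,u]\<close> and \<open>G[u,B]\<close> are
  \<open>insert u (side B u)\<close> and \<open>hang u B\<close>; \<open>kap B u\<close> is \<open>\<kappa>(B,u)\<close>, and \<open>BA u - {B}\<close> is \<open>\<beta>(u,B)\<close>.\<close>

definition side :: "'a set \<Rightarrow> 'a \<Rightarrow> 'a set" where
  "side B u = {y. \<exists>x\<in>B - {u}. conn (V - {u}) x y}"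

definition hang :: "'a \<Rightarrow> 'a set \<Rightarrow> 'a set" where
  "hang u B = V - side B u"

text \<open>A second block at \<open>u\<close> is the form in which the cut-vertex condition enters
  the recursions (compare \<open>cut_vertex_iff\<close>). The condition is inherited by the
  arguments of all recursive calls.\<close>

definition valid :: "'a \<Rightarrow> 'a set \<Rightarrow> bool" where
  "valid u B \<longleftrightarrow> B \<in> BA u \<and> BA u \<noteq> {B}"

definition kap :: "'a set \<Rightarrow> 'a \<Rightarrow> 'a set" where
  "kap B u = {v \<in> B - {u}. BA v \<noteq> {B}}"

lemma BA_V: "B \<in> BA u \<Longrightarrow> B \<subseteq> V" "B \<in> BA u \<Longrightarrow> u \<in> V" "B \<in> BA u \<Longrightarrow> u \<in> B"
  unfolding BA_def BL_def by auto

lemma BA_clq: "B \<in> BA u \<Longrightarrow> a \<in> B \<Longrightarrow> b \<in> B \<Longrightarrow> a \<noteq> b \<Longrightarrow> E a b"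
  unfolding BA_def BL_def clq_def by auto

lemma BA_max:
  assumes a: "B \<in> BA u" "y \<in> V" "\<And>b. b \<in> B \<Longrightarrow> b \<noteq> y \<Longrightarrow> E b y"
  shows "y \<in> B"
proof -
  have "clq (insert y B)" unfolding clq_def using sym[OF a(3)] a(3) BA_clq[OF a(1)] by blast
  moreover have "insert y B \<subseteq> V" using a BA_V(1)[OF a(1)] by blast
  ultimately have "insert y B = B" using a(1) unfolding BA_def BL_def by blast
  then show ?thesis by auto
qed

lemma BA_swap: "B \<in> BA u \<Longrightarrow> v \<in> B \<Longrightarrow> B \<in> BA v"
  unfolding BA_def by auto

lemma finite_BA: "finite (BA u)"
  by (rule finite_subset[of _ "Pow V"]) (auto simp: BA_def BL_def finite_V)

lemma finite_B: "B \<in> BA u \<Longrightarrow> finite B"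
  using BA_V(1) by (intro finite_sub)

lemma ex_BL:
  assumes S: "S \<subseteq> V" "S \<noteq> {}" "clq S"
  shows "\<exists>B\<in>BL. S \<subseteq> B"
proof -
  define F where "F = {T. S \<subseteq> T \<and> T \<subseteq> V \<and> clq T}"
  have "finite F" unfolding F_def by (rule finite_subset[of _ "Pow V"]) (auto simp: finite_V)
  moreover have "S \<in> F" unfolding F_def using S by auto
  ultimately obtain B where B: "B \<in> F" "S \<subseteq> B" "\<forall>T\<in>F. B \<subseteq> T \<longrightarrow> B = T"
    using finite_has_maximal2[of F S] by blast
  have "T = B" if "B \<subseteq> T" "T \<subseteq> V" "clq T" for T
    using B that unfolding F_def by blast
  then have "B \<in> BL" unfolding BL_def using B(1) S unfolding F_def by auto
  then show ?thesis using B by blast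
qed

lemma ex_BA_edge:
  assumes e: "E u x"
  shows "\<exists>B\<in>BA u. x \<in> B"
proof -
  have "clq {u, x}" unfolding clq_def using e sym by auto
  then show ?thesis using ex_BL[of "{u, x}"] e E_V E_V2 unfolding BA_def by auto
qed

text \<open>Any \<open>y\<close> in \<open>B\<close> and \<open>z\<close> in \<open>B'\<close> are
  joined through \<open>w\<close> without using \<open>u\<close>, so \<open>bg\<close> at
  \<open>u\<close> makes them adjacent, and maximality identifies the two cliques.\<close>

lemma BA_Int:
  assumes "B \<in> BA u" "B' \<in> BA u" "w \<in> B" "w \<in> B'" "w \<noteq> u"
  shows "B = B'"
proof -
  have e: "E y z" if yz: "y \<in> B" "z \<in> B'" "y \<noteq> z" for y z
  proof (cases "y = u \<or> z = u \<or> y = w \<or> z = w")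
    case True
    then show ?thesis using yz BA_clq[OF assms(1)] BA_clq[OF assms(2)] assms BA_V(3) by blast
  next
    case False
    have "conn (V - {u}) y w" "conn (V - {u}) w z"
      using False yz BA_clq[OF assms(1), of y w] BA_clq[OF assms(2), of w z] assms
        BA_V(1)[OF assms(1)] BA_V(1)[OF assms(2)] by (auto intro!: conn_edge)
    then have "conn (V - {u}) y z" by (rule conn_trans)
    moreover have "E u y" "E u z"
      using False yz BA_clq[OF assms(1)] BA_clq[OF assms(2)] BA_V(3)[OF assms(1)] BA_V(3)[OF assms(2)] by auto
    ultimately show ?thesis using bg yz by blast
  qed
  have "B' \<subseteq> B"
    using BA_max[OF assms(1)] e BA_V(1)[OF assms(2)] by blast
  moreover have "B \<subseteq> B'"
    using BA_max[OF assms(2)] e sym BA_V(1)[OF assms(1)] by blast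
  ultimately show ?thesis by blast
qed

lemma BA_other: "valid u B \<Longrightarrow> \<exists>B'\<in>BA u. B' \<noteq> B"
  unfolding valid_def by auto

text \<open>A block consisting of \<open>u\<close> alone would be contained in the second block at
  \<open>u\<close>, against maximality.\<close>

lemma valid_ex:
  assumes v: "valid u B"
  shows "\<exists>x\<in>B. x \<noteq> u"
proof (rule ccontr)
  assume n: "\<not> (\<exists>x\<in>B. x \<noteq> u)"
  then obtain B' where B': "B' \<in> BA u" "B' \<noteq> B" using BA_other[OF v] by blast
  have "B \<in> BA u" using v unfolding valid_def by blast
  moreover have "B = {u}" using n BA_V(3)[OF calculation] by blast
  ultimately show False using B' unfolding BA_def BL_def by auto
qed

lemma side_subset: "side B u \<subseteq> V - {u}" if "B \<in> BA u"
  unfolding side_def using conn_in[of "V - {u}"] BA_V(1)[OF that] by blast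

lemma B_side: "B - {u} \<subseteq> side B u"
  unfolding side_def using conn_refl by blast

text \<open>Such a \<open>y\<close> is joined to \<open>B - {u}\<close> without \<open>u\<close>, so
  \<open>bg\<close> at \<open>u\<close> makes it adjacent to all of \<open>B\<close>, and
  \<open>B\<close> is maximal.\<close>

lemma side_nb:
  assumes B: "B \<in> BA u" and y: "y \<in> side B u" "E u y"
  shows "y \<in> B"
proof -
  obtain x where x: "x \<in> B" "x \<noteq> u" "conn (V - {u}) x y" using y unfolding side_def by auto
  show ?thesis
  proof (rule BA_max[OF B])
    show "y \<in> V" using side_subset[OF B] y by blast
    fix b assume b: "b \<in> B" "b \<noteq> y"
    show "E b y"
    proof (cases "b = u")
      case False
      have "conn (V - {u}) b x"
      proof (cases "b = x")
        case False
        then show ?thesis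
          using \<open>b \<noteq> u\<close> b x BA_clq[OF B] BA_V(1)[OF B] by (intro conn_edge) auto
      qed simp
      then have "conn (V - {u}) b y" using x(3) by (rule conn_trans)
      moreover have "E u b" using BA_clq[OF B, of u b] b False BA_V(3)[OF B] by auto
      ultimately show ?thesis using bg y(2) b(2) by blast
    qed (use y in simp)
  qed
qed

text \<open>This is what separates the sides at \<open>u\<close>: the only exits of a side are the
  edges from \<open>B\<close> to \<open>u\<close>, so sides do not interact while \<open>u\<close>
  is empty.\<close>

lemma side_edge:
  assumes B: "B \<in> BA u" and y: "y \<in> side B u" "z \<notin> side B u" "E y z"
  shows "z = u \<and> y \<in> B"
proof -
  have "z = u"
  proof (rule ccontr)
    assume "z \<noteq> u"
    then have "conn (V - {u}) y z"
      using y side_subset[OF B] E_V2 by (intro conn_edge) auto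
    then show False using y conn_trans unfolding side_def by blast
  qed
  then show ?thesis using side_nb[OF B y(1)] y sym by blast
qed

text \<open>As \<open>V\<close> is connected, the component of \<open>y\<close> in
  \<open>V - {u}\<close> contains a neighbour of \<open>u\<close>, and the block of that edge is the
  one sought. Together with \<open>side_disj\<close>, the sides at \<open>u\<close> partition
  \<open>V - {u}\<close>.\<close>

lemma side_cover:
  assumes "u \<in> V" "y \<in> V" "y \<noteq> u"
  shows "\<exists>B\<in>BA u. y \<in> side B u"
proof -
  have yV: "y \<in> V - {u}" using assms by auto
  obtain p q where pq: "p \<in> comp (V - {u}) y" "q \<in> V" "q \<notin> comp (V - {u}) y" "E p q"
    using cn_ex_edge[OF cn_V, of y u "comp (V - {u}) y"] assms comp_self comp_subset[OF yV] by blast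
  have "q = u" using comp_edge[OF yV pq(1) _ pq(4)] pq by blast
  then obtain B where B: "B \<in> BA u" "p \<in> B" using ex_BA_edge pq(4) sym by blast
  have "p \<noteq> u" using pq(4) \<open>q = u\<close> irr by blast
  moreover have "conn (V - {u}) p y" using pq(1) conn_sym unfolding comp_def by auto
  ultimately show ?thesis using B unfolding side_def by blast
qed

lemma side_disj:
  assumes B: "B \<in> BA u" "B' \<in> BA u" and y: "y \<in> side B u" "y \<in> side B' u"
  shows "B = B'"
proof -
  obtain x where x: "x \<in> B" "x \<noteq> u" "conn (V - {u}) x y" using y unfolding side_def by auto
  obtain x' where x': "x' \<in> B'" "x' \<noteq> u" "conn (V - {u}) x' y" using y unfolding side_def by auto
  have "conn (V - {u}) x x'" using x x' conn_sym conn_trans by blast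
  then have "x' \<in> side B u" using x unfolding side_def by blast
  moreover have "E u x'" using BA_clq[OF B(2), of u x'] BA_V(3)[OF B(2)] x' by auto
  ultimately have "x' \<in> B" using side_nb[OF B(1)] by blast
  then show ?thesis using BA_Int B x' by blast
qed

text \<open>Whatever hangs at \<open>b\<close> is joined to \<open>b\<close> through the side of
  another block at \<open>b\<close>. That side avoids \<open>u\<close>, since \<open>u\<close> lies
  in the side of \<open>B\<close> at \<open>b\<close>.\<close>

lemma hang_subset_side:
  assumes B: "B \<in> BA u" and b: "b \<in> B" "b \<noteq> u"
  shows "hang b B \<subseteq> side B u"
proof
  fix y assume "y \<in> hang b B"
  then have y: "y \<in> V" "y \<notin> side B b" unfolding hang_def by auto
  have Bb: "B \<in> BA b" using BA_swap B b by blast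
  show "y \<in> side B u"
  proof (cases "y = b")
    case True
    then show ?thesis using B_side b by blast
  next
    case False
    obtain B' where B': "B' \<in> BA b" "y \<in> side B' b"
      using side_cover[of b y] y False BA_V(2)[OF Bb] by blast
    have "B' \<noteq> B" using B' y by blast
    obtain x where x: "x \<in> B'" "x \<noteq> b" "conn (V - {b}) x y" using B' unfolding side_def by auto
    have u: "u \<in> side B b" using B_side[of B b] BA_V(3)[OF B] b by blast
    then have uB': "u \<notin> side B' b" using side_disj[OF Bb B'(1)] \<open>B' \<noteq> B\<close> by blast
    have xs: "x \<in> side B' b" using x B_side by blast
    have "conn ((V - {b}) \<inter> side B' b) x y"
      using conn_closed[OF x(3) xs] side_edge[OF B'(1)] by blast
    then have 1: "conn (V - {u}) x y" using uB' by (elim conn_mono) blast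
    have "E b x" using BA_clq[OF B'(1), of b x] BA_V(3)[OF B'(1)] x by auto
    moreover have "x \<noteq> u" using xs uB' by blast
    ultimately have "conn (V - {u}) b x"
      using b BA_V(1)[OF B] BA_V(1)[OF B'(1)] x by (intro conn_edge) auto
    then show ?thesis using 1 conn_trans b unfolding side_def by blast
  qed
qed

text \<open>The union of the hanging parts is closed under edges that avoid \<open>u\<close>: a
  hanging part can be left only at its root, and then only into \<open>B\<close>.\<close>

lemma side_subset_hang:
  assumes B: "B \<in> BA u" and y: "y \<in> side B u"
  shows "\<exists>b\<in>B - {u}. y \<in> hang b B"
proof -
  obtain x where x: "x \<in> B" "x \<noteq> u" "conn (V - {u}) x y" using y unfolding side_def by auto
  let ?T = "{y \<in> V. \<exists>b\<in>B - {u}. y \<in> hang b B}"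
  have hb: "b \<in> hang b B" if "b \<in> B" for b
    using side_subset[OF BA_swap[OF B that]] that BA_V(1)[OF B] unfolding hang_def by blast
  have "y \<in> ?T \<and> conn ((V - {u}) \<inter> ?T) x y"
  proof (rule conn_closed[OF x(3)])
    show "x \<in> ?T" using x hb BA_V(1)[OF B] by blast
    fix p q assume pq: "p \<in> ?T" "p \<in> V - {u}" "q \<in> V - {u}" "E p q"
    then obtain b where b: "b \<in> B - {u}" "p \<in> hang b B" by blast
    show "q \<in> ?T"
    proof (cases "q \<in> hang b B")
      case False
      then have "q \<in> side B b" "p \<notin> side B b" using pq b unfolding hang_def by auto
      then have "q \<in> B" using side_edge[OF BA_swap[OF B, of b]] b pq(4) sym by blast
      then show ?thesis using hb pq by blast
    qed (use b pq in blast)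
  qed
  then show ?thesis by blast
qed

lemma hang_self: "B \<in> BA u \<Longrightarrow> u \<in> hang u B"
  using side_subset[of B u] BA_V(2) unfolding hang_def by blast

lemma hang_edge:
  assumes B: "B \<in> BA u" and "x \<in> hang u B" "z \<notin> hang u B" "E x z"
  shows "x = u \<and> z \<in> B"
  using side_edge[OF B, of z x] assms E_V2 sym unfolding hang_def by blast

lemma hang_Int_B: "B \<in> BA u \<Longrightarrow> hang u B \<inter> B = {u}"
  using B_side[of B u] hang_self BA_V(3) unfolding hang_def by blast

lemma hang_disj:
  assumes "B \<in> BA u" "b \<in> B" "b \<noteq> u" "y \<in> hang b B"
  shows "y \<notin> hang u B"
  using hang_subset_side[OF assms(1-3)] assms(4) unfolding hang_def by blast

lemma hang_sides:
  assumes B: "B \<in> BA u"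
  shows "hang u B - {u} = (\<Union>B'\<in>BA u - {B}. side B' u)"
proof
  show "hang u B - {u} \<subseteq> (\<Union>B'\<in>BA u - {B}. side B' u)"
    using side_cover[OF BA_V(2)[OF B]] unfolding hang_def by blast
  show "(\<Union>B'\<in>BA u - {B}. side B' u) \<subseteq> hang u B - {u}"
    using side_subset side_disj[OF B] unfolding hang_def by blast
qed

lemma kap_valid: "v \<in> kap B u \<Longrightarrow> B \<in> BA u \<Longrightarrow> valid v B"
  unfolding kap_def valid_def using BA_swap by blast

lemma kap_in: "v \<in> kap B u \<Longrightarrow> v \<in> B" "v \<in> kap B u \<Longrightarrow> v \<noteq> u"
  unfolding kap_def by auto

lemma finite_kap: "B \<in> BA u \<Longrightarrow> finite (kap B u)"
  using finite_B[of B u] finite_subset[of "kap B u" B] unfolding kap_def by blast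

lemma other_valid: "B' \<in> BA u - {B} \<Longrightarrow> B \<in> BA u \<Longrightarrow> valid u B'"
  unfolding valid_def by blast

text \<open>From a pair (u,B) to (B',u) the vertex \<open>u\<close> is lost, so the vertex set
  shrinks strictly. From (B,u) to (v,B) it may stay the same, namely if \<open>B\<close> is just
  \<open>{u, v}\<close>. Hence the measures \<open>2 * card (hang u B)\<close> and
  \<open>2 * card (side B u) + 1\<close>, which decrease in both steps.\<close>

lemma valid_induct [consumes 1, case_names BV VB]:
  assumes "valid u B"
    and B: "\<And>u B. valid u B \<Longrightarrow> (\<And>v. v \<in> kap B u \<Longrightarrow> valid v B \<Longrightarrow> PV v B) \<Longrightarrow> PB B u"
    and V: "\<And>u B. valid u B \<Longrightarrow> (\<And>B'. B' \<in> BA u - {B} \<Longrightarrow> valid u B' \<Longrightarrow> PB B' u) \<Longrightarrow> PV u B"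
  shows "PB B u \<and> PV u B"
proof -
  have fin: "finite (hang u B)" "finite (side B u)" if "B \<in> BA u" for u B
    using finite_sub[of "hang u B"] finite_sub[of "side B u"] side_subset[OF that]
    unfolding hang_def by auto
  have "valid u B \<longrightarrow> (n = 2 * card (side B u) + 1 \<longrightarrow> PB B u) \<and> (n = 2 * card (hang u B) \<longrightarrow> PV u B)" for n u B
  proof (induction n arbitrary: u B rule: less_induct)
    case (less n)
    show ?case
    proof (intro impI conjI)
      assume v: "valid u B"
      then have BA: "B \<in> BA u" unfolding valid_def by blast
      assume n: "n = 2 * card (side B u) + 1"
      show "PB B u"
      proof (rule B[OF v])
        fix w assume w: "w \<in> kap B u" "valid w B"
        have "card (hang w B) \<le> card (side B u)"
          using hang_subset_side[OF BA kap_in[OF w(1)]] fin(2)[OF BA] by (rule card_mono[rotated])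
        then have "2 * card (hang w B) < n" using n by simp
        then show "PV w B" using less[of "2 * card (hang w B)" w B] w(2) by blast
      qed
    next
      assume v: "valid u B"
      then have BA: "B \<in> BA u" unfolding valid_def by blast
      assume n: "n = 2 * card (hang u B)"
      show "PV u B"
      proof (rule V[OF v])
        fix B' assume B': "B' \<in> BA u - {B}" "valid u B'"
        have "side B' u \<subset> hang u B" using hang_sides[OF BA] B'(1) hang_self[OF BA] by blast
        then have "card (side B' u) < card (hang u B)"
          using fin(1)[OF BA] by (rule psubset_card_mono[rotated])
        then have "2 * card (side B' u) + 1 < n" using n by simp
        then show "PB B' u" using less[of "2 * card (side B' u) + 1" u B'] B'(2) by blast
      qed
    qed
  qed
  then show ?thesis using assms(1) by blast
qed

end

section \<open>Capacities\<close>

text \<open>\<open>uV\<close> and \<open>uB\<close> are \<open>ua\<close> on pairs \<open>(u, B)\<close> and \<open>(B, u)\<close>, and \<open>cV\<close>, \<open>cB\<close> are the capacities.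
  The restrictions \<open>C[p]\<close> are dropped: the capacity for \<open>p\<close> only looks at \<open>C[p]\<close> anyway.\<close>

locale capacity = cbgraph +
  fixes uV :: "'a \<Rightarrow> 'a set \<Rightarrow> bool" and uB :: "'a set \<Rightarrow> 'a \<Rightarrow> bool"
    and cV :: "'a \<Rightarrow> 'a set \<Rightarrow> 'a set \<Rightarrow> int" and cB :: "'a set \<Rightarrow> 'a \<Rightarrow> 'a set \<Rightarrow> int"
  assumes uB: "valid u B \<Longrightarrow> uB B u \<longleftrightarrow> \<not> ((\<forall>v\<in>kap B u. uV v B) \<and> B = kap B u \<union> {u})"
    and uV: "valid u B \<Longrightarrow> uV u B \<longleftrightarrow> (\<exists>B'\<in>BA u - {B}. uB B' u)"
    and cB: "valid u B \<Longrightarrow> cB B u C =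
      (\<Sum>v\<in>kap B u. cV v B C) + of_bool (uB B u) - int (card (B \<inter> (C - {u})))"
    and cV: "valid u B \<Longrightarrow> cV u B C =
      (if \<exists>B'\<in>BA u - {B}. cB B' u C = 0 \<and> uB B' u then 0
       else (\<Sum>B'\<in>BA u - {B}. cB B' u C - of_bool (uB B' u)) + of_bool (uV u B))"
begin

lemma cV_cong:
  assumes "valid u B" "\<And>B'. B' \<in> BA u - {B} \<Longrightarrow> cB B' u C = cB B' u C'"
  shows "cV u B C = cV u B C'"
proof -
  have "(\<exists>B'\<in>BA u - {B}. cB B' u C = 0 \<and> uB B' u) \<longleftrightarrow> (\<exists>B'\<in>BA u - {B}. cB B' u C' = 0 \<and> uB B' u)"
    by (rule bex_cong) (use assms(2) in auto)
  moreover have "(\<Sum>B'\<in>BA u - {B}. cB B' u C - of_bool (uB B' u)) =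
      (\<Sum>B'\<in>BA u - {B}. cB B' u C' - of_bool (uB B' u))"
    by (rule sum.cong) (use assms(2) in auto)
  ultimately show ?thesis unfolding cV[OF assms(1)] by (simp only:)
qed

text \<open>Neither capacity sees a token on the base, which is why the base is absent from both
  restrictions.\<close>

lemma cap_local:
  assumes "valid u B"
  shows "(\<forall>C C'. C \<inter> side B u = C' \<inter> side B u \<longrightarrow> cB B u C = cB B u C') \<and>
    (\<forall>C C'. C \<inter> (hang u B - {u}) = C' \<inter> (hang u B - {u}) \<longrightarrow> cV u B C = cV u B C')"
  using assms
proof (induction rule: valid_induct[where PB = "\<lambda>B u. \<forall>C C'. C \<inter> side B u = C' \<inter> side B u \<longrightarrow> cB B u C = cB B u C'"
      and PV = "\<lambda>u B. \<forall>C C'. C \<inter> (hang u B - {u}) = C' \<inter> (hang u B - {u}) \<longrightarrow> cV u B C = cV u B C'"])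
  case (BV u B)
  then have BA: "B \<in> BA u" unfolding valid_def by blast
  show ?case
  proof (intro allI impI)
    fix C C' assume eq: "C \<inter> side B u = C' \<inter> side B u"
    have "cV v B C = cV v B C'" if v: "v \<in> kap B u" for v
    proof -
      have "hang v B \<subseteq> side B u" using hang_subset_side[OF BA kap_in[OF v]] .
      then have "C \<inter> (hang v B - {v}) = C' \<inter> (hang v B - {v})" using eq by blast
      then show ?thesis using BV(2)[OF v kap_valid[OF v BA]] by blast
    qed
    moreover have "B \<inter> (C - {u}) = B \<inter> (C' - {u})" using eq B_side[of B u] by blast
    ultimately show "cB B u C = cB B u C'" using cB[OF BV(1)] by simp
  qed
next
  case (VB u B)
  then have BA: "B \<in> BA u" unfolding valid_def by blast
  show ?case
  proof (intro allI impI)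
    fix C C' assume eq: "C \<inter> (hang u B - {u}) = C' \<inter> (hang u B - {u})"
    have "cB B' u C = cB B' u C'" if B': "B' \<in> BA u - {B}" for B'
    proof -
      have "C \<inter> side B' u = C' \<inter> side B' u" using eq hang_sides[OF BA] B' by blast
      then show ?thesis using VB(2)[OF B' other_valid[OF B' BA]] by blast
    qed
    then show "cV u B C = cV u B C'" using cV_cong[OF VB(1)] by blast
  qed
qed

text \<open>The clauses after nonnegativity make the induction work. The only negative contribution
  to \<open>cB\<close> is the single token that the clique can hold off \<open>u\<close>, say on
  \<open>b\<close>. It is paid for by \<open>uB B u\<close> or, if that fails, by
  \<open>cV b B C\<close>, which is at least 1 since \<open>uV b B\<close> holds and
  \<open>b\<close> is occupied. For \<open>cV\<close>, a token on \<open>u\<close> leaves the other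
  vertices of all blocks at \<open>u\<close> empty, which excludes the zero case.\<close>

lemma cap_nonneg:
  assumes "valid u B"
  shows "(\<forall>C. ind C \<longrightarrow> 0 \<le> cB B u C \<and> (B \<inter> (C - {u}) = {} \<longrightarrow> of_bool (uB B u) \<le> cB B u C)) \<and>
    (\<forall>C. ind C \<longrightarrow> 0 \<le> cV u B C \<and> (u \<in> C \<longrightarrow> of_bool (uV u B) \<le> cV u B C))"
  using assms
proof (induction rule: valid_induct[where PB =
      "\<lambda>B u. \<forall>C. ind C \<longrightarrow> 0 \<le> cB B u C \<and> (B \<inter> (C - {u}) = {} \<longrightarrow> of_bool (uB B u) \<le> cB B u C)"
      and PV = "\<lambda>u B. \<forall>C. ind C \<longrightarrow> 0 \<le> cV u B C \<and> (u \<in> C \<longrightarrow> of_bool (uV u B) \<le> cV u B C)"])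
  case (BV u B)
  then have BA: "B \<in> BA u" unfolding valid_def by blast
  show ?case
  proof (intro allI impI)
    fix C assume ind: "ind C"
    have nn: "0 \<le> cV v B C" if "v \<in> kap B u" for v
      using BV(2)[OF that kap_valid[OF that BA]] ind by blast
    then have s: "0 \<le> (\<Sum>v\<in>kap B u. cV v B C)" by (rule sum_nonneg)
    have e: "of_bool (uB B u) \<le> cB B u C" if "B \<inter> (C - {u}) = {}"
      using cB[OF BV(1)] that s by simp
    have "0 \<le> cB B u C"
    proof (cases "B \<inter> (C - {u}) = {}")
      case False
      then obtain b where b: "b \<in> B" "b \<in> C" "b \<noteq> u" by blast
      then have "B \<inter> (C - {u}) = {b}" using ind BA_clq[OF BA] unfolding ind_def by blast
      then have c: "cB B u C = (\<Sum>v\<in>kap B u. cV v B C) + of_bool (uB B u) - 1"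
        using cB[OF BV(1)] by simp
      show ?thesis
      proof (cases "uB B u")
        case False
        then have "b \<in> kap B u" "uV b B" using uB[OF BV(1)] b by auto
        then have "1 \<le> cV b B C" using BV(2)[OF _ kap_valid[OF _ BA]] ind b by fastforce
        also have "\<dots> \<le> (\<Sum>v\<in>kap B u. cV v B C)"
          using nn \<open>b \<in> kap B u\<close> finite_kap[OF BA] by (intro member_le_sum) auto
        finally show ?thesis using c by simp
      qed (use c s in simp)
    qed (use e in \<open>auto intro: order_trans[rotated]\<close>)
    then show "0 \<le> cB B u C \<and> (B \<inter> (C - {u}) = {} \<longrightarrow> of_bool (uB B u) \<le> cB B u C)" using e by blast
  qed
next
  case (VB u B)
  then have BA: "B \<in> BA u" unfolding valid_def by blast
  show ?case
  proof (intro allI impI)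
    fix C assume ind: "ind C"
    let ?z = "\<exists>B'\<in>BA u - {B}. cB B' u C = 0 \<and> uB B' u"
    have IH: "0 \<le> cB B' u C \<and> (B' \<inter> (C - {u}) = {} \<longrightarrow> of_bool (uB B' u) \<le> cB B' u C)" if "B' \<in> BA u - {B}" for B'
      using VB(2)[OF that other_valid[OF that BA]] ind by blast
    have "0 \<le> cB B' u C - of_bool (uB B' u)" if "\<not> ?z" "B' \<in> BA u - {B}" for B'
    proof (cases "uB B' u")
      case True
      then have "cB B' u C \<noteq> 0" using that by blast
      then show ?thesis using IH[OF that(2)] True by simp
    qed (use IH[OF that(2)] in simp)
    then have nz: "of_bool (uV u B) \<le> cV u B C" if "\<not> ?z"
      using cV[OF VB(1), of C] that sum_nonneg[of "BA u - {B}" "\<lambda>B'. cB B' u C - of_bool (uB B' u)"] by simp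
    have "\<not> ?z" if "u \<in> C"
    proof
      assume ?z
      then obtain B' where B': "B' \<in> BA u - {B}" "cB B' u C = 0" "uB B' u" by blast
      have "B' \<inter> (C - {u}) = {}"
        using ind that BA_clq[of B' u u] BA_V(3)[of B' u] B' unfolding ind_def by blast
      then show False using IH[OF B'(1)] B' by simp
    qed
    moreover have "0 \<le> cV u B C"
    proof (cases ?z)
      case True
      then show ?thesis unfolding cV[OF VB(1), of C] if_P[OF True] by simp
    next
      case False
      then show ?thesis using nz by (cases "uV u B") auto
    qed
    ultimately show "0 \<le> cV u B C \<and> (u \<in> C \<longrightarrow> of_bool (uV u B) \<le> cV u B C)" using nz by blast
  qed
qed

lemmas cB_local = cap_local[THEN conjunct1, rule_format]
lemmas cV_local = cap_local[THEN conjunct2, rule_format]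
lemmas cB_nonneg = cap_nonneg[THEN conjunct1, rule_format, THEN conjunct1]
lemmas cB_free = cap_nonneg[THEN conjunct1, rule_format, THEN conjunct2, rule_format]
lemmas cV_nonneg = cap_nonneg[THEN conjunct2, rule_format, THEN conjunct1]
lemmas cV_occ = cap_nonneg[THEN conjunct2, rule_format, THEN conjunct2, rule_format]

lemma cB_change:
  assumes "valid u B" "x \<in> kap B u"
    "\<And>v. v \<in> kap B u \<Longrightarrow> v \<noteq> x \<Longrightarrow> S \<inter> (hang v B - {v}) = C \<inter> (hang v B - {v})"
  shows "cB B u S = cB B u C + (cV x B S - cV x B C) - int (card (B \<inter> (S - {u}))) + int (card (B \<inter> (C - {u})))"
proof -
  have BA: "B \<in> BA u" using assms(1) unfolding valid_def by blast
  have "(\<Sum>v\<in>kap B u - {x}. cV v B S) = (\<Sum>v\<in>kap B u - {x}. cV v B C)"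
    using assms(3) kap_valid[OF _ BA] by (intro sum.cong) (auto intro!: cV_local)
  then have "(\<Sum>v\<in>kap B u. cV v B S) = (\<Sum>v\<in>kap B u. cV v B C) + (cV x B S - cV x B C)"
    using sum.remove[OF finite_kap[OF BA] assms(2), of "\<lambda>v. cV v B S"]
      sum.remove[OF finite_kap[OF BA] assms(2), of "\<lambda>v. cV v B C"] by simp
  then show ?thesis using cB[OF assms(1), of S] cB[OF assms(1), of C] by simp
qed

text \<open>Capacity is read as room for tokens entering through the base. The \<open>free\<close>
  statements let a part clear the neighbourhood of its base without losing capacity; the
  \<open>push\<close> statements let it absorb a token standing on the base at the price of one
  unit. The threshold is \<open>ua\<close> rather than 1: where \<open>ua\<close> is False, clearing
  is possible even with capacity 0. The four statements are proved by one mutual induction.\<close>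

definition freeB :: "'a set \<Rightarrow> 'a \<Rightarrow> bool" where
  "freeB B u \<longleftrightarrow> (\<forall>C. C \<subseteq> side B u \<longrightarrow> ind C \<longrightarrow> of_bool (uB B u) \<le> cB B u C \<longrightarrow>
     (\<exists>S. reach (side B u) C S \<and> S \<inter> B = {} \<and> cB B u C \<le> cB B u S))"

definition pushB :: "'a set \<Rightarrow> 'a \<Rightarrow> bool" where
  "pushB B u \<longleftrightarrow> (\<forall>C. C \<subseteq> insert u (side B u) \<longrightarrow> ind C \<longrightarrow> u \<in> C \<longrightarrow> 1 \<le> cB B u C \<longrightarrow>
     (\<exists>S. reach (insert u (side B u)) C S \<and> u \<notin> S \<and> cB B u C - 1 \<le> cB B u S))"

definition freeV :: "'a \<Rightarrow> 'a set \<Rightarrow> bool" where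
  "freeV u B \<longleftrightarrow> (\<forall>C. C \<subseteq> hang u B - {u} \<longrightarrow> ind C \<longrightarrow> of_bool (uV u B) \<le> cV u B C \<longrightarrow>
     (\<exists>S. reach (hang u B - {u}) C S \<and> S \<inter> nb u = {} \<and> cV u B C \<le> cV u B S))"

definition pushV :: "'a \<Rightarrow> 'a set \<Rightarrow> bool" where
  "pushV u B \<longleftrightarrow> (\<forall>C. C \<subseteq> hang u B \<longrightarrow> ind C \<longrightarrow> u \<in> C \<longrightarrow> 1 \<le> cV u B C \<longrightarrow>
     (\<exists>S. reach (hang u B) C S \<and> u \<notin> S \<and> cV u B C - 1 \<le> cV u B S))"

lemma cV_sum:
  assumes "valid u B" "\<not> (\<exists>B'\<in>BA u - {B}. cB B' u C = 0 \<and> uB B' u)"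
  shows "cV u B C = (\<Sum>B'\<in>BA u - {B}. cB B' u C - of_bool (uB B' u)) + of_bool (uV u B)"
  unfolding cV[OF assms(1), of C] if_not_P[OF assms(2)] ..

text \<open>The threshold excludes the zero case of \<open>cV\<close>, since a block causing it
  would make \<open>uV u B\<close> True while the capacity is 0. So each other block at
  \<open>u\<close> meets its own threshold, and with \<open>u\<close> empty their sides can be
  cleared independently.\<close>

lemma freeV_step:
  assumes v: "valid u B" and IH: "\<And>B'. B' \<in> BA u - {B} \<Longrightarrow> freeB B' u"
  shows "freeV u B"
  unfolding freeV_def
proof (intro allI impI)
  fix C assume C: "C \<subseteq> hang u B - {u}" "ind C" and cap: "of_bool (uV u B) \<le> cV u B C"
  have BA: "B \<in> BA u" using v unfolding valid_def by blast
  let ?O = "BA u - {B}"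
  have vO: "valid u B'" if "B' \<in> ?O" for B' using other_valid[OF that BA] .
  have dis: "B' = B''" if "B' \<in> ?O" "B'' \<in> ?O" "y \<in> side B' u" "y \<in> side B'' u" for B' B'' y
    using side_disj that by blast
  have nz: "\<not> (\<exists>B'\<in>?O. cB B' u C = 0 \<and> uB B' u)"
  proof
    assume z: "\<exists>B'\<in>?O. cB B' u C = 0 \<and> uB B' u"
    then have "uV u B" using uV[OF v] by blast
    moreover have "cV u B C = 0" using cV[OF v, of C] z by simp
    ultimately show False using cap by simp
  qed
  have pos: "of_bool (uB B' u) \<le> cB B' u C" if "B' \<in> ?O" for B'
  proof (cases "uB B' u")
    case True
    then have "cB B' u C \<noteq> 0" using nz that by blast
    then show ?thesis using cB_nonneg[OF vO[OF that] C(2)] True by simp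
  qed (use cB_nonneg[OF vO[OF that] C(2)] in simp)
  have "\<exists>S. reach (side B' u) (C \<inter> side B' u) S \<and> S \<inter> B' = {} \<and> cB B' u C \<le> cB B' u S" if B': "B' \<in> ?O" for B'
  proof -
    have "cB B' u (C \<inter> side B' u) = cB B' u C" by (rule cB_local[OF vO[OF B']]) blast
    then show ?thesis
      using IH[OF B'] pos[OF B'] ind_subset[OF C(2), of "C \<inter> side B' u"] unfolding freeB_def
      by (metis Int_lower1 Int_lower2)
  qed
  then obtain S where S: "\<And>B'. B' \<in> ?O \<Longrightarrow> reach (side B' u) (C \<inter> side B' u) (S B')"
      "\<And>B'. B' \<in> ?O \<Longrightarrow> S B' \<inter> B' = {}" "\<And>B'. B' \<in> ?O \<Longrightarrow> cB B' u C \<le> cB B' u (S B')"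
    by metis
  define J where "J = (\<Union>B'\<in>?O. S B')"
  have Ss: "S B' \<subseteq> side B' u" if "B' \<in> ?O" for B' using reach_in[OF S(1)[OF that]] by blast
  have Js: "J \<inter> side B' u = S B'" if "B' \<in> ?O" for B'
    unfolding J_def using Ss dis that by blast
  have U: "\<Union>((\<lambda>B'. side B' u) ` ?O) = hang u B - {u}" using hang_sides[OF BA] by simp
  have "reach (\<Union>((\<lambda>B'. side B' u) ` ?O)) (C \<inter> \<Union>((\<lambda>B'. side B' u) ` ?O)) (J \<inter> \<Union>((\<lambda>B'. side B' u) ` ?O))"
  proof (rule reach_Union)
    show "finite ((\<lambda>B'. side B' u) ` ?O)" using finite_BA by simp
    show "reach X (C \<inter> X) (J \<inter> X)" if "X \<in> (\<lambda>B'. side B' u) ` ?O" for X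
    proof -
      obtain B' where B': "B' \<in> ?O" "X = side B' u" using \<open>X \<in> _\<close> by blast
      show ?thesis using S(1)[OF B'(1)] Js[OF B'(1)] B'(2) by simp
    qed
    fix X Y x y assume XY: "X \<in> (\<lambda>B'. side B' u) ` ?O" "Y \<in> (\<lambda>B'. side B' u) ` ?O" "X \<noteq> Y" "x \<in> X" "y \<in> Y"
    then obtain B1 B2 where B12: "B1 \<in> ?O" "B2 \<in> ?O" "X = side B1 u" "Y = side B2 u" by blast
    then have n: "y \<notin> side B1 u" "y \<noteq> u" using dis XY side_subset[of B2 u] by blast+
    then show "x \<noteq> y \<and> \<not> E x y" using side_edge[of B1 u x y] B12 XY by blast
  qed
  moreover have "C \<inter> (hang u B - {u}) = C" "J \<inter> (hang u B - {u}) = J"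
    using C Ss unfolding U[symmetric] J_def by blast+
  ultimately have "reach (hang u B - {u}) C J" unfolding U by simp
  moreover have "J \<inter> nb u = {}"
  proof -
    have False if "y \<in> J" "y \<in> nb u" for y
    proof -
      from that obtain B' where B': "B' \<in> ?O" "y \<in> S B'" unfolding J_def by blast
      have "y \<noteq> u" using Ss[OF B'(1)] B' side_subset[of B' u] by blast
      then have "y \<in> B'" using side_nb[of B' u y] B' Ss[OF B'(1)] that(2) unfolding nb_def by blast
      then show False using S(2)[OF B'(1)] B' by blast
    qed
    then show ?thesis by blast
  qed
  moreover have "cV u B C \<le> cV u B J"
  proof -
    have le: "cB B' u C \<le> cB B' u J" if B': "B' \<in> ?O" for B'
    proof -
      have "cB B' u J = cB B' u (S B')" by (rule cB_local[OF vO[OF B']]) (use Js[OF B'] Ss[OF B'] in blast)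
      then show ?thesis using S(3)[OF B'] by simp
    qed
    have nzJ: "\<not> (\<exists>B'\<in>?O. cB B' u J = 0 \<and> uB B' u)"
      using le pos by fastforce
    have "(\<Sum>B'\<in>?O. cB B' u C - of_bool (uB B' u)) \<le> (\<Sum>B'\<in>?O. cB B' u J - of_bool (uB B' u))"
      using le by (intro sum_mono) simp
    then show ?thesis using cV_sum[OF v nz] cV_sum[OF v nzJ] by simp
  qed
  ultimately show "\<exists>S. reach (hang u B - {u}) C S \<and> S \<inter> nb u = {} \<and> cV u B C \<le> cV u B S" by blast
qed

text \<open>The token on \<open>u\<close> empties the blocks around it, so \<open>cB_free\<close>
  excludes the zero case. The token is handed to one block \<open>B'\<close>, and the other sides
  stay as they are.\<close>

lemma pushV_step:
  assumes v: "valid u B" and IH: "\<And>B'. B' \<in> BA u - {B} \<Longrightarrow> pushB B' u"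
  shows "pushV u B"
  unfolding pushV_def
proof (intro allI impI)
  fix C assume C: "C \<subseteq> hang u B" "ind C" "u \<in> C" and cap: "1 \<le> cV u B C"
  have BA: "B \<in> BA u" using v unfolding valid_def by blast
  let ?O = "BA u - {B}"
  have vO: "valid u B'" if "B' \<in> ?O" for B' using other_valid[OF that BA] .
  have noB: "B' \<inter> (C - {u}) = {}" if "B' \<in> ?O" for B'
    using C BA_clq[of B' u u] BA_V(3)[of B' u] that unfolding ind_def by blast
  have pos: "of_bool (uB B' u) \<le> cB B' u C" if "B' \<in> ?O" for B'
    using cB_free[OF vO[OF that] C(2) noB[OF that]] .
  have nz: "\<not> (\<exists>B'\<in>?O. cB B' u C = 0 \<and> uB B' u)" using pos by fastforce
  have cVC: "cV u B C = (\<Sum>B'\<in>?O. cB B' u C - of_bool (uB B' u)) + of_bool (uV u B)"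
    using cV_sum[OF v nz] .
  \<comment> \<open>Either \<open>B'\<close> has a unit above its threshold, and then the sum drops
    by at most 1 and the zero case stays excluded; or all summands vanish, the total is exactly 1,
    and nonnegativity of the new capacity is enough.\<close>
  obtain B' where B': "B' \<in> ?O" "1 \<le> cB B' u C"
      and alt: "of_bool (uB B' u) + 1 \<le> cB B' u C \<or> cV u B C = 1"
  proof (cases "\<exists>B'\<in>?O. of_bool (uB B' u) + 1 \<le> cB B' u C")
    case True
    then obtain B' where "B' \<in> ?O" "of_bool (uB B' u) + 1 \<le> cB B' u C" by blast
    moreover have "1 \<le> cB B' u C" using calculation(2) by (cases "uB B' u") auto
    ultimately show ?thesis using that by blast
  next
    case False
    then have "cB B' u C - of_bool (uB B' u) = 0" if "B' \<in> ?O" for B'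
      using pos[OF that] that by force
    then have s: "(\<Sum>B'\<in>?O. cB B' u C - of_bool (uB B' u)) = 0" by (intro sum.neutral) blast
    then have uVT: "uV u B" using cVC cap by (cases "uV u B") auto
    then obtain B' where "B' \<in> ?O" "uB B' u" using uV[OF v] by blast
    then show ?thesis using that[of B'] pos[of B'] s cVC uVT by simp
  qed
  have BA': "B' \<in> BA u" using B' by blast
  let ?X = "insert u (side B' u)"
  have "cB B' u (C \<inter> ?X) = cB B' u C" by (rule cB_local[OF vO[OF B'(1)]]) blast
  then obtain S' where S': "reach ?X (C \<inter> ?X) S'" "u \<notin> S'" "cB B' u C - 1 \<le> cB B' u S'"
    using IH[OF B'(1)] B'(2) C ind_subset[OF C(2), of "C \<inter> ?X"] unfolding pushB_def
    by (metis Int_iff Int_lower1 Int_lower2 insertI1)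
  define K where "K = C - ?X"
  define S where "S = S' \<union> K"
  have sX: "side B' u \<subseteq> hang u B - {u}" using hang_sides[OF BA] B'(1) by blast
  have XK: "\<not> E x k" if "x \<in> ?X" "k \<in> K" for x k
    using that side_edge[OF BA', of x k] C unfolding K_def ind_def by blast
  have r: "reach (hang u B) (C \<inter> ?X \<union> K) (S' \<union> K)"
    using sX C hang_self[OF BA] XK ind_subset[OF C(2), of K] unfolding K_def
    by (intro reach_Un[OF S'(1)]) blast+
  moreover have "C \<inter> ?X \<union> K = C" unfolding K_def by blast
  ultimately have r: "reach (hang u B) C S" unfolding S_def by simp
  have uS: "u \<notin> S" using S' unfolding S_def K_def by blast
  have S'X: "S' \<subseteq> side B' u" using reach_in[OF S'(1)] S'(2) by blast
  have iS: "ind S" using reach_in[OF r] by blast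
  have cS': "cB B' u S = cB B' u S'"
    by (rule cB_local[OF vO[OF B'(1)]]) (unfold S_def K_def, blast)
  have cSo: "cB B'' u S = cB B'' u C" if B'': "B'' \<in> ?O - {B'}" for B''
  proof (rule cB_local[OF vO])
    show "B'' \<in> ?O" using B'' by blast
    have "side B'' u \<inter> ?X = {}" using side_disj[OF BA', of B''] B'' side_subset[of B'' u] by blast
    then show "S \<inter> side B'' u = C \<inter> side B'' u" using S'X unfolding S_def K_def by blast
  qed
  have "cV u B C - 1 \<le> cV u B S"
  proof (cases "cV u B C = 1")
    case True
    then show ?thesis using cV_nonneg[OF v iS] by simp
  next
    case False
    then have ge: "of_bool (uB B' u) \<le> cB B' u S" using alt cS' S'(3) by linarith
    have posS: "of_bool (uB B'' u) \<le> cB B'' u S" if "B'' \<in> ?O" for B''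
      using ge cSo[of B''] pos[OF that] that by (cases "B'' = B'") auto
    have nzS: "\<not> (\<exists>B'\<in>?O. cB B' u S = 0 \<and> uB B' u)" using posS by fastforce
    have fO: "finite ?O" using finite_BA by simp
    have "(\<Sum>B'\<in>?O - {B'}. cB B' u S - of_bool (uB B' u)) = (\<Sum>B'\<in>?O - {B'}. cB B' u C - of_bool (uB B' u))"
      using cSo by (intro sum.cong) auto
    then have "(\<Sum>B'\<in>?O. cB B' u S - of_bool (uB B' u)) \<ge> (\<Sum>B'\<in>?O. cB B' u C - of_bool (uB B' u)) - 1"
      using sum.remove[OF fO B'(1), of "\<lambda>B'. cB B' u S - of_bool (uB B' u)"]
        sum.remove[OF fO B'(1), of "\<lambda>B'. cB B' u C - of_bool (uB B' u)"] cS' S'(3) by simp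
    then show ?thesis using cVC cV_sum[OF v nzS] by simp
  qed
  then show "\<exists>S. reach (hang u B) C S \<and> u \<notin> S \<and> cV u B C - 1 \<le> cV u B S" using r uS by blast
qed

text \<open>First vacate the neighbours of \<open>x\<close> in \<open>hang x B\<close>, then move the token at \<open>a\<close> to \<open>x\<close>.\<close>

lemma enter_kap:
  assumes BAa: "a \<in> B" and x: "x \<in> B" "x \<noteq> a" "valid x B" and fr: "freeV x B"
    and C: "C \<subseteq> X" "ind C" "a \<in> C" and X: "hang x B \<subseteq> X" and cap: "of_bool (uV x B) \<le> cV x B C"
  shows "\<exists>T. reach X C (insert x (T \<union> (C - hang x B - {a}))) \<and> T \<subseteq> hang x B - {x} \<and>
    cV x B C \<le> cV x B T"
proof -
  have BA: "B \<in> BA x" using x unfolding valid_def by blast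
  let ?H = "hang x B - {x}"
  have CB: "C \<inter> B = {a}" using C BAa BA_clq[OF BA] unfolding ind_def by blast
  have CH: "C \<inter> hang x B = C \<inter> ?H" using CB x by blast
  have "cV x B (C \<inter> ?H) = cV x B C" by (rule cV_local[OF x(3)]) blast
  then obtain T where T: "reach ?H (C \<inter> ?H) T" "T \<inter> nb x = {}" "cV x B C \<le> cV x B T"
    using fr cap ind_subset[OF C(2), of "C \<inter> ?H"] unfolding freeV_def
    by (metis Int_lower1 Int_lower2)
  define K where "K = C - hang x B"
  have HK: "\<not> E y k" if "y \<in> ?H" "k \<in> K" for y k
    using hang_edge[OF BA, of y k] that unfolding K_def by blast
  have TH: "T \<subseteq> ?H" "ind T" using reach_in[OF T(1)] by auto
  have "reach X (C \<inter> ?H \<union> K) (T \<union> K)"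
    using X C HK ind_subset[OF C(2), of K] unfolding K_def by (intro reach_Un[OF T(1)]) blast+
  moreover have "C \<inter> ?H \<union> K = C" using CH unfolding K_def by blast
  ultimately have r: "reach X C (T \<union> K)" by simp
  have ah: "a \<notin> hang x B" using hang_Int_B[OF BA] BAa x(2) by auto
  have aK: "a \<in> K" using C ah unfolding K_def by blast
  have xn: "x \<notin> T \<union> K" using TH hang_self[OF BA] unfolding K_def by blast
  have "ind (insert x (T \<union> K - {a}))"
  proof -
    have "\<not> E x y" if y: "y \<in> T \<union> K - {a}" for y
    proof (cases "y \<in> T")
      case True
      then show ?thesis using T(2) unfolding nb_def by blast
    next
      case False
      then have "y \<in> C" "y \<notin> hang x B" using y unfolding K_def by auto
      then have "y \<notin> B" using CB y by blast
      then show ?thesis using hang_edge[OF BA hang_self[OF BA], of y] \<open>y \<notin> hang x B\<close> by blast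
    qed
    moreover have "ind (T \<union> K - {a})" using reach_in[OF r] ind_subset[of "T \<union> K" "T \<union> K - {a}"] by blast
    ultimately show ?thesis using irr sym unfolding ind_def by blast
  qed
  moreover have "E a x" using BA_clq[OF BA BAa x(1)] x(2) by blast
  ultimately have "mv X (T \<union> K) (insert x (T \<union> K - {a}))"
    using aK xn reach_in[OF r] X hang_self[OF BA] by (intro mvI) auto
  then have "reach X C (insert x (T \<union> K - {a}))" by (rule reach_step[OF r])
  moreover have "insert x (T \<union> K - {a}) = insert x (T \<union> (C - hang x B - {a}))"
  proof -
    have "a \<notin> T" using TH(1) ah by blast
    then have "T \<union> K - {a} = T \<union> (C - hang x B - {a})" unfolding K_def by blast
    then show ?thesis by simp
  qed
  ultimately show ?thesis using TH(1) T(3) by (intro exI[of _ T]) simp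
qed

text \<open>The token on \<open>u\<close> needs a place in \<open>B\<close>. A vertex
  \<open>w\<close> in no other block is available at once, because its neighbours lie in
  \<open>B\<close>, where no other token is. Without such a vertex the token enters some
  \<open>x\<close> of \<open>kap B u\<close> whose hanging part can first be cleared around
  \<open>x\<close>.\<close>

lemma pushB_step:
  assumes v: "valid u B" and IH: "\<And>x. x \<in> kap B u \<Longrightarrow> freeV x B"
  shows "pushB B u"
  unfolding pushB_def
proof (intro allI impI)
  let ?X = "insert u (side B u)"
  fix C assume C: "C \<subseteq> ?X" "ind C" "u \<in> C" and cap: "1 \<le> cB B u C"
  have BA: "B \<in> BA u" using v unfolding valid_def by blast
  have CB: "C \<inter> B = {u}" using C BA_clq[OF BA] BA_V(3)[OF BA] unfolding ind_def by blast
  then have BC: "B \<inter> (C - {u}) = {}" by blast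
  have cC: "cB B u C = (\<Sum>v\<in>kap B u. cV v B C) + of_bool (uB B u)" using cB[OF v, of C] BC by simp
  have nn: "0 \<le> cV x B C" if "x \<in> kap B u" for x using cV_nonneg[OF kap_valid[OF that BA] C(2)] .
  show "\<exists>S. reach ?X C S \<and> u \<notin> S \<and> cB B u C - 1 \<le> cB B u S"
  proof (cases "\<exists>w\<in>B - {u}. w \<notin> kap B u")
    case True
    then obtain w where w: "w \<in> B" "w \<noteq> u" "w \<notin> kap B u" by blast
    then have BAw: "BA w = {B}" unfolding kap_def by blast
    let ?S = "insert w (C - {u})"
    have wn: "y \<in> B" if "E w y" for y using ex_BA_edge[OF that] BAw by auto
    have "ind ?S"
      using C(2) wn BC irr sym unfolding ind_def by blast
    then have "mv ?X C ?S"
      using C w BC BA_clq[OF BA, of u w] BA_V(3)[OF BA] B_side[of B u] by (intro mvI) auto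
    moreover have "cB B u C - 1 \<le> cB B u ?S"
    proof -
      have "cV x B ?S = cV x B C" if x: "x \<in> kap B u" for x
      proof (rule cV_local[OF kap_valid[OF x BA]])
        have "w \<notin> hang x B" "u \<notin> hang x B"
          using hang_Int_B[OF BA_swap[OF BA kap_in(1)[OF x]]] w kap_in[OF x] x BA_V(3)[OF BA] by auto
        then show "?S \<inter> (hang x B - {x}) = C \<inter> (hang x B - {x})" by blast
      qed
      moreover have "B \<inter> (?S - {u}) = {w}" using BC w by blast
      ultimately show ?thesis using cC cB[OF v, of ?S] by simp
    qed
    ultimately show ?thesis using reach_mv w(2) by (intro exI[of _ ?S]) auto
  next
    case False
    then have Beq: "B = kap B u \<union> {u}" using BA_V(3)[OF BA] kap_in(1) by blast
    \<comment> \<open>If \<open>uB B u\<close> holds, some \<open>x\<close> violates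
      \<open>uV x B\<close> and its threshold is 0. If it fails, the capacity comes from the sum
      alone, so some summand is positive.\<close>
    obtain x where x: "x \<in> kap B u" "of_bool (uV x B) \<le> cV x B C"
    proof (cases "uB B u")
      case True
      then obtain x where "x \<in> kap B u" "\<not> uV x B" using uB[OF v] Beq by blast
      then show ?thesis using that nn by simp
    next
      case False
      then have "\<not> (\<Sum>v\<in>kap B u. cV v B C) \<le> 0" using cap cC by simp
      then obtain x where "x \<in> kap B u" "\<not> cV x B C \<le> 0" using sum_nonpos by metis
      then show ?thesis using that[of x] by (cases "uV x B") auto
    qed
    have xB: "x \<in> B" "x \<noteq> u" using kap_in[OF x(1)] .
    have vx: "valid x B" using kap_valid[OF x(1) BA] .
    have BAx: "B \<in> BA x" using BA_swap[OF BA xB(1)] .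
    obtain T where T: "reach ?X C (insert x (T \<union> (C - hang x B - {u})))" "T \<subseteq> hang x B - {x}"
        "cV x B C \<le> cV x B T"
      using enter_kap[OF BA_V(3)[OF BA] xB vx IH[OF x(1)] C _ x(2)] hang_subset_side[OF BA xB] by blast
    let ?S = "insert x (T \<union> (C - hang x B - {u}))"
    have uh: "u \<notin> hang x B" using hang_Int_B[OF BAx] BA_V(3)[OF BA] xB(2) by auto
    have "cV x B ?S = cV x B T"
      by (rule cV_local[OF vx]) blast
    moreover have "B \<inter> (?S - {u}) = {x}"
      using T(2) hang_Int_B[OF BAx] BC xB by blast
    moreover have "?S \<inter> (hang y B - {y}) = C \<inter> (hang y B - {y})" if y: "y \<in> kap B u" "y \<noteq> x" for y
    proof -
      have "u \<notin> hang y B"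
        using hang_Int_B[OF BA_swap[OF BA kap_in(1)[OF y(1)]]] BA_V(3)[OF BA] kap_in(2)[OF y(1)] by auto
      moreover have "hang y B \<inter> hang x B = {}"
        using hang_disj[OF BAx kap_in(1)[OF y(1)] y(2)] by blast
      moreover have "x \<notin> hang y B" using calculation hang_self[OF BAx] by blast
      ultimately show ?thesis using T(2) by blast
    qed
    ultimately have "cB B u C - 1 \<le> cB B u ?S"
      using cB_change[OF v x(1), of ?S C] T(3) BC by simp
    moreover have "u \<notin> T" using T(2) uh by blast
    then have "u \<notin> ?S" using xB(2) by simp
    ultimately show ?thesis using T(1) by blast
  qed
qed

text \<open>The clique \<open>B\<close> holds at most one token. If the part hanging there has room,
  the token is pushed into it; otherwise it first slides to another \<open>x\<close> whose part has
  room. Pushing costs one unit, and the vacated \<open>B\<close> gives one back, so no capacity is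
  lost.\<close>

lemma freeB_step:
  assumes v: "valid u B" and IH: "\<And>x. x \<in> kap B u \<Longrightarrow> freeV x B \<and> pushV x B"
  shows "freeB B u"
  unfolding freeB_def
proof (intro allI impI)
  fix C assume C: "C \<subseteq> side B u" "ind C" and cap: "of_bool (uB B u) \<le> cB B u C"
  have BA: "B \<in> BA u" using v unfolding valid_def by blast
  have uC: "u \<notin> C" using C side_subset[OF BA] by blast
  have push: "\<exists>S. reach (side B u) D S \<and> S \<inter> B = {} \<and> cB B u D \<le> cB B u S"
    if D: "D \<subseteq> side B u" "ind D" and x: "x \<in> kap B u" "x \<in> D" "1 \<le> cV x B D" for D x
  proof -
    have xB: "x \<in> B" "x \<noteq> u" using kap_in[OF x(1)] .
    have vx: "valid x B" using kap_valid[OF x(1) BA] .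
    have BAx: "B \<in> BA x" using BA_swap[OF BA xB(1)] .
    let ?H = "hang x B"
    have DB: "D \<inter> B = {x}" using D(2) x(2) xB BA_clq[OF BA] unfolding ind_def by blast
    have "cV x B (D \<inter> ?H) = cV x B D" by (rule cV_local[OF vx]) blast
    then obtain T where T: "reach ?H (D \<inter> ?H) T" "x \<notin> T" "cV x B D - 1 \<le> cV x B T"
      using IH[OF x(1)] x ind_subset[OF D(2), of "D \<inter> ?H"] hang_self[OF BAx] unfolding pushV_def
      by (metis Int_iff Int_lower1 Int_lower2)
    define K where "K = D - ?H"
    have HK: "\<not> E y k" if "y \<in> ?H" "k \<in> K" for y k
    proof
      assume "E y k"
      then have "k \<in> B" using hang_edge[OF BAx, of y k] that unfolding K_def by blast
      then have "k = x" using that DB unfolding K_def by blast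
      then show False using that hang_self[OF BAx] unfolding K_def by blast
    qed
    have TH: "T \<subseteq> ?H" using reach_in[OF T(1)] by blast
    have "reach (side B u) (D \<inter> ?H \<union> K) (T \<union> K)"
      using hang_subset_side[OF BA xB] D HK ind_subset[OF D(2), of K] unfolding K_def
      by (intro reach_Un[OF T(1)]) blast+
    moreover have "D \<inter> ?H \<union> K = D" unfolding K_def by blast
    ultimately have r: "reach (side B u) D (T \<union> K)" by simp
    have TKB: "(T \<union> K) \<inter> B = {}"
    proof -
      have False if y: "y \<in> T \<union> K" "y \<in> B" for y
      proof (cases "y \<in> T")
        case True
        then have "y = x" using TH hang_Int_B[OF BAx] y by auto
        then show False using True T(2) by simp
      next
        case False
        then have "y \<in> D \<inter> B" "y \<notin> hang x B" using y unfolding K_def by auto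
        then show False using DB hang_self[OF BAx] by simp
      qed
      then show ?thesis by blast
    qed
    have "cV x B (T \<union> K) = cV x B T" by (rule cV_local[OF vx]) (unfold K_def, blast)
    moreover have "B \<inter> (D - {u}) = {x}" using DB xB by blast
    moreover have "B \<inter> (T \<union> K - {u}) = {}" using TKB by blast
    moreover have "(T \<union> K) \<inter> (hang y B - {y}) = D \<inter> (hang y B - {y})" if y: "y \<in> kap B u" "y \<noteq> x" for y
      using hang_disj[OF BAx kap_in(1)[OF y(1)] y(2)] TH unfolding K_def by blast
    ultimately have "cB B u D \<le> cB B u (T \<union> K)"
      using cB_change[OF v x(1), of "T \<union> K" D] T(3) by simp
    then show ?thesis using r TKB by blast
  qed
  show "\<exists>S. reach (side B u) C S \<and> S \<inter> B = {} \<and> cB B u C \<le> cB B u S"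
  proof (cases "C \<inter> B = {}")
    case True
    then show ?thesis using reach_refl[OF C] by blast
  next
    case False
    then obtain b where b: "b \<in> C" "b \<in> B" by blast
    have CB: "C \<inter> B = {b}" using C(2) b BA_clq[OF BA] unfolding ind_def by blast
    have bu: "b \<noteq> u" using b uC by blast
    have BC: "B \<inter> (C - {u}) = {b}" using CB bu by blast
    have cC: "cB B u C = (\<Sum>v\<in>kap B u. cV v B C) + of_bool (uB B u) - 1" using cB[OF v, of C] BC by simp
    show ?thesis
    proof (cases "b \<in> kap B u \<and> 1 \<le> cV b B C")
      case True
      then show ?thesis using push[OF C] b by blast
    next
      case no: False
      have uBT: "uB B u"
      proof (rule ccontr)
        assume "\<not> uB B u"
        then have "b \<in> kap B u" "uV b B" using uB[OF v] b bu by auto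
        then show False using no cV_occ[OF kap_valid[OF _ BA] C(2) b(1)] by fastforce
      qed
      \<comment> \<open>The unit of \<open>uB\<close> and the token on \<open>b\<close> cancel, so
        the sum equals the capacity, which is at least 1.\<close>
      then have "\<not> (\<Sum>v\<in>kap B u. cV v B C) \<le> 0" using cap cC by simp
      then obtain x where x: "x \<in> kap B u" "\<not> cV x B C \<le> 0" using sum_nonpos by metis
      then have xb: "x \<noteq> b" using no by auto
      have xB: "x \<in> B" "x \<noteq> u" using kap_in[OF x(1)] .
      have vx: "valid x B" using kap_valid[OF x(1) BA] .
      have BAx: "B \<in> BA x" using BA_swap[OF BA xB(1)] .
      have cx: "of_bool (uV x B) \<le> cV x B C" using x(2) by (cases "uV x B") auto
      obtain T where T: "reach (side B u) C (insert x (T \<union> (C - hang x B - {b})))" "T \<subseteq> hang x B - {x}"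
          "cV x B C \<le> cV x B T"
        using enter_kap[OF b(2) xB(1) xb vx _ C b(1) hang_subset_side[OF BA xB] cx] IH[OF x(1)] by blast
      let ?S = "insert x (T \<union> (C - hang x B - {b}))"
      have cS: "cV x B ?S = cV x B T"
        by (rule cV_local[OF vx]) blast
      moreover have "B \<inter> (?S - {u}) = {x}"
        using T(2) hang_Int_B[OF BAx] CB xB by blast
      moreover have "?S \<inter> (hang y B - {y}) = C \<inter> (hang y B - {y})" if y: "y \<in> kap B u" "y \<noteq> x" for y
      proof -
        have d: "hang y B \<inter> hang x B = {}" "b \<notin> hang y B - {y}"
          using hang_disj[OF BAx kap_in(1)[OF y(1)] y(2)] hang_Int_B[OF BA_swap[OF BA kap_in(1)[OF y(1)]]]
            b by blast+
        then have "x \<notin> hang y B" using hang_self[OF BAx] by blast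
        then show ?thesis using T(2) d by blast
      qed
      ultimately have le: "cB B u C \<le> cB B u ?S"
        using cB_change[OF v x(1), of ?S C] T(3) BC by simp
      have "1 \<le> cV x B ?S" using cS T(3) x(2) by simp
      then obtain S where S: "reach (side B u) ?S S" "S \<inter> B = {}" "cB B u ?S \<le> cB B u S"
        using push[of ?S x] reach_in[OF T(1)] x(1) by blast
      have "reach (side B u) C S" using reach_trans[OF T(1) S(1)] .
      moreover have "cB B u C \<le> cB B u S" using le S(3) by simp
      ultimately show ?thesis using S(2) by blast
    qed
  qed
qed

lemma freeB_holds: "valid u B \<Longrightarrow> freeB B u"
proof -
  assume "valid u B"
  then have "(freeB B u \<and> pushB B u) \<and> (freeV u B \<and> pushV u B)"
  proof (induction rule: valid_induct)
    case (BV u B)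
    then show ?case using freeB_step[OF BV(1)] pushB_step[OF BV(1)] kap_valid[of _ B u] BV(1) valid_def by metis
  next
    case (VB u B)
    then show ?case using freeV_step[OF VB(1)] pushV_step[OF VB(1)] other_valid[of _ u B] VB(1) valid_def by metis
  qed
  then show ?thesis by blast
qed

text \<open>By contraposition of \<open>freeB\<close> the capacity lies below
  \<open>of_bool (uB B u)\<close>. As it is a nonnegative integer, only capacity 0 with
  \<open>uB\<close> True remains.\<close>

lemma blocking_cap:
  assumes v: "valid u B" and C: "ind C"
    and bl: "\<And>S. reach (side B u) (C \<inter> side B u) S \<Longrightarrow> S \<inter> B \<noteq> {}"
  shows "uB B u \<and> cB B u C = 0"
proof -
  have "cB B u (C \<inter> side B u) = cB B u C" by (rule cB_local[OF v]) blast
  then have "\<not> of_bool (uB B u) \<le> cB B u C"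
    using freeB_holds[OF v] bl ind_subset[OF C, of "C \<inter> side B u"] unfolding freeB_def
    by (metis Int_lower1 Int_lower2)
  then show ?thesis using cB_nonneg[OF v C] by (cases "uB B u") auto
qed

end

section \<open>Reachability in terms of \<open>rig\<close> and token counts on components\<close>

context bgraph
begin

theorem reach_iff_rig:
  assumes C: "C \<subseteq> V" "ind C" and D: "D \<subseteq> V" "ind D"
  shows "reach V C D \<longleftrightarrow> rig V C = rig V D \<and>
    (\<forall>X \<in> comp (V - rig V C) ` (V - rig V C). card (C \<inter> X) = card (D \<inter> X))"
proof -
  define Q where "Q = V - rig V C"
  have ne: "\<not> E x z" if "y \<in> Q" "x \<in> comp Q y" "z \<in> Q - comp Q y" for x y z
    using comp_edge[OF that(1,2), of z] that(3) by blast
  show ?thesis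
  proof
    assume r: "reach V C D"
    have rQ: "reach Q C D" using reach_rig[OF r] unfolding Q_def .
    have "card (C \<inter> comp Q y) = card (D \<inter> comp Q y)" if "y \<in> Q" for y
    proof -
      have "reach (comp Q y) (C \<inter> comp Q y) (D \<inter> comp Q y)"
        using ne[OF that] by (intro reach_proj[OF rQ comp_subset[OF that]]) blast
      moreover have "comp Q y \<subseteq> V" using comp_subset[OF that] unfolding Q_def by blast
      ultimately show ?thesis using reach_card by metis
    qed
    then show "rig V C = rig V D \<and>
        (\<forall>X \<in> comp (V - rig V C) ` (V - rig V C). card (C \<inter> X) = card (D \<inter> X))"
      using rig_reach[OF r] unfolding Q_def by blast
  next
    assume a: "rig V C = rig V D \<and>
        (\<forall>X \<in> comp (V - rig V C) ` (V - rig V C). card (C \<inter> X) = card (D \<inter> X))"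
    have QD: "Q = V - rig V D" unfolding Q_def using a by simp
    have r: "reach X (C \<inter> X) (D \<inter> X)" if X: "X \<in> comp Q ` Q" for X
    proof -
      obtain y where y: "y \<in> Q" "X = comp Q y" using X by blast
      have XQ: "X \<subseteq> Q" using comp_subset y by blast
      have "fluid X (C \<inter> X)"
        using XQ ne[OF y(1)] y(2) unfolding Q_def by (intro fluid_comp[OF C(2,1)]) blast+
      moreover have "fluid X (D \<inter> X)"
        using XQ ne[OF y(1)] y(2) unfolding QD by (intro fluid_comp[OF D(2,1)]) blast+
      moreover have "card (C \<inter> X) = card (D \<inter> X)" using a X unfolding Q_def by blast
      moreover have "cn X" "X \<subseteq> V" using comp_cn y XQ unfolding Q_def by auto
      ultimately show ?thesis by (intro fluid_reach_iff_card)
    qed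
    have "finite Q" unfolding Q_def using finite_V by simp
    have "reach (\<Union>(comp Q ` Q)) (C \<inter> \<Union>(comp Q ` Q)) (D \<inter> \<Union>(comp Q ` Q))"
    proof (rule reach_Union)
      show "finite (comp Q ` Q)" using \<open>finite Q\<close> by simp
      show "reach X (C \<inter> X) (D \<inter> X)" if "X \<in> comp Q ` Q" for X using r[OF that] .
      fix X Y x y assume XY: "X \<in> comp Q ` Q" "Y \<in> comp Q ` Q" "X \<noteq> Y" "x \<in> X" "y \<in> Y"
      then obtain p q where pq: "p \<in> Q" "q \<in> Q" "X = comp Q p" "Y = comp Q q" by blast
      have "y \<notin> X"
      proof
        assume "y \<in> X"
        then have "conn Q p y" "conn Q q y" using XY(5) pq unfolding comp_def by auto
        then have "conn Q p q" using conn_sym conn_trans by blast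
        then have "X = Y" unfolding pq comp_def using conn_sym conn_trans by blast
        then show False using XY by blast
      qed
      moreover have "y \<in> Q" using comp_subset[OF pq(2)] pq XY by blast
      ultimately show "x \<noteq> y \<and> \<not> E x y" using ne[OF pq(1), of x y] XY pq(3) by blast
    qed
    moreover have "\<Union>(comp Q ` Q) = Q"
    proof
      show "\<Union>(comp Q ` Q) \<subseteq> Q" using comp_subset[of _ Q] by (intro UN_least)
      show "Q \<subseteq> \<Union>(comp Q ` Q)" using comp_self by (intro subsetI UN_I)
    qed
    moreover have "C \<inter> Q = C" "D \<inter> Q = D"
    proof -
      show "C \<inter> Q = C" unfolding Q_def using rig_empty_reach[OF C] C(1) by blast
      show "D \<inter> Q = D" unfolding QD using rig_empty_reach[OF D] D(1) by blast
    qed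
    ultimately have "reach Q C D" by simp
    then show "reach V C D" by (rule reach_mono) (auto simp: Q_def)
  qed
qed

end

section \<open>Rigid vertices, permanently occupied blocks and potentials\<close>

context cbgraph
begin

lemma side_reach:
  assumes "B \<in> BA u" "reach (V - {u}) C D"
  shows "reach (side B u) (C \<inter> side B u) (D \<inter> side B u)"
  using side_subset[OF assms(1)] side_edge[OF assms(1)]
  by (intro reach_proj[OF assms(2)]) blast+

text \<open>If at most one block at \<open>u\<close> is permanently occupied, all others can be vacated
  simultaneously, since the sides of an unoccupied vertex do not interact.\<close>

lemma rig_two_blocking:
  assumes u: "u \<in> rig V C" and C: "C \<subseteq> V" "ind C"
  shows "\<exists>B\<in>BA u. \<exists>B'\<in>BA u. B \<noteq> B' \<and>
    (\<forall>S. reach (side B u) (C \<inter> side B u) S \<longrightarrow> S \<inter> B \<noteq> {}) \<and>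
    (\<forall>S. reach (side B' u) (C \<inter> side B' u) S \<longrightarrow> S \<inter> B' \<noteq> {})"
proof (rule ccontr)
  assume n: "\<not> ?thesis"
  define bl where "bl B \<longleftrightarrow> (\<forall>S. reach (side B u) (C \<inter> side B u) S \<longrightarrow> S \<inter> B \<noteq> {})" for B
  have uV: "u \<in> V" using u unfolding rig_def by blast
  have uC: "u \<notin> C" using rig_empty_reach[OF C] u by blast
  have n: "B = B'" if "B \<in> BA u" "B' \<in> BA u" "bl B" "bl B'" for B B'
    using n that unfolding bl_def by blast
  have "\<exists>S. reach (side B u) (C \<inter> side B u) S \<and> (\<not> bl B \<longrightarrow> S \<inter> B = {})" for B
  proof (cases "bl B")
    case True
    then show ?thesis using reach_refl[of "C \<inter> side B u"] ind_subset[OF C(2)] by blast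
  qed (auto simp: bl_def)
  then obtain S where S: "\<And>B. reach (side B u) (C \<inter> side B u) (S B)" "\<And>B. \<not> bl B \<Longrightarrow> S B \<inter> B = {}"
    by metis
  define J where "J = (\<Union>B\<in>BA u. S B)"
  have Ss: "S B \<subseteq> side B u" for B using reach_in[OF S(1)] by blast
  have Js: "J \<inter> side B u = S B" if "B \<in> BA u" for B
    unfolding J_def using Ss side_disj[OF that] that by blast
  have U: "\<Union>((\<lambda>B. side B u) ` BA u) = V - {u}"
    using side_cover[OF uV] side_subset by blast
  have "reach (\<Union>((\<lambda>B. side B u) ` BA u)) (C \<inter> \<Union>((\<lambda>B. side B u) ` BA u)) (J \<inter> \<Union>((\<lambda>B. side B u) ` BA u))"
  proof (rule reach_Union)
    show "finite ((\<lambda>B. side B u) ` BA u)" using finite_BA by simp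
    show "reach X (C \<inter> X) (J \<inter> X)" if "X \<in> (\<lambda>B. side B u) ` BA u" for X
    proof -
      obtain B where B: "B \<in> BA u" "X = side B u" using \<open>X \<in> _\<close> by blast
      show ?thesis using S(1)[of B] Js[OF B(1)] B(2) by simp
    qed
    fix X Y x y assume XY: "X \<in> (\<lambda>B. side B u) ` BA u" "Y \<in> (\<lambda>B. side B u) ` BA u" "X \<noteq> Y" "x \<in> X" "y \<in> Y"
    then obtain B1 B2 where B12: "B1 \<in> BA u" "B2 \<in> BA u" "X = side B1 u" "Y = side B2 u" by blast
    then have "y \<notin> side B1 u" using side_disj[OF B12(1,2), of y] XY by blast
    moreover have "y \<noteq> u" using side_subset[OF B12(2)] XY(5) B12(4) by blast
    ultimately show "x \<noteq> y \<and> \<not> E x y" using side_edge[OF B12(1), of x y] B12 XY by blast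
  qed
  moreover have "C \<inter> (V - {u}) = C" using C uC by blast
  moreover have "J \<inter> (V - {u}) = J"
    unfolding J_def using Ss side_subset by blast
  ultimately have r: "reach (V - {u}) C J" unfolding U by simp
  then have "reach V C J" by (rule reach_mono) blast
  then have c: "2 \<le> card (nb u \<inter> J)" using u unfolding rig_def by blast
  have iJ: "ind J" "J \<subseteq> V - {u}" using reach_in[OF r] by auto
  have "\<exists>B\<in>BA u. bl B \<and> y \<in> B" if y: "y \<in> nb u \<inter> J" for y
  proof -
    obtain B where B: "B \<in> BA u" "y \<in> S B" using y unfolding J_def by blast
    have "E u y" using y iJ unfolding nb_def by blast
    then have "y \<in> B" using side_nb[OF B(1)] Ss B(2) by blast
    then show ?thesis using S(2)[of B] B by blast
  qed
  \<comment> \<open>All tokens near \<open>u\<close> sit in permanently occupied blocks. By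
    assumption there is at most one, and it is a clique.\<close>
  then have "x = y" if "x \<in> nb u \<inter> J" "y \<in> nb u \<inter> J" for x y
    using that n BA_clq iJ unfolding ind_def by (metis IntD2)
  then have "card (nb u \<inter> J) \<le> 1"
    using finite_nb[of u] card_le_Suc0_iff_eq[of "nb u \<inter> J"] by simp
  then show False using c by simp
qed

end

context capacity
begin

definition potential :: "'a set \<Rightarrow> 'a \<Rightarrow> 'a set \<Rightarrow> int" where
  "potential B u C = Max ((\<lambda>D. cB B u D + int (card (D \<inter> side B u)) - int (card (C \<inter> side B u))) `
     {D. reach V C D})"

lemma finite_reach: "finite {D. reach V C D}"
  by (rule finite_subset[of _ "Pow V"]) (use reach_in finite_V in auto)

lemma potential_ge:
  "reach V C D \<Longrightarrow> cB B u D + int (card (D \<inter> side B u)) - int (card (C \<inter> side B u)) \<le> potential B u C"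
  unfolding potential_def using finite_reach by (intro Max_ge) auto

text \<open>From left to right: \<open>u\<close> is never entered, so the token counts of the sides
  are constant and the two blocking blocks remain blocking; by \<open>blocking_cap\<close> all
  values in the maximum are 0. From right to left: an invariant keeps \<open>u\<close> empty and
  both counts unchanged, and this forces a token into each of the two blocks at all times.\<close>

theorem rig_iff_potential:
  assumes C: "C \<subseteq> V" "ind C"
  shows "u \<in> rig V C \<longleftrightarrow> (\<exists>B\<in>BA u. \<exists>B'\<in>BA u. B \<noteq> B' \<and>
    potential B u C = 0 \<and> potential B' u C = 0 \<and> uB B u \<and> uB B' u)"
proof
  assume u: "u \<in> rig V C"
  then obtain B B' where B: "B \<in> BA u" "B' \<in> BA u" "B \<noteq> B'"
      "\<And>S. reach (side B u) (C \<inter> side B u) S \<Longrightarrow> S \<inter> B \<noteq> {}"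
      "\<And>S. reach (side B' u) (C \<inter> side B' u) S \<Longrightarrow> S \<inter> B' \<noteq> {}"
    using rig_two_blocking[OF u C] by blast
  have *: "uB A u \<and> potential A u C = 0"
    if A: "A \<in> BA u" "valid u A" "\<And>S. reach (side A u) (C \<inter> side A u) S \<Longrightarrow> S \<inter> A \<noteq> {}" for A
  proof -
    have D: "uB A u \<and> cB A u D = 0 \<and> card (D \<inter> side A u) = card (C \<inter> side A u)" if D: "reach V C D" for D
    proof -
      have "reach (V - {u}) C D"
        by (rule reach_mono[OF reach_rig[OF D]]) (use u in blast)
      then have r: "reach (side A u) (C \<inter> side A u) (D \<inter> side A u)" by (rule side_reach[OF A(1)])
      then have "card (D \<inter> side A u) = card (C \<inter> side A u)"
        using side_subset[OF A(1)] by (intro reach_card) blast+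
      moreover have "uB A u \<and> cB A u D = 0"
      proof (rule blocking_cap[OF A(2)])
        show "ind D" using reach_in[OF D] by blast
        show "S \<inter> A \<noteq> {}" if "reach (side A u) (D \<inter> side A u) S" for S
          using A(3)[OF reach_trans[OF r that]] .
      qed
      ultimately show ?thesis by blast
    qed
    have "reach V C C" using C reach_refl by blast
    have "(\<lambda>D. cB A u D + int (card (D \<inter> side A u)) - int (card (C \<inter> side A u))) `
     {D. reach V C D} = (\<lambda>D. 0) ` {D. reach V C D}"
      using D by (intro image_cong refl) simp
    also have "\<dots> = {0}" using \<open>reach V C C\<close> by (intro image_constant[of C]) simp
    finally have "potential A u C = 0" unfolding potential_def by simp
    then show ?thesis using D \<open>reach V C C\<close> by blast
  qed
  have "valid u B" "valid u B'" using B unfolding valid_def by auto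
  then show "\<exists>B\<in>BA u. \<exists>B'\<in>BA u. B \<noteq> B' \<and>
    potential B u C = 0 \<and> potential B' u C = 0 \<and> uB B u \<and> uB B' u"
    using *[OF B(1) _ B(4)] *[OF B(2) _ B(5)] B by blast
next
  assume "\<exists>B\<in>BA u. \<exists>B'\<in>BA u. B \<noteq> B' \<and>
    potential B u C = 0 \<and> potential B' u C = 0 \<and> uB B u \<and> uB B' u"
  then obtain B B' where B: "B \<in> BA u" "B' \<in> BA u" "B \<noteq> B'" "potential B u C = 0" "potential B' u C = 0"
      "uB B u" "uB B' u" by blast
  have v: "valid u B" "valid u B'" using B unfolding valid_def by auto
  define good where "good A \<longleftrightarrow> A \<in> BA u \<and> valid u A \<and> potential A u C = 0 \<and> uB A u" for A
  have gd: "good B" "good B'" using B v unfolding good_def by auto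
  \<comment> \<open>An empty block would have capacity at least 1 because \<open>uB\<close> holds;
    with an unchanged token count this would make the potential positive.\<close>
  have occ: "A \<inter> (D - {u}) \<noteq> {}"
    if "good A" "reach V C D" "card (D \<inter> side A u) = card (C \<inter> side A u)" for A D
  proof
    assume "A \<inter> (D - {u}) = {}"
    then have "1 \<le> cB A u D"
      using cB_free[of u A D] reach_in[OF that(2)] that(1) unfolding good_def by simp
    then show False using potential_ge[OF that(2), of A u] that(1,3) unfolding good_def by simp
  qed
  have noocc: False
    if "good A" "reach V C D" "card (D \<inter> side A u) = card (C \<inter> side A u)" "u \<in> D" for A D
  proof -
    have "A \<in> BA u" using that(1) unfolding good_def by blast
    then have "A \<inter> (D - {u}) = {}"
      using reach_in[OF that(2)] that(4) BA_clq[of A u u] BA_V(3)[of A u] unfolding ind_def by blast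
    then show False using occ that by blast
  qed
  have inv: "u \<notin> D \<and> card (D \<inter> side B u) = card (C \<inter> side B u) \<and> card (D \<inter> side B' u) = card (C \<inter> side B' u)"
    if "reach V C D" for D
    using that
  proof (induction rule: reach_induct)
    case base
    then show ?case using noocc[OF gd(1) reach_refl[OF base]] by blast
  next
    case (step J K)
    have rK: "reach V C K" using reach_step step by blast
    from step(2) obtain a b where ab: "a \<in> J" "b \<notin> J" "a \<in> V" "b \<in> V" "E a b" "K = insert b (J - {a})"
        "J \<subseteq> V" "K \<subseteq> V" "ind J" "ind K"
      by (rule mvE)
    have fJ: "finite J" using ab finite_sub by blast
    have same: "K \<inter> side A u = J \<inter> side A u" if "a \<notin> side A u" "b \<notin> side A u" for A
      using ab that by auto
    have us: "u \<notin> side A u" if "A \<in> BA u" for A using side_subset[OF that] by blast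
    have "b \<noteq> u"
    proof
      assume bu: "b = u"
      \<comment> \<open>A token entering \<open>u\<close> leaves only one side, so at least one of
        the two blocks keeps its count. With \<open>u\<close> occupied that block is empty, which
        \<open>noocc\<close> rules out.\<close>
      have "a \<notin> side B u \<or> a \<notin> side B' u" using side_disj[OF B(1,2)] B(3) by blast
      then show False
      proof
        assume "a \<notin> side B u"
        then have "K \<inter> side B u = J \<inter> side B u" using same us[OF B(1)] bu by blast
        then show False using noocc[OF gd(1) rK] step.IH ab(6) bu by simp
      next
        assume "a \<notin> side B' u"
        then have "K \<inter> side B' u = J \<inter> side B' u" using same us[OF B(2)] bu by blast
        then show False using noocc[OF gd(2) rK] step.IH ab(6) bu by simp
      qed
    qed
    have au: "a \<noteq> u" using step.IH ab by blast
    have "card (K \<inter> side A u) = card (J \<inter> side A u)" if A: "A \<in> BA u" for A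
    proof (cases "a \<in> side A u")
      case True
      then have "b \<in> side A u" using side_edge[OF A True _ ab(5)] \<open>b \<noteq> u\<close> by blast
      then have "K \<inter> side A u = insert b (J \<inter> side A u - {a})" using ab by auto
      then show ?thesis
        using True ab(1,2) fJ card_Suc_Diff1[of "J \<inter> side A u" a] by simp
    next
      case False
      then have "b \<notin> side A u" using side_edge[OF A _ False sym[OF ab(5)]] au by blast
      then show ?thesis using same[OF False] by simp
    qed
    then show ?case using step.IH \<open>b \<noteq> u\<close> au B(1,2) ab(6) by auto
  qed
  have "2 \<le> card (nb u \<inter> D)" if D: "reach V C D" for D
  proof -
    obtain b where b: "b \<in> B" "b \<in> D" "b \<noteq> u" using occ[OF gd(1) D] inv[OF D] by blast
    obtain b' where b': "b' \<in> B'" "b' \<in> D" "b' \<noteq> u" using occ[OF gd(2) D] inv[OF D] by blast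
    have "b \<noteq> b'" using BA_Int[OF B(1,2)] b b' B(3) by blast
    moreover have "{b, b'} \<subseteq> nb u \<inter> D"
      using b b' BA_clq[OF B(1) BA_V(3)[OF B(1)] b(1)] BA_clq[OF B(2) BA_V(3)[OF B(2)] b'(1)]
      unfolding nb_def by auto
    then have "card {b, b'} \<le> card (nb u \<inter> D)" using finite_nb by (intro card_mono) auto
    ultimately show ?thesis by simp
  qed
  then show "u \<in> rig V C" using BA_V(2)[OF B(1)] unfolding rig_def by blast
qed

end

context ugraph
begin

section \<open>Subgraphs represented by vertex sets\<close>

text \<open>The interface between digraphs and vertex sets. Only the arc relation is compared, so
  induced subgraphs, vertex deletions and the graphs \<open>part\<close> can all be handled as
  subsets of \<open>V\<close>.\<close>

definition represents :: "('a, 'b) pre_digraph \<Rightarrow> 'a set \<Rightarrow> bool" where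
  "represents H S \<longleftrightarrow> fin_digraph H \<and> verts H = S \<and> S \<subseteq> V \<and>
     (\<forall>a b. a \<rightarrow>\<^bsub>H\<^esub> b \<longleftrightarrow> a \<in> S \<and> b \<in> S \<and> E a b)"

definition biconn :: "'a set \<Rightarrow> bool" where
  "biconn S \<longleftrightarrow> S \<noteq> {} \<and> cn S \<and> (\<forall>v\<in>S. cn (S - {v}))"

lemma representsD:
  assumes "represents H S"
  shows "fin_digraph H" "wf_digraph H" "verts H = S" "S \<subseteq> V"
    "a \<rightarrow>\<^bsub>H\<^esub> b \<longleftrightarrow> a \<in> S \<and> b \<in> S \<and> E a b" "symmetric H"
proof -
  show *: "fin_digraph H" "verts H = S" "S \<subseteq> V" "a \<rightarrow>\<^bsub>H\<^esub> b \<longleftrightarrow> a \<in> S \<and> b \<in> S \<and> E a b" for a b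
    using assms unfolding represents_def by auto
  show "wf_digraph H" using *(1) by (simp add: fin_digraph_def)
  show "symmetric H" unfolding symmetric_def using *(4) sym by (auto intro!: symI)
qed

lemma reachable_iff_conn:
  assumes "represents H S"
  shows "a \<rightarrow>\<^sup>*\<^bsub>H\<^esub> b \<longleftrightarrow> a \<in> S \<and> conn S a b"
proof
  assume "a \<rightarrow>\<^sup>*\<^bsub>H\<^esub> b"
  then show "a \<in> S \<and> conn S a b"
    unfolding reachable_def representsD(3)[OF assms]
  proof (induction rule: rtrancl_on_induct)
    case (step y z)
    then have "conn S y z" using representsD(5)[OF assms] by (intro conn_edge) auto
    then show ?case using step conn_trans by blast
  qed simp
next
  assume a: "a \<in> S \<and> conn S a b"
  then have "(\<lambda>x y. x \<in> S \<and> y \<in> S \<and> E x y)\<^sup>*\<^sup>* a b" "a \<in> S" unfolding conn_def by auto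
  then show "a \<rightarrow>\<^sup>*\<^bsub>H\<^esub> b"
    unfolding reachable_def representsD(3)[OF assms]
  proof (induction rule: rtranclp_induct)
    case (step y z)
    then have "(y, z) \<in> arcs_ends H" using representsD(5)[OF assms, of y z] by blast
    then show ?case using step by (auto intro: rtrancl_on_into_rtrancl_on)
  qed simp
qed

lemma connected_iff_cn:
  assumes "represents H S"
  shows "Digraph_Component.connected H \<longleftrightarrow> S \<noteq> {} \<and> cn S"
proof -
  interpret wf_digraph H using representsD(2)[OF assms] .
  show ?thesis
    unfolding connected_def strongly_connected_def cn_def
    using reachable_mk_symmetric_eq[OF representsD(6)[OF assms]] reachable_iff_conn[OF assms]
      representsD(3)[OF assms] by auto
qed

lemma scc_of_eq_comp:
  assumes "represents H S" "u \<in> S"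
  shows "pre_digraph.scc_of H u = comp S u"
  unfolding pre_digraph.scc_of_def comp_def
  using reachable_iff_conn[OF assms(1)] assms(2) conn_sym conn_in by auto

lemma sccs_eq_comp:
  assumes "represents H S"
  shows "verts ` pre_digraph.sccs H = comp S ` S"
    "card (pre_digraph.sccs H) = card (comp S ` S)"
proof -
  interpret fin_digraph H using representsD(1)[OF assms] .
  have "sccs_verts = comp S ` S"
    using sccs_verts_conv_scc_of scc_of_eq_comp[OF assms] representsD(3)[OF assms] by auto
  then show "verts ` sccs = comp S ` S" "card sccs = card (comp S ` S)"
    using sccs_verts_conv card_sccs_verts by auto
qed

lemma represents_induce:
  assumes "represents H S" "T \<subseteq> S"
  shows "represents (H \<restriction> T) T"
proof -
  interpret fin_digraph H using representsD(1)[OF assms(1)] .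
  have "fin_digraph (H \<restriction> T)"
    using assms(2) representsD(3)[OF assms(1)]
    by unfold_locales (auto intro: finite_subset)
  moreover have "a \<rightarrow>\<^bsub>H \<restriction> T\<^esub> b \<longleftrightarrow> a \<in> T \<and> b \<in> T \<and> E a b" for a b
  proof -
    have "a \<rightarrow>\<^bsub>H \<restriction> T\<^esub> b \<longleftrightarrow> a \<in> T \<and> b \<in> T \<and> a \<rightarrow>\<^bsub>H\<^esub> b"
      unfolding arcs_ends_conv by auto
    then show ?thesis using representsD(5)[OF assms(1), of a b] assms(2) by blast
  qed
  ultimately show ?thesis
    unfolding represents_def using assms(2) representsD(4)[OF assms(1)] by simp
qed

lemma represents_del_vert:
  assumes "represents H S"
  shows "represents (pre_digraph.del_vert H v) (S - {v})"
proof -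
  interpret fin_digraph H using representsD(1)[OF assms] .
  have "a \<rightarrow>\<^bsub>del_vert v\<^esub> b \<longleftrightarrow> a \<in> S - {v} \<and> b \<in> S - {v} \<and> E a b" for a b
  proof -
    have "a \<rightarrow>\<^bsub>del_vert v\<^esub> b \<longleftrightarrow> a \<noteq> v \<and> b \<noteq> v \<and> a \<rightarrow>\<^bsub>H\<^esub> b"
      unfolding arcs_ends_conv del_vert_simps by auto
    then show ?thesis using representsD(5)[OF assms, of a b] by blast
  qed
  then show ?thesis
    unfolding represents_def using representsD(3,4)[OF assms] fin_digraph_del_vert
    by (auto simp: verts_del_vert)
qed

text \<open>The bound is at most 1 rather than equal to 1 to include the empty set, which arises
  when the only vertex is deleted.\<close>

lemma card_comp_le_1:
  assumes "finite S"
  shows "card (comp S ` S) \<le> 1 \<longleftrightarrow> cn S"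
proof
  assume c: "card (comp S ` S) \<le> 1"
  have "\<forall>x\<in>comp S ` S. \<forall>y\<in>comp S ` S. x = y"
    by (rule card_le_Suc0_iff_eq[OF finite_imageI[OF assms], THEN iffD1]) (use c in simp)
  then have "comp S a = comp S b" if "a \<in> S" "b \<in> S" for a b using that by blast
  then have "b \<in> comp S a" if "a \<in> S" "b \<in> S" for a b using comp_self that by blast
  then show "cn S" unfolding cn_def comp_def by simp
next
  assume "cn S"
  then have "comp S a = S" if "a \<in> S" for a
    using that comp_subset[OF that] unfolding cn_def comp_def by blast
  then have "comp S ` S \<subseteq> {S}" by blast
  then show "card (comp S ` S) \<le> 1" using card_mono[of "{S}"] by fastforce
qed

lemma cut_vertices_eq:
  assumes "represents H S" "cn S"
  shows "cut_vertices H = {v \<in> S. \<not> cn (S - {v})}"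
proof -
  have fS: "finite S" using representsD(4)[OF assms(1)] finite_sub by blast
  have "card (comp S ` S) = 1" if "v \<in> S" for v
  proof -
    have "card (comp S ` S) \<noteq> 0" using fS that by auto
    then show ?thesis using card_comp_le_1[OF fS] assms(2) by linarith
  qed
  moreover have "card (comp (S - {v}) ` (S - {v})) > 1 \<longleftrightarrow> \<not> cn (S - {v})" for v
    using card_comp_le_1[of "S - {v}"] fS by auto
  ultimately show ?thesis
    unfolding cut_vertices_def
    using sccs_eq_comp(2)[OF assms(1)] sccs_eq_comp(2)[OF represents_del_vert[OF assms(1)]]
      representsD(3)[OF assms(1)] by auto
qed

lemma two_connected_iff:
  assumes "represents H S"
  shows "two_connected H \<longleftrightarrow> biconn S"
  unfolding two_connected_def biconn_def connected_iff_cn[OF assms]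
  using cut_vertices_eq[OF assms] by auto

lemma blocks_eq:
  assumes "represents H S"
  shows "blocks H = {B. B \<subseteq> S \<and> biconn B \<and> (\<forall>T. B \<subset> T \<and> T \<subseteq> S \<longrightarrow> \<not> biconn T)}"
  unfolding blocks_def
  using two_connected_iff[OF represents_induce[OF assms]] representsD(3)[OF assms] by auto

lemma clq_cn: "clq S \<Longrightarrow> cn S"
  unfolding clq_def cn_def using conn_edge conn_refl by metis

lemma clq_biconn: "clq S \<Longrightarrow> S \<noteq> {} \<Longrightarrow> biconn S"
proof -
  assume S: "clq S" "S \<noteq> {}"
  have "clq (S - {v})" for v using S unfolding clq_def by blast
  then show ?thesis unfolding biconn_def using S clq_cn by blast
qed

text \<open>A walk is shortened to a path by cutting back whenever it returns to a visited vertex.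
  Distinctness is needed to split the cycle at a deleted vertex in
  \<open>biconn_cycle\<close>.\<close>

lemma conn_distinct_path:
  assumes "conn S a b" "a \<in> S"
  shows "\<exists>xs. distinct xs \<and> set xs \<subseteq> S \<and> xs \<noteq> [] \<and> hd xs = a \<and> last xs = b \<and> successively E xs"
  using assms(1)[unfolded conn_def]
proof (induction rule: rtranclp_induct)
  case base
  then show ?case using assms(2) by (intro exI[of _ "[a]"]) simp
next
  case (step y z)
  then obtain xs where xs: "distinct xs" "set xs \<subseteq> S" "xs \<noteq> []" "hd xs = a" "last xs = y" "successively E xs"
    by blast
  show ?case
  proof (cases "z \<in> set xs")
    case True
    then obtain ys zs where d: "xs = ys @ z # zs" by (meson split_list)
    have "successively E (ys @ [z])" using xs(6) unfolding d by (auto simp: successively_append_iff)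
    moreover have "hd (ys @ [z]) = a" using xs(4) unfolding d by (cases ys) auto
    ultimately show ?thesis
      using xs(1,2) unfolding d by (intro exI[of _ "ys @ [z]"]) auto
  next
    case False
    then show ?thesis
      using xs step by (intro exI[of _ "xs @ [z]"]) (auto simp: successively_append_iff)
  qed
qed

lemma successively_conn:
  assumes "successively E xs" "xs \<noteq> []" "y \<in> set xs"
  shows "conn (set xs) (hd xs) y" "conn (set xs) y (last xs)"
proof -
  have *: "conn (set xs) (hd xs) y"
    if "successively E xs" "xs \<noteq> []" "y \<in> set xs" for xs y
    using that
  proof (induction xs)
    case (Cons a xs)
    show ?case
    proof (cases "y = a")
      case False
      then have y: "y \<in> set xs" "xs \<noteq> []" using Cons.prems by auto
      then have s: "successively E xs" "E a (hd xs)" using Cons.prems by (auto simp: successively_Cons)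
      have "conn (set (a # xs)) (hd xs) y"
        by (rule conn_mono[OF Cons.IH[OF s(1) y(2,1)]]) auto
      moreover have "conn (set (a # xs)) a (hd xs)" using s y by (intro conn_edge) auto
      ultimately show ?thesis using conn_trans[of "set (a # xs)" a "hd xs" y] by simp
    qed simp
  qed simp
  show 1: "conn (set xs) (hd xs) y" using *[OF assms] .
  have "last xs \<in> set xs" using assms(2) by simp
  then show "conn (set xs) y (last xs)"
    using *[OF assms(1,2)] 1 conn_sym conn_trans by blast
qed

text \<open>A path in \<open>V - {w}\<close> between two neighbours of \<open>w\<close> closes up to a cycle through \<open>w\<close>.\<close>

lemma biconn_cycle:
  assumes xs: "distinct xs" "w \<notin> set xs" "xs \<noteq> []" "successively E xs" "E w (hd xs)" "E w (last xs)"
  shows "biconn (insert w (set xs))"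
proof -
  have w: "conn (insert w (set zs)) w y"
    if "successively E zs" "y \<in> set zs" "E w (hd zs) \<or> E w (last zs)" for zs y
  proof -
    have ne: "zs \<noteq> []" using that by auto
    have m: "conn (set zs) p q \<Longrightarrow> conn (insert w (set zs)) p q" for p q
      by (erule conn_mono) auto
    show ?thesis using that(3)
    proof
      assume "E w (hd zs)"
      then have "conn (insert w (set zs)) w (hd zs)" using ne by (intro conn_edge) auto
      then show ?thesis using m[OF successively_conn(1)[OF that(1) ne that(2)]] conn_trans by blast
    next
      assume "E w (last zs)"
      then have "conn (insert w (set zs)) w (last zs)" using ne by (intro conn_edge) auto
      then show ?thesis using m[OF successively_conn(2)[OF that(1) ne that(2)]] conn_trans conn_sym by blast
    qed
  qed
  have "cn (insert w (set xs))"
    by (rule cn_from) (use w[OF xs(4)] xs(5) in auto)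
  moreover have "cn (insert w (set xs) - {v})" if v: "v \<in> insert w (set xs)" for v
  proof (cases "v = w")
    case True
    have "cn (set xs)"
      unfolding cn_def using successively_conn(1)[OF xs(4,3)] conn_sym conn_trans by meson
    moreover have "insert w (set xs) - {v} = set xs" using True xs(2) by auto
    ultimately show ?thesis by simp
  next
    case False
    \<comment> \<open>Deleting \<open>v\<close> cuts the path in two. The first piece keeps the head
      and the second keeps the last vertex, so each piece, if nonempty, is still attached to
      \<open>w\<close>.\<close>
    then obtain ys zs where d: "xs = ys @ v # zs" using v by (meson insertE split_list)
    have sy: "successively E ys" "successively E zs"
      using xs(4) unfolding d by (auto simp: successively_append_iff successively_Cons)
    have eq: "insert w (set xs) - {v} = insert w (set ys \<union> set zs)"
      using xs(1,2) unfolding d by auto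
    show ?thesis
      unfolding eq
    proof (rule cn_from)
      fix y assume "y \<in> insert w (set ys \<union> set zs)"
      then consider "y = w" | "y \<in> set ys" | "y \<in> set zs" by blast
      then show "conn (insert w (set ys \<union> set zs)) w y"
      proof cases
        case 2
        then have "ys \<noteq> []" by auto
        then have "E w (hd ys)" using xs(5) unfolding d by simp
        then have "conn (insert w (set ys)) w y" using w[OF sy(1) 2] by blast
        then show ?thesis by (rule conn_mono) auto
      next
        case 3
        then have "zs \<noteq> []" by auto
        then have "E w (last zs)" using xs(6) unfolding d by simp
        then have "conn (insert w (set zs)) w y" using w[OF sy(2) 3] by blast
        then show ?thesis by (rule conn_mono) auto
      qed simp
    qed
  qed
  ultimately show ?thesis unfolding biconn_def by blast
qed

text \<open>The path from \<open>a\<close> to \<open>b\<close> together with \<open>w\<close> is a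
  cycle, hence biconnected, hence a clique. This turns the hypothesis on blocks into
  \<open>bg\<close>.\<close>

lemma bgraph_from_biconn:
  assumes "\<And>T. T \<subseteq> V \<Longrightarrow> biconn T \<Longrightarrow> clq T"
    and "E w a" "E w b" "a \<noteq> b" "conn (V - {w}) a b"
  shows "E a b"
proof -
  have "a \<in> V - {w}" using assms(2) irr E_V2 by auto
  then obtain xs where xs: "distinct xs" "set xs \<subseteq> V - {w}" "xs \<noteq> []" "hd xs = a" "last xs = b" "successively E xs"
    using conn_distinct_path[OF assms(5)] by blast
  have "biconn (insert w (set xs))" using xs assms(2,3) by (intro biconn_cycle) auto
  moreover have "insert w (set xs) \<subseteq> V" using xs(2) E_V[OF assms(2)] by auto
  ultimately have "clq (insert w (set xs))" using assms(1) by blast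
  moreover have "a \<in> set xs" "b \<in> set xs" using xs(3,4,5) by auto
  ultimately show ?thesis using assms(4) unfolding clq_def by blast
qed

end

section \<open>The recursions on a connected block graph\<close>

locale block_graph_rep = cbgraph V E for V :: "'a set" and E +
  fixes G :: "('a, 'b) pre_digraph"
  assumes rep: "represents G V"
    and biconn_clq: "T \<subseteq> V \<Longrightarrow> biconn T \<Longrightarrow> clq T"
begin

lemma verts_G: "verts G = V"
  using representsD(3)[OF rep] .

lemma dominates_G: "a \<rightarrow>\<^bsub>G\<^esub> b \<longleftrightarrow> E a b"
  using representsD(5)[OF rep, of a b] E_V E_V2 by blast

lemma biconn_iff_clq: "T \<subseteq> V \<Longrightarrow> biconn T \<longleftrightarrow> T \<noteq> {} \<and> clq T"
  using biconn_clq[of T] clq_biconn[of T] unfolding biconn_def by blast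

lemma blocks_maximal_cliques:
  assumes "represents P X"
  shows "blocks P = {B. B \<subseteq> X \<and> B \<noteq> {} \<and> clq B \<and> (\<forall>T. B \<subset> T \<and> T \<subseteq> X \<longrightarrow> \<not> clq T)}"
proof -
  have "biconn T \<longleftrightarrow> T \<noteq> {} \<and> clq T" if "T \<subseteq> X" for T
    using biconn_iff_clq representsD(4)[OF assms] that by blast
  then show ?thesis unfolding blocks_eq[OF assms] by blast
qed

lemma blocks_at_G: "blocks_at G u = BA u"
  unfolding blocks_at_def BA_def BL_def blocks_maximal_cliques[OF rep] by blast

lemma conn_side:
  assumes B: "B \<in> BA u" and y: "y \<in> side B u"
  shows "conn (insert u (side B u)) u y"
proof -
  obtain x where x: "x \<in> B" "x \<noteq> u" "conn (V - {u}) x y" using y unfolding side_def by auto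
  have xs: "x \<in> side B u" using x B_side by blast
  have "conn ((V - {u}) \<inter> side B u) x y"
    using conn_closed[OF x(3) xs] side_edge[OF B] by blast
  then have "conn (insert u (side B u)) x y" by (rule conn_mono) blast
  moreover have "conn (insert u (side B u)) u x"
    using BA_clq[OF B BA_V(3)[OF B] x(1)] x(2) xs by (intro conn_edge) auto
  ultimately show ?thesis using conn_trans by blast
qed

lemma cn_side: "B \<in> BA u \<Longrightarrow> cn (insert u (side B u))"
  by (rule cn_from) (use conn_side in auto)

lemma side_other_subset: "B \<in> BA u \<Longrightarrow> B' \<in> BA u - {B} \<Longrightarrow> insert u (side B' u) \<subseteq> hang u B"
  using hang_sides[of B u] hang_self[of B u] by blast

lemma conn_hang:
  assumes B: "B \<in> BA u" and y: "y \<in> hang u B"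
  shows "conn (hang u B) u y"
proof (cases "y = u")
  case False
  then obtain B' where B': "B' \<in> BA u - {B}" "y \<in> side B' u" using hang_sides[OF B] y by blast
  then have "conn (insert u (side B' u)) u y" using conn_side by blast
  then show ?thesis using side_other_subset[OF B B'(1)] by (rule conn_mono)
qed simp

lemma cn_hang: "B \<in> BA u \<Longrightarrow> cn (hang u B)"
  by (rule cn_from) (rule conn_hang)

text \<open>Used with \<open>S\<close> being \<open>B\<close> and \<open>V - B\<close>. Every edge
  leaving \<open>X\<close> is among the deleted ones by \<open>out\<close>, and no deleted edge lies
  inside \<open>X\<close> by \<open>ins\<close>; so \<open>X\<close> is closed and still connected
  after the deletion.\<close>

lemma represents_component:
  assumes X: "X \<subseteq> V" "u \<in> X" "cn X"
    and out: "\<And>a b. a \<in> X \<Longrightarrow> b \<notin> X \<Longrightarrow> E a b \<Longrightarrow> a = u \<and> b \<in> S"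
    and ins: "\<And>b. b \<in> S \<Longrightarrow> b \<in> X \<Longrightarrow> \<not> E u b"
  shows "represents (component_of (del_edges G u S) u) X"
proof -
  let ?D = "del_edges G u S"
  interpret G: fin_digraph G using representsD(1)[OF rep] .
  have D: "verts ?D = V" "tail ?D = tail G" "head ?D = head G"
      "arcs ?D = {e \<in> arcs G. \<not> (\<exists>v\<in>S. arc_to_ends G e = (u, v) \<or> arc_to_ends G e = (v, u))}"
    unfolding del_edges_def using verts_G by auto
  have fD: "fin_digraph ?D"
    by unfold_locales (auto simp: D verts_G[symmetric])
  have dom: "a \<rightarrow>\<^bsub>?D\<^esub> b \<longleftrightarrow> E a b \<and> \<not> (a = u \<and> b \<in> S) \<and> \<not> (b = u \<and> a \<in> S)" for a b
  proof -
    have "a \<rightarrow>\<^bsub>?D\<^esub> b \<longleftrightarrow> a \<rightarrow>\<^bsub>G\<^esub> b \<and> \<not> (a = u \<and> b \<in> S) \<and> \<not> (b = u \<and> a \<in> S)"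
      unfolding arcs_ends_def arc_to_ends_def D by (auto simp: image_iff)
    then show ?thesis using dominates_G by blast
  qed
  have inX: "a \<rightarrow>\<^bsub>?D\<^esub> b" if "a \<in> X" "b \<in> X" "E a b" for a b
    unfolding dom using that ins[of a] ins[of b] sym by blast
  have "y \<in> X" if "u \<rightarrow>\<^sup>*\<^bsub>?D\<^esub> y" for y
    using that unfolding reachable_def
  proof (induction rule: rtrancl_on_induct)
    case (step y z)
    then show ?case using out[of y z] dom by blast
  qed (use X in simp)
  moreover have r: "a \<rightarrow>\<^sup>*\<^bsub>?D\<^esub> b" if "a \<in> X" "b \<in> X" for a b
  proof -
    have "(\<lambda>x y. x \<in> X \<and> y \<in> X \<and> E x y)\<^sup>*\<^sup>* a b" using X(3) that unfolding cn_def conn_def by blast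
    then show ?thesis
      unfolding reachable_def
    proof (induction rule: rtranclp_induct)
      case base
      then show ?case using that X D(1) by auto
    next
      case (step y z)
      then have "(y, z) \<in> arcs_ends ?D" "z \<in> verts ?D" using inX X D(1) by blast+
      then show ?case using step by (auto intro: rtrancl_on_into_rtrancl_on)
    qed
  qed
  ultimately have scc: "pre_digraph.scc_of ?D u = X"
    unfolding pre_digraph.scc_of_def using X(2) by blast
  interpret D: fin_digraph ?D using fD .
  have "fin_digraph (?D \<restriction> X)"
    using X(1) finite_sub[OF X(1)] by unfold_locales auto
  moreover have "a \<rightarrow>\<^bsub>?D \<restriction> X\<^esub> b \<longleftrightarrow> a \<in> X \<and> b \<in> X \<and> a \<rightarrow>\<^bsub>?D\<^esub> b" for a b
    unfolding arcs_ends_conv by auto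
  ultimately show ?thesis
    unfolding represents_def component_of_def scc using X(1) inX dom by auto
qed

lemma represents_part_VB:
  assumes B: "B \<in> BA u"
  shows "represents (part G (VB u B)) (hang u B)"
proof -
  have "hang u B \<subseteq> V" unfolding hang_def by blast
  moreover have "\<not> E u b" if "b \<in> B" "b \<in> hang u B" for b
  proof -
    have "b = u" using hang_Int_B[OF B] that by blast
    then show ?thesis using irr by simp
  qed
  ultimately have "represents (component_of (del_edges G u B) u) (hang u B)"
    using hang_self[OF B] cn_hang[OF B] hang_edge[OF B] by (intro represents_component) blast+
  then show ?thesis by simp
qed

lemma represents_part_BV:
  assumes B: "B \<in> BA u"
  shows "represents (part G (BV B u)) (insert u (side B u))"
proof -
  have "insert u (side B u) \<subseteq> V" using side_subset[OF B] BA_V(2)[OF B] by blast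
  moreover have "a = u \<and> b \<in> V - B" if "a \<in> insert u (side B u)" "b \<notin> insert u (side B u)" "E a b" for a b
    using side_edge[OF B, of a b] that E_V2 B_side[of B u] by blast
  moreover have "\<not> E u b" if "b \<in> V - B" "b \<in> insert u (side B u)" for b
    using side_nb[OF B, of b] that irr by blast
  ultimately have "represents (component_of (del_edges G u (V - B)) u) (insert u (side B u))"
    using cn_side[OF B] by (intro represents_component) blast+
  then show ?thesis using verts_G by simp
qed

lemma verts_part:
  assumes "B \<in> BA u"
  shows "verts (part G (VB u B)) = hang u B" "verts (part G (BV B u)) = insert u (side B u)"
  using representsD(3)[OF represents_part_VB[OF assms]] representsD(3)[OF represents_part_BV[OF assms]] by auto

lemma beta_eq:
  assumes v: "valid u B"
  shows "beta G u B = BA u - {B}"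
proof -
  have B: "B \<in> BA u" using v unfolding valid_def by blast
  let ?X = "hang u B"
  have XV: "?X \<subseteq> V" unfolding hang_def by blast
  have sub: "B' \<subseteq> ?X" if "B' \<in> BA u - {B}" for B'
    using side_other_subset[OF B that] B_side[of B' u] by blast
  have beta: "beta G u B = {T. T \<subseteq> ?X \<and> T \<noteq> {} \<and> clq T \<and> (\<forall>S. T \<subset> S \<and> S \<subseteq> ?X \<longrightarrow> \<not> clq S) \<and> u \<in> T}"
    unfolding beta_def blocks_at_def blocks_maximal_cliques[OF represents_part_VB[OF B]] by blast
  show ?thesis
  proof (rule set_eqI, rule iffI)
    fix T assume "T \<in> beta G u B"
    then have T: "T \<subseteq> ?X" "clq T" "\<And>S. T \<subset> S \<Longrightarrow> S \<subseteq> ?X \<Longrightarrow> \<not> clq S" "u \<in> T"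
      unfolding beta by auto
    have "\<exists>B'\<in>BA u - {B}. T \<subseteq> B'"
    \<comment> \<open>For \<open>T = {u}\<close>, extending to a maximal clique might yield
      \<open>B\<close> itself, so the second block at \<open>u\<close> is taken instead. Otherwise
      another vertex of \<open>T\<close> lies outside \<open>B\<close> and excludes this.\<close>
    proof (cases "T = {u}")
      case True
      obtain B' where "B' \<in> BA u" "B' \<noteq> B" using BA_other[OF v] by blast
      then show ?thesis using True BA_V(3)[of B' u] by blast
    next
      case False
      then obtain x where x: "x \<in> T" "x \<noteq> u" using T(4) by blast
      obtain B' where B': "B' \<in> BL" "T \<subseteq> B'" using ex_BL[of T] T XV by blast
      have "x \<notin> B" using hang_Int_B[OF B] x T(1) by blast
      then have "B' \<in> BA u - {B}" using B' T(4) x unfolding BA_def by blast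
      then show ?thesis using B' by blast
    qed
    then obtain B' where B': "B' \<in> BA u - {B}" "T \<subseteq> B'" by blast
    have "clq B'" using B' unfolding BA_def BL_def by blast
    then have "T = B'" using T(3)[of B'] sub[OF B'(1)] B'(2) by blast
    then show "T \<in> BA u - {B}" using B' by simp
  next
    fix T assume T: "T \<in> BA u - {B}"
    then have "T \<noteq> {} \<and> clq T \<and> u \<in> T \<and> (\<forall>S. T \<subset> S \<and> S \<subseteq> V \<longrightarrow> \<not> clq S)"
      unfolding BA_def BL_def by blast
    then show "T \<in> beta G u B" unfolding beta using sub[OF T] XV by blast
  qed
qed

text \<open>The base is no cut-vertex of its part because the clique \<open>B - {u}\<close> holds
  the side together. If \<open>v\<close> lies in no other block, all remaining vertices hang at
  vertices of \<open>B\<close> other than \<open>v\<close> and stay joined to \<open>u\<close>. If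
  \<open>v\<close> lies in a second block, that block contains a vertex which \<open>u\<close>
  reaches only through \<open>v\<close>.\<close>

lemma kappa_eq:
  assumes B: "B \<in> BA u"
  shows "kappa G B u = kap B u"
proof -
  let ?X = "insert u (side B u)"
  have BX: "B \<subseteq> ?X" using B_side by blast
  have kp: "kappa G B u = {v \<in> B. \<not> cn (?X - {v})}"
    unfolding kappa_def cut_vertices_eq[OF represents_part_BV[OF B] cn_side[OF B]] using BX by blast
  have "\<not> cn (?X - {v}) \<longleftrightarrow> v \<noteq> u \<and> BA v \<noteq> {B}" if v: "v \<in> B" for v
  proof (cases "v = u")
    case True
    have "conn (side B u) x y" if "x \<in> side B u" "y \<in> side B u" for x y
    proof -
      have *: "\<exists>p\<in>B - {u}. conn (side B u) p z" if z: "z \<in> side B u" for z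
      proof -
        obtain p where p: "p \<in> B" "p \<noteq> u" "conn (V - {u}) p z" using z unfolding side_def by auto
        have "conn ((V - {u}) \<inter> side B u) p z"
          using conn_closed[OF p(3), of "side B u"] p side_edge[OF B] B_side[of B u] by blast
        then show ?thesis using p conn_mono by blast
      qed
      obtain p where p: "p \<in> B - {u}" "conn (side B u) p x" using *[OF \<open>x \<in> side B u\<close>] by blast
      obtain q where q: "q \<in> B - {u}" "conn (side B u) q y" using *[OF \<open>y \<in> side B u\<close>] by blast
      have "conn (side B u) p q"
      proof (cases "p = q")
        case False
        then show ?thesis using p q BA_clq[OF B, of p q] B_side[of B u] by (intro conn_edge) blast+
      qed simp
      then show ?thesis using p q conn_sym conn_trans by blast
    qed
    moreover have "?X - {u} = side B u" using side_subset[OF B] by blast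
    ultimately show ?thesis unfolding True cn_def by simp
  next
    case False
    have Bv: "B \<in> BA v" using BA_swap[OF B v] .
    show ?thesis
    proof (cases "BA v = {B}")
      case True
      then have hv: "hang v B = {v}" using hang_sides[OF Bv] hang_self[OF Bv] by auto
      have "conn (?X - {v}) u y" if y: "y \<in> ?X - {v}" for y
      proof (cases "y = u")
        case False
        then have "y \<in> side B u" using y by blast
        then obtain b where b: "b \<in> B - {u}" "y \<in> hang b B" using side_subset_hang[OF B] by blast
        have bv: "b \<noteq> v" using b hv y by blast
        have Bb: "B \<in> BA b" using BA_swap[OF B] b by blast
        have "v \<notin> hang b B" using hang_Int_B[OF Bb] v bv by auto
        then have "hang b B \<subseteq> ?X - {v}" using hang_subset_side[OF B] b by blast
        then have "conn (?X - {v}) b y" by (rule conn_mono[OF conn_hang[OF Bb b(2)]])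
        moreover have "conn (?X - {v}) u b"
          using b bv BX \<open>v \<noteq> u\<close> BA_clq[OF B BA_V(3)[OF B], of b] by (intro conn_edge) auto
        ultimately show ?thesis using conn_trans by blast
      qed simp
      then have "cn (?X - {v})" by (rule cn_from)
      then show ?thesis using True by blast
    next
      case False
      then have vv: "valid v B" using Bv unfolding valid_def by blast
      obtain B' where B': "B' \<in> BA v" "B' \<noteq> B" using BA_other[OF vv] by blast
      have "valid v B'" using B' Bv unfolding valid_def by blast
      then obtain x where x: "x \<in> B'" "x \<noteq> v" using valid_ex by blast
      have xs: "x \<in> side B' v" using x B_side by blast
      then have xh: "x \<in> hang v B" using side_other_subset[OF Bv] B' by blast
      then have xX: "x \<in> ?X - {v}" using hang_subset_side[OF B v \<open>v \<noteq> u\<close>] x by blast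
      have "\<not> conn (?X - {v}) u x"
      proof
        assume "conn (?X - {v}) u x"
        then have "conn (V - {v}) u x"
          using side_subset[OF B] BA_V(2)[OF B] by (elim conn_mono) blast
        then have "x \<in> side B v" using BA_V(3)[OF B] \<open>v \<noteq> u\<close> unfolding side_def by blast
        then show False using xh unfolding hang_def by blast
      qed
      then have "\<not> cn (?X - {v})" using xX \<open>v \<noteq> u\<close> unfolding cn_def by blast
      then show ?thesis using False \<open>v \<noteq> u\<close> by blast
    qed
  qed
  then show ?thesis unfolding kp kap_def by blast
qed

text \<open>The sides of the two blocks are nonempty and lie in different components of
  \<open>V - {u}\<close>. It supplies the cut-vertex condition of \<open>rigid\<close>, which
  \<open>rig_iff_potential\<close> expresses by two distinct blocks.\<close>

lemma cut_vertex_iff: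
  assumes "B \<in> BA u" "B' \<in> BA u" "B \<noteq> B'"
  shows "u \<in> cut_vertices G"
proof -
  have "valid u B" "valid u B'" using assms unfolding valid_def by auto
  then obtain x x' where x: "x \<in> B" "x \<noteq> u" "x' \<in> B'" "x' \<noteq> u" using valid_ex by meson
  have "\<not> conn (V - {u}) x x'"
  proof
    assume "conn (V - {u}) x x'"
    then have "x' \<in> side B u" using x unfolding side_def by blast
    then show False using side_disj[OF assms(1,2)] B_side[of B' u] x assms(3) by blast
  qed
  then have "\<not> cn (V - {u})"
    using x BA_V(1)[OF assms(1)] BA_V(1)[OF assms(2)] unfolding cn_def by blast
  then show ?thesis
    unfolding cut_vertices_eq[OF rep cn_V] using BA_V(2)[OF assms(1)] by blast
qed

text \<open>Termination by \<open>valid_induct\<close>, as for the other two recursions: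
  \<open>valid\<close> holds for all arguments of recursive calls once \<open>kappa\<close> and
  \<open>beta\<close> are rewritten to \<open>kap\<close> and \<open>BA u - {B}\<close>.\<close>

lemma depth_dom:
  assumes "valid u B"
  shows "depth_dom (G, BV B u) \<and> depth_dom (G, VB u B)"
  using assms
proof (induction rule: valid_induct)
  case (BV u B)
  then have B: "B \<in> BA u" unfolding valid_def by blast
  show ?case
    by (rule depth.domintros) (use BV(2) kappa_eq[OF B] kap_valid[OF _ B] in blast)
next
  case (VB u B)
  then have B: "B \<in> BA u" unfolding valid_def by blast
  show ?case
    by (rule depth.domintros) (use VB beta_eq[OF VB(1)] other_valid[OF _ B] in blast)
qed

lemma ua_dom:
  assumes "valid u B"
  shows "ua_dom (G, BV B u) \<and> ua_dom (G, VB u B)"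
  using assms
proof (induction rule: valid_induct)
  case (BV u B)
  then have B: "B \<in> BA u" unfolding valid_def by blast
  show ?case
    by (rule ua.domintros) (use BV(2) kappa_eq[OF B] kap_valid[OF _ B] in blast)
next
  case (VB u B)
  then have B: "B \<in> BA u" unfolding valid_def by blast
  show ?case
    by (rule ua.domintros) (use VB beta_eq[OF VB(1)] other_valid[OF _ B] in blast)
qed

lemma cap_dom:
  assumes "valid u B"
  shows "(\<forall>C. cap_dom (G, BV B u, C)) \<and> (\<forall>C. cap_dom (G, VB u B, C))"
  using assms
proof (induction rule: valid_induct)
  case (BV u B)
  then have B: "B \<in> BA u" unfolding valid_def by blast
  show ?case
    by (intro allI, rule cap.domintros) (use BV(2) kappa_eq[OF B] kap_valid[OF _ B] in blast)
next
  case (VB u B)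
  then have B: "B \<in> BA u" unfolding valid_def by blast
  show ?case
    by (intro allI, rule cap.domintros) (use VB beta_eq[OF VB(1)] other_valid[OF _ B] in blast)+
qed

text \<open>The case of depth 0 needs no separate clause: then \<open>kap B u\<close> is empty, and
  a block at a cut-vertex is never \<open>{u}\<close>, so the right-hand side is True
  anyway.\<close>

lemma ua_BV:
  assumes v: "valid u B"
  shows "ua G (BV B u) \<longleftrightarrow> \<not> ((\<forall>x\<in>kap B u. ua G (VB x B)) \<and> B = kap B u \<union> {u})"
proof -
  have B: "B \<in> BA u" using v unfolding valid_def by blast
  have "depth G (BV B u) = 0 \<longleftrightarrow> kap B u = {}"
    using depth.psimps(1)[OF conjunct1[OF depth_dom[OF v]]] kappa_eq[OF B] by simp
  moreover have "B \<noteq> {} \<union> {u}" using valid_ex[OF v] by blast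
  ultimately show ?thesis
    using ua.psimps(1)[OF conjunct1[OF ua_dom[OF v]]] kappa_eq[OF B] by auto
qed

lemma ua_VB:
  assumes v: "valid u B"
  shows "ua G (VB u B) \<longleftrightarrow> (\<exists>B'\<in>BA u - {B}. ua G (BV B' u))"
  using ua.psimps(2)[OF conjunct2[OF ua_dom[OF v]]] depth.psimps(2)[OF conjunct2[OF depth_dom[OF v]]]
    beta_eq[OF v] by simp

lemma cap_BV_restricted:
  assumes v: "valid u B"
  shows "cap G (BV B u) C = (\<Sum>x\<in>kap B u. cap G (VB x B) (C \<inter> hang x B))
    + of_bool (ua G (BV B u)) - int (card (B \<inter> (C - {u})))"
proof -
  have B: "B \<in> BA u" using v unfolding valid_def by blast
  have "verts (part G (VB x B)) = hang x B" if "x \<in> kap B u" for x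
    using verts_part(1)[of B x] BA_swap[OF B] kap_in(1)[OF that] by blast
  then show ?thesis
    using cap.psimps(1)[OF spec[OF conjunct1[OF cap_dom[OF v]], of C]] kappa_eq[OF B]
    by (simp del: part.simps cong: sum.cong)
qed

lemma cap_VB_restricted:
  assumes v: "valid u B"
  shows "cap G (VB u B) C =
    (if \<exists>B'\<in>BA u - {B}. cap G (BV B' u) (C \<inter> insert u (side B' u)) = 0 \<and> ua G (BV B' u) then 0
     else (\<Sum>B'\<in>BA u - {B}. cap G (BV B' u) (C \<inter> insert u (side B' u)) - of_bool (ua G (BV B' u)))
       + of_bool (ua G (VB u B)))"
proof -
  have vp: "verts (part G (BV B' u)) = insert u (side B' u)" if "B' \<in> BA u - {B}" for B'
    using verts_part(2)[of B' u] that by blast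
  have "(\<exists>B'\<in>BA u - {B}. cap G (BV B' u) (C \<inter> verts (part G (BV B' u))) = 0 \<and> ua G (BV B' u)) \<longleftrightarrow>
      (\<exists>B'\<in>BA u - {B}. cap G (BV B' u) (C \<inter> insert u (side B' u)) = 0 \<and> ua G (BV B' u))"
    by (rule bex_cong[OF refl]) (simp only: vp)
  moreover have "(\<Sum>B'\<in>BA u - {B}. cap G (BV B' u) (C \<inter> verts (part G (BV B' u))) - of_bool (ua G (BV B' u))) =
      (\<Sum>B'\<in>BA u - {B}. cap G (BV B' u) (C \<inter> insert u (side B' u)) - of_bool (ua G (BV B' u)))"
    by (rule sum.cong[OF refl]) (simp only: vp)
  ultimately show ?thesis
    using cap.psimps(2)[OF spec[OF conjunct2[OF cap_dom[OF v]], of C]] beta_eq[OF v]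
    by (simp only:)
qed

text \<open>The recursion restricts its argument to still smaller parts, so a restriction to the
  whole part beforehand is invisible. With \<open>cap_VB_Int\<close> this removes all
  restrictions.\<close>

lemma cap_BV_Int:
  assumes v: "valid u B"
  shows "cap G (BV B u) (C \<inter> insert u (side B u)) = cap G (BV B u) C"
proof -
  have B: "B \<in> BA u" using v unfolding valid_def by blast
  let ?X = "insert u (side B u)"
  have "C \<inter> ?X \<inter> hang x B = C \<inter> hang x B" if "x \<in> kap B u" for x
    using hang_subset_side[OF B kap_in[OF that]] by blast
  moreover have "B \<inter> (C \<inter> ?X - {u}) = B \<inter> (C - {u})" using B_side[of B u] by blast
  ultimately show ?thesis unfolding cap_BV_restricted[OF v] by (simp cong: sum.cong)
qed

lemma cap_VB_Int:
  assumes v: "valid u B"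
  shows "cap G (VB u B) (C \<inter> hang u B) = cap G (VB u B) C"
proof -
  have B: "B \<in> BA u" using v unfolding valid_def by blast
  have e: "C \<inter> hang u B \<inter> insert u (side B' u) = C \<inter> insert u (side B' u)" if "B' \<in> BA u - {B}" for B'
    using side_other_subset[OF B that] by blast
  have "(\<exists>B'\<in>BA u - {B}. cap G (BV B' u) (C \<inter> hang u B \<inter> insert u (side B' u)) = 0 \<and> ua G (BV B' u)) \<longleftrightarrow>
      (\<exists>B'\<in>BA u - {B}. cap G (BV B' u) (C \<inter> insert u (side B' u)) = 0 \<and> ua G (BV B' u))"
    by (rule bex_cong[OF refl]) (simp only: e)
  moreover have "(\<Sum>B'\<in>BA u - {B}. cap G (BV B' u) (C \<inter> hang u B \<inter> insert u (side B' u)) - of_bool (ua G (BV B' u))) =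
      (\<Sum>B'\<in>BA u - {B}. cap G (BV B' u) (C \<inter> insert u (side B' u)) - of_bool (ua G (BV B' u)))"
    by (rule sum.cong[OF refl]) (simp only: e)
  ultimately show ?thesis unfolding cap_VB_restricted[OF v] by (simp only:)
qed

sublocale capacity V E "\<lambda>u B. ua G (VB u B)" "\<lambda>B u. ua G (BV B u)"
  "\<lambda>u B. cap G (VB u B)" "\<lambda>B u. cap G (BV B u)"
proof
  fix u B C assume v: "valid u B"
  then have B: "B \<in> BA u" unfolding valid_def by blast
  show "ua G (BV B u) \<longleftrightarrow> \<not> ((\<forall>v\<in>kap B u. ua G (VB v B)) \<and> B = kap B u \<union> {u})"
    by (rule ua_BV[OF v])
  show "ua G (VB u B) \<longleftrightarrow> (\<exists>B'\<in>BA u - {B}. ua G (BV B' u))"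
    by (rule ua_VB[OF v])
  have "(\<Sum>x\<in>kap B u. cap G (VB x B) (C \<inter> hang x B)) = (\<Sum>x\<in>kap B u. cap G (VB x B) C)"
    using cap_VB_Int kap_valid[OF _ B] by (intro sum.cong refl) blast
  then show "cap G (BV B u) C = (\<Sum>v\<in>kap B u. cap G (VB v B) C) + of_bool (ua G (BV B u))
      - int (card (B \<inter> (C - {u})))"
    using cap_BV_restricted[OF v, of C] by (simp only:)
  have e: "cap G (BV B' u) (C \<inter> insert u (side B' u)) = cap G (BV B' u) C" if "B' \<in> BA u - {B}" for B'
    using cap_BV_Int other_valid[OF that B] by blast
  have "(\<exists>B'\<in>BA u - {B}. cap G (BV B' u) (C \<inter> insert u (side B' u)) = 0 \<and> ua G (BV B' u)) \<longleftrightarrow>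
      (\<exists>B'\<in>BA u - {B}. cap G (BV B' u) C = 0 \<and> ua G (BV B' u))"
    by (rule bex_cong[OF refl]) (simp only: e)
  moreover have "(\<Sum>B'\<in>BA u - {B}. cap G (BV B' u) (C \<inter> insert u (side B' u)) - of_bool (ua G (BV B' u))) =
      (\<Sum>B'\<in>BA u - {B}. cap G (BV B' u) C - of_bool (ua G (BV B' u)))"
    by (rule sum.cong[OF refl]) (simp only: e)
  ultimately show "cap G (VB u B) C =
      (if \<exists>B'\<in>BA u - {B}. cap G (BV B' u) C = 0 \<and> ua G (BV B' u) then 0
       else (\<Sum>B'\<in>BA u - {B}. cap G (BV B' u) C - of_bool (ua G (BV B' u))) + of_bool (ua G (VB u B)))"
    using cap_VB_restricted[OF v, of C] by (simp only:)
qed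

section \<open>Translation of sliding, potential and rigidity, and the conclusion\<close>

lemma independent_iff: "independent G C \<longleftrightarrow> C \<subseteq> V \<and> ind C"
  unfolding independent_def ind_def verts_G dominates_G ..

lemma step_iff: "step G I J \<longleftrightarrow> independent G I \<and> (I = J \<or> mv V I J)"
proof
  assume s: "step G I J"
  show "independent G I \<and> (I = J \<or> mv V I J)"
  proof (cases "I = J")
    case False
    then obtain a b where ab: "I - J = {a}" "J - I = {b}" "E a b" "I \<subseteq> V" "J \<subseteq> V" "ind I" "ind J"
      using s unfolding step_def independent_iff dominates_G by blast
    then have "J = insert b (I - {a})" "a \<in> I" "b \<notin> I" by blast+
    then show ?thesis using s ab unfolding step_def mv_def by blast
  qed (use s in \<open>simp add: step_def\<close>)
next
  assume s: "independent G I \<and> (I = J \<or> mv V I J)"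
  show "step G I J"
  proof (cases "I = J")
    case False
    then have "mv V I J" using s by blast
    then obtain a b where ab: "a \<in> I" "b \<notin> I" "a \<in> V" "b \<in> V" "E a b" "J = insert b (I - {a})"
        "I \<subseteq> V" "J \<subseteq> V" "ind I" "ind J"
      by (rule mvE)
    then have "I - J = {a}" "J - I = {b}" using irr by auto
    then show ?thesis unfolding step_def independent_iff dominates_G using ab by blast
  qed (use s in \<open>simp add: step_def\<close>)
qed

lemma reachable_from_iff: "reachable_from G I J \<longleftrightarrow> reach V I J"
proof
  assume r: "reachable_from G I J"
  then have "(step G)\<^sup>*\<^sup>* I J" "independent G I" unfolding reachable_from_def by auto
  then show "reach V I J"
  proof (induction rule: rtranclp_induct)
    case base
    then show ?case using reach_refl unfolding independent_iff by blast
  next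
    case (step J K)
    then show ?case using reach_step unfolding step_iff by blast
  qed
next
  assume "reach V I J"
  then show "reachable_from G I J"
  proof (induction rule: reach_induct)
    case base
    then show ?case unfolding reachable_from_def independent_iff by blast
  next
    case (step J K)
    then have "step G J K" using reach_in[OF step(1)] unfolding step_iff independent_iff by blast
    then show ?case using step unfolding reachable_from_def by (meson rtranclp.rtrancl_into_rtrancl)
  qed
qed

lemma pot_eq:
  assumes v: "valid u B"
  shows "pot G C (BV B u) = potential B u C"
proof -
  have B: "B \<in> BA u" using v unfolding valid_def by blast
  have "D \<inter> insert u (side B u) - {u} = D \<inter> side B u" for D
    using side_subset[OF B] by blast
  then show ?thesis
    unfolding pot_def potential_def verts_part(2)[OF B] base.simps reachable_from_iff cap_BV_Int[OF v]
    by simp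
qed

lemma rigid_iff_rig:
  assumes "independent G C"
  shows "rigid G C u \<longleftrightarrow> u \<in> rig V C"
proof -
  have C: "C \<subseteq> V" "ind C" using assms independent_iff by auto
  have "pot G C (BV B u) = potential B u C \<and> pot G C (BV B' u) = potential B' u C \<and> u \<in> cut_vertices G"
    if "B \<in> BA u" "B' \<in> BA u" "B \<noteq> B'" for B B'
    using that pot_eq[of u B] pot_eq[of u B'] cut_vertex_iff[OF that] unfolding valid_def by blast
  then show ?thesis
    unfolding rigid_def blocks_at_G rig_iff_potential[OF C] by metis
qed

theorem reachable_from_iff_rigid:
  assumes C1: "independent G C1" and C2: "independent G C2"
    and "W1 = {u. rigid G C1 u}" and "W2 = {u. rigid G C2 u}"
  shows "reachable_from G C2 C1 \<longleftrightarrow> W1 = W2 \<and>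
    (\<forall>H \<in> pre_digraph.sccs (G \<restriction> (verts G - W1)). card (C1 \<inter> verts H) = card (C2 \<inter> verts H))"
proof -
  have W: "W1 = rig V C1" "W2 = rig V C2" using assms rigid_iff_rig by auto
  have "reachable_from G C2 C1 \<longleftrightarrow> reach V C1 C2"
    unfolding reachable_from_iff using reach_sym by blast
  also have "\<dots> \<longleftrightarrow> W1 = W2 \<and> (\<forall>X \<in> comp (V - W1) ` (V - W1). card (C1 \<inter> X) = card (C2 \<inter> X))"
    unfolding W using C1 C2 unfolding independent_iff by (intro reach_iff_rig) blast+
  also have "comp (V - W1) ` (V - W1) = verts ` pre_digraph.sccs (G \<restriction> (verts G - W1))"
    unfolding verts_G by (rule sccs_eq_comp(1)[OF represents_induce[OF rep Diff_subset], symmetric])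
  finally show ?thesis by simp
qed

end

theorem theorem8p3:
  fixes G :: "('a, 'b) pre_digraph" and C1 C2 W1 W2 :: "'a set"
  assumes "block_graph G" and "Digraph_Component.connected G"
    and "independent G C1" and "independent G C2"
    and "W1 = {u. rigid G C1 u}" and "W2 = {u. rigid G C2 u}"
  shows "reachable_from G C2 C1 \<longleftrightarrow>
    W1 = W2 \<and>
    (\<forall>H \<in> pre_digraph.sccs (G \<restriction> (verts G - W1)).
       card (C1 \<inter> verts H) = card (C2 \<inter> verts H))"
proof -
  interpret graph G using assms(1) unfolding block_graph_def by blast
  define E where "E = (\<lambda>a b. a \<rightarrow>\<^bsub>G\<^esub> b)"
  interpret ugraph "verts G" E
  proof
    show "finite (verts G)" by simp
    show "E b a" if "E a b" for a b using that graph_symmetric unfolding E_def by blast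
    show "\<not> E a a" for a unfolding E_def using adj_not_same by blast
    show "a \<in> verts G" if "E a b" for a b using that unfolding E_def by (rule adj_in_verts)
  qed
  have rep: "represents G (verts G)"
    unfolding represents_def using fin_digraph_axioms adj_in_verts unfolding E_def by blast
  have bc: "clq T" if T: "T \<subseteq> verts G" "biconn T" for T
  proof -
    \<comment> \<open>A biconnected set need not be a block, but it extends to a maximal one, which
      is a block and therefore a clique.\<close>
    define F where "F = {S. S \<subseteq> verts G \<and> biconn S}"
    have "finite F" unfolding F_def by (rule finite_subset[of _ "Pow (verts G)"]) auto
    moreover have "T \<in> F" unfolding F_def using T by blast
    ultimately obtain B where B: "B \<in> F" "T \<subseteq> B" "\<forall>S\<in>F. B \<subseteq> S \<longrightarrow> B = S"
      using finite_has_maximal2[of F T] by blast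
    then have "B \<in> blocks G" unfolding blocks_eq[OF rep] F_def by blast
    then have "clique G B" using assms(1) unfolding block_graph_def by blast
    then have "E a b" if "a \<in> B" "b \<in> B" "a \<noteq> b" for a b
      using that unfolding clique_def E_def by blast
    then show ?thesis using B(2) unfolding clq_def by blast
  qed
  interpret block_graph_rep "verts G" E G
  proof
    show "E a b" if "E w a" "E w b" "a \<noteq> b" "conn (verts G - {w}) a b" for w a b
      using bgraph_from_biconn[OF bc that] .
    show "cn (verts G)" using assms(2) connected_iff_cn[OF rep] by blast
  qed (use rep bc in auto)
  show ?thesis using reachable_from_iff_rigid[OF assms(3-6)] .
qed

end
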